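(* Let $M$ be a $2n$-dimensional symplectic manifold and let $\mathcal{A}$ be a vector subspace of $C^\infty(M)$ which is closed under complex conjugation. Suppose that the following conditions are satisfied: (1) $\mathcal{A}$ is a commutative algebra for the Poisson brackets of $M$, i.e. $\{a,b\} = 0$ for every $a,b \in \mathcal{A}$; and (2) for every $p \in M$ there exist real-valued elements $a_1, \dots, a_n \in \mathcal{A}$ such that the differentials $d(a_1)_p, \dots, d(a_n)_p$ are linearly independent over $\mathbb{R}$. Then there is a Lagrangian foliation $\mathcal{F}$ of $M$ such that $\mathcal{A} \subseteq \mathcal{A}_{\mathcal{F}}(M)$.
   Context: $C^\infty(M)$ is the space of smooth complex-valued functions on a manifold $M$. For a symplectic manifold $M$ with symplectic form $\omega$ and $f\in C^\infty(M)$, the Hamiltonian field $X_f$ is the smooth (complex, if $f$ is not real-valued) vector field satisfying $df(X)=\omega(X_f,X)$ for every vector field $X$ on $M$. The Poisson bracket of $f,g\in C^\infty(M)$ is $\{f,g\}=\omega(X_f,X_g)=df(X_g)$. A foliation $\mathcal{F}$ of a manifold $M$ is a decomposition of $M$ into connected (immersed) submanifolds, the leaves, given by a foliated atlas. A foliated chart is a smooth submersion $\varphi:U\to\mathbb{R}^k$ from an open $U\subseteq M$ onto an open subset of $\mathbb{R}^k$. Two foliated charts $\varphi,\psi$ with domains $U,V$ are compatible if there is a diffeomorphism $\xi:\varphi(U\cap V)\to\psi(U\cap V)$ with $\xi\circ\varphi=\psi$ on $U\cap V$. A foliated atlas is a family of compatible foliated charts, all with the same $k$, whose domains cover $M$.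 The plaques are the connected components of the fibers of the foliated charts, and the leaves are the equivalence classes of the relation: $x\sim y$ iff there is a finite sequence of plaques $P_0,\dots,P_l$ with $x\in P_0$, $y\in P_l$ and $P_{j-1}\cap P_j\neq\emptyset$ for $j=1,\dots,l$. A foliation of a symplectic manifold is Lagrangian if its leaves are Lagrangian submanifolds. For a foliation $\mathcal{F}$ of $M$, $\mathcal{A}_{\mathcal{F}}(M)$ is the vector subspace of $C^\infty(M)$ of functions which are constant along every leaf of $\mathcal{F}$. *)

theory Defs
  imports "HOL-Analysis.Analysis"
begin

section \<open>Smooth maps between normed spaces\<close>

text \<open>The library has no notion of a \<open>C\<^sup>\<infinity>\<close> map. Both predicates below are meant for open \<open>S\<close>
  and finite-dimensional spaces: all iterated directional derivatives exist and are continuous.\<close>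

primrec Ck_on :: "nat \<Rightarrow> 'a::real_normed_vector set \<Rightarrow> ('a \<Rightarrow> 'b::real_normed_vector) \<Rightarrow> bool" where
  "Ck_on 0 S f \<longleftrightarrow> continuous_on S f"
| "Ck_on (Suc k) S f \<longleftrightarrow>
     (\<forall>x\<in>S. f differentiable (at x)) \<and> (\<forall>v. Ck_on k S (\<lambda>x. frechet_derivative f (at x) v))"

definition smooth_on :: "'a::real_normed_vector set \<Rightarrow> ('a \<Rightarrow> 'b::real_normed_vector) \<Rightarrow> bool" where
  "smooth_on S f \<longleftrightarrow> (\<forall>k. Ck_on k S f)"

definition diffeomorphism ::
    "'a::real_normed_vector set \<Rightarrow> 'b::real_normed_vector set \<Rightarrow> ('a \<Rightarrow> 'b) \<Rightarrow> bool" where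
  "diffeomorphism S T f \<longleftrightarrow>
     open S \<and> open T \<and> bij_betw f S T \<and> smooth_on S f \<and> smooth_on T (inv_into S f)"

section \<open>Smooth manifolds\<close>

text \<open>A manifold is a topology \<open>X\<close> (the point set is \<open>topspace X\<close>) with a smooth atlas \<open>A\<close>.
  Its dimension is \<open>CARD('d)\<close>. Atlases need not be maximal.
  A function on the manifold is a total function on the type of points;
  its values outside \<open>topspace X\<close> play no role.\<close>

type_synonym ('m, 'd) chart = "'m set \<times> ('m \<Rightarrow> real ^ 'd)"

definition inv_chart :: "('m, 'd::finite) chart \<Rightarrow> real ^ 'd \<Rightarrow> 'm" where
  "inv_chart c = inv_into (fst c) (snd c)"

definition is_chart :: "'m topology \<Rightarrow> ('m, 'd::finite) chart \<Rightarrow> bool" where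
  "is_chart X c \<longleftrightarrow> openin X (fst c) \<and> open (snd c ` fst c) \<and>
     homeomorphic_map (subtopology X (fst c)) (top_of_set (snd c ` fst c)) (snd c)"

definition smooth_manifold :: "'m topology \<Rightarrow> ('m, 'd::finite) chart set \<Rightarrow> bool" where
  "smooth_manifold X A \<longleftrightarrow>
     Hausdorff_space X \<and> second_countable X \<and>
     (\<forall>c\<in>A. is_chart X c) \<and> (\<Union>c\<in>A. fst c) = topspace X \<and>
     (\<forall>c\<in>A. \<forall>c'\<in>A. smooth_on (snd c ` (fst c \<inter> fst c')) (snd c' \<circ> inv_chart c))"

text \<open>Smoothness on an open subset \<open>U\<close> of the manifold of a map into a normed space.\<close>

definition smooth_fun_on ::
    "('m, 'd::finite) chart set \<Rightarrow> 'm set \<Rightarrow> ('m \<Rightarrow> 'b::real_normed_vector) \<Rightarrow> bool" where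
  "smooth_fun_on A U f \<longleftrightarrow> (\<forall>c\<in>A. smooth_on (snd c ` (fst c \<inter> U)) (f \<circ> inv_chart c))"

definition smooth_functions ::
    "'m topology \<Rightarrow> ('m, 'd::finite) chart set \<Rightarrow> ('m \<Rightarrow> complex) set" where
  "smooth_functions X A = {f. smooth_fun_on A (topspace X) f}"

definition smooth_map ::
    "'m topology \<Rightarrow> ('m, 'd::finite) chart set \<Rightarrow> 'p topology \<Rightarrow> ('p, 'e::finite) chart set \<Rightarrow>
     ('m \<Rightarrow> 'p) \<Rightarrow> bool" where
  "smooth_map X A Y B f \<longleftrightarrow> continuous_map X Y f \<and>
     (\<forall>c\<in>A. \<forall>c'\<in>B. smooth_on (snd c ` (fst c \<inter> f -` fst c')) (snd c' \<circ> f \<circ> inv_chart c))"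

section \<open>Tangent spaces and differentials\<close>

text \<open>Each point \<open>p\<close> gets a fixed chart \<open>chart_at A p\<close> around it, and a tangent vector at \<open>p\<close> is
  represented by its coordinates in that chart, so that the tangent space at \<open>p\<close> is the type
  \<open>real ^ 'd\<close> and its complexification is \<open>complex ^ 'd\<close>.
  Hence every function from points to \<open>real ^ 'd\<close> (or \<open>complex ^ 'd\<close>) is a, possibly
  discontinuous, (complex) vector field.\<close>

definition chart_at :: "('m, 'd::finite) chart set \<Rightarrow> 'm \<Rightarrow> ('m, 'd) chart" where
  "chart_at A p = (SOME c. c \<in> A \<and> p \<in> fst c)"

definition differential ::
    "('m, 'd::finite) chart set \<Rightarrow> ('m \<Rightarrow> 'b::real_normed_vector) \<Rightarrow> 'm \<Rightarrow> real ^ 'd \<Rightarrow> 'b" where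
  "differential A f p =
     frechet_derivative (f \<circ> inv_chart (chart_at A p)) (at (snd (chart_at A p) p))"

definition tangent_map ::
    "('m, 'd::finite) chart set \<Rightarrow> ('p, 'e::finite) chart set \<Rightarrow> ('m \<Rightarrow> 'p) \<Rightarrow> 'm \<Rightarrow>
     real ^ 'd \<Rightarrow> real ^ 'e" where
  "tangent_map A B f p = differential A (snd (chart_at B (f p)) \<circ> f) p"

text \<open>The tangent vector at \<open>inv_chart c x\<close> whose coordinates in the chart \<open>c\<close> are \<open>u\<close>.\<close>

definition coord_vector ::
    "('m, 'd::finite) chart set \<Rightarrow> ('m, 'd) chart \<Rightarrow> real ^ 'd \<Rightarrow> real ^ 'd \<Rightarrow> real ^ 'd" where
  "coord_vector A c x u =
     frechet_derivative (snd (chart_at A (inv_chart c x)) \<circ> inv_chart c) (at x) u"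

text \<open>\<open>differential A (snd c) p v\<close> is the coordinate vector of \<open>v\<close> in the chart \<open>c\<close>.\<close>

definition smooth_vector_field ::
    "('m, 'd::finite) chart set \<Rightarrow> ('m \<Rightarrow> real ^ 'd) \<Rightarrow> bool" where
  "smooth_vector_field A Y \<longleftrightarrow>
     (\<forall>c\<in>A. smooth_on (snd c ` fst c)
        (\<lambda>x. differential A (snd c) (inv_chart c x) (Y (inv_chart c x))))"

definition Re_vec :: "complex ^ 'd \<Rightarrow> real ^ 'd" where
  "Re_vec v = (\<chi> i. Re (v $ i))"

definition Im_vec :: "complex ^ 'd \<Rightarrow> real ^ 'd" where
  "Im_vec v = (\<chi> i. Im (v $ i))"

definition smooth_complex_vector_field ::
    "('m, 'd::finite) chart set \<Rightarrow> ('m \<Rightarrow> complex ^ 'd) \<Rightarrow> bool" where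
  "smooth_complex_vector_field A Z \<longleftrightarrow>
     smooth_vector_field A (\<lambda>p. Re_vec (Z p)) \<and> smooth_vector_field A (\<lambda>p. Im_vec (Z p))"

text \<open>Complex-linear, respectively complex-bilinear, extensions to \<open>complex ^ 'd\<close>.\<close>

definition complex_ext :: "(real ^ 'd \<Rightarrow> complex) \<Rightarrow> complex ^ 'd \<Rightarrow> complex" where
  "complex_ext L v = L (Re_vec v) + \<i> * L (Im_vec v)"

definition complex_ext2 ::
    "(real ^ 'd \<Rightarrow> real ^ 'd \<Rightarrow> real) \<Rightarrow> complex ^ 'd \<Rightarrow> complex ^ 'd \<Rightarrow> complex" where
  "complex_ext2 B v w =
     Complex (B (Re_vec v) (Re_vec w) - B (Im_vec v) (Im_vec w))
             (B (Re_vec v) (Im_vec w) + B (Im_vec v) (Re_vec w))"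

section \<open>Symplectic manifolds and Poisson brackets\<close>

type_synonym ('m, 'd) form2 = "'m \<Rightarrow> real ^ 'd \<Rightarrow> real ^ 'd \<Rightarrow> real"

text \<open>The coefficient of the 2-form \<open>\<omega>\<close> in the chart \<open>c\<close> for the fields with constant coordinates
  \<open>u\<close> and \<open>v\<close>.\<close>

definition local_form ::
    "('m, 'd::finite) chart set \<Rightarrow> ('m, 'd) form2 \<Rightarrow> ('m, 'd) chart \<Rightarrow>
     real ^ 'd \<Rightarrow> real ^ 'd \<Rightarrow> real ^ 'd \<Rightarrow> real" where
  "local_form A \<omega> c u v x =
     \<omega> (inv_chart c x) (coord_vector A c x u) (coord_vector A c x v)"

definition smooth_2_form ::
    "'m topology \<Rightarrow> ('m, 'd::finite) chart set \<Rightarrow> ('m, 'd) form2 \<Rightarrow> bool" where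
  "smooth_2_form X A \<omega> \<longleftrightarrow>
     (\<forall>p\<in>topspace X. bilinear (\<omega> p) \<and> (\<forall>v. \<omega> p v v = 0)) \<and>
     (\<forall>c\<in>A. \<forall>u v. smooth_on (snd c ` fst c) (local_form A \<omega> c u v))"

text \<open>\<open>d\<omega> = 0\<close>, evaluated on the commuting fields with constant coordinates \<open>u, v, w\<close> in a chart:
  there \<open>d\<omega>(u,v,w)\<close> is the cyclic sum of the derivatives of \<open>\<omega>(v,w)\<close> along \<open>u\<close>.\<close>

definition closed_2_form ::
    "('m, 'd::finite) chart set \<Rightarrow> ('m, 'd) form2 \<Rightarrow> bool" where
  "closed_2_form A \<omega> \<longleftrightarrow>
     (\<forall>c\<in>A. \<forall>x\<in>snd c ` fst c. \<forall>u v w.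
        frechet_derivative (local_form A \<omega> c v w) (at x) u +
        frechet_derivative (local_form A \<omega> c w u) (at x) v +
        frechet_derivative (local_form A \<omega> c u v) (at x) w = 0)"

definition symplectic_manifold ::
    "'m topology \<Rightarrow> ('m, 'd::finite) chart set \<Rightarrow> ('m, 'd) form2 \<Rightarrow> bool" where
  "symplectic_manifold X A \<omega> \<longleftrightarrow>
     smooth_manifold X A \<and> smooth_2_form X A \<omega> \<and> closed_2_form A \<omega> \<and>
     (\<forall>p\<in>topspace X. \<forall>u. (\<forall>v. \<omega> p u v = 0) \<longrightarrow> u = 0)"

definition is_hamiltonian_field ::
    "'m topology \<Rightarrow> ('m, 'd::finite) chart set \<Rightarrow> ('m, 'd) form2 \<Rightarrow>
     ('m \<Rightarrow> complex) \<Rightarrow> ('m \<Rightarrow> complex ^ 'd) \<Rightarrow> bool" where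
  "is_hamiltonian_field X A \<omega> f Z \<longleftrightarrow>
     smooth_complex_vector_field A Z \<and>
     (\<forall>Y :: 'm \<Rightarrow> complex ^ 'd. \<forall>p\<in>topspace X.
        complex_ext (differential A f p) (Y p) = complex_ext2 (\<omega> p) (Z p) (Y p))"

text \<open>On a symplectic manifold and for smooth \<open>f\<close>, the Hamiltonian field exists and is unique on
  \<open>topspace X\<close>; the choice only concerns its values elsewhere.\<close>

definition hamiltonian_field ::
    "'m topology \<Rightarrow> ('m, 'd::finite) chart set \<Rightarrow> ('m, 'd) form2 \<Rightarrow>
     ('m \<Rightarrow> complex) \<Rightarrow> 'm \<Rightarrow> complex ^ 'd" where
  "hamiltonian_field X A \<omega> f = (SOME Z. is_hamiltonian_field X A \<omega> f Z)"

definition poisson_bracket ::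
    "'m topology \<Rightarrow> ('m, 'd::finite) chart set \<Rightarrow> ('m, 'd) form2 \<Rightarrow>
     ('m \<Rightarrow> complex) \<Rightarrow> ('m \<Rightarrow> complex) \<Rightarrow> 'm \<Rightarrow> complex" where
  "poisson_bracket X A \<omega> f g p =
     complex_ext2 (\<omega> p) (hamiltonian_field X A \<omega> f p) (hamiltonian_field X A \<omega> g p)"

section \<open>Immersed and Lagrangian submanifolds\<close>

text \<open>An immersed submanifold of \<open>(X, A)\<close> is a manifold \<open>(Y, B)\<close> on a subset of \<open>topspace X\<close>,
  whose topology may be finer than the subspace topology.\<close>

definition immersed_submanifold ::
    "'m topology \<Rightarrow> ('m, 'd::finite) chart set \<Rightarrow> 'm topology \<Rightarrow> ('m, 'e::finite) chart set \<Rightarrow> bool" where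
  "immersed_submanifold X A Y B \<longleftrightarrow>
     smooth_manifold Y B \<and> topspace Y \<subseteq> topspace X \<and> smooth_map Y B X A id \<and>
     (\<forall>p\<in>topspace Y. inj (tangent_map B A id p))"

definition lagrangian_submanifold ::
    "'m topology \<Rightarrow> ('m, 'd::finite) chart set \<Rightarrow> ('m, 'd) form2 \<Rightarrow>
     'm topology \<Rightarrow> ('m, 'e::finite) chart set \<Rightarrow> bool" where
  "lagrangian_submanifold X A \<omega> Y B \<longleftrightarrow>
     immersed_submanifold X A Y B \<and> CARD('d) = 2 * CARD('e) \<and>
     (\<forall>p\<in>topspace Y. \<forall>u v. \<omega> p (tangent_map B A id p u) (tangent_map B A id p v) = 0)"

section \<open>Foliations\<close>

type_synonym ('m, 'k) fchart = "'m set \<times> ('m \<Rightarrow> real ^ 'k)"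

definition foliated_chart ::
    "'m topology \<Rightarrow> ('m, 'd::finite) chart set \<Rightarrow> ('m, 'k::finite) fchart \<Rightarrow> bool" where
  "foliated_chart X A c \<longleftrightarrow>
     openin X (fst c) \<and> open (snd c ` fst c) \<and> smooth_fun_on A (fst c) (snd c) \<and>
     (\<forall>p\<in>fst c. surj (differential A (snd c) p))"

definition fcompatible :: "('m, 'k::finite) fchart \<Rightarrow> ('m, 'k) fchart \<Rightarrow> bool" where
  "fcompatible c c' \<longleftrightarrow>
     (\<exists>\<xi>. diffeomorphism (snd c ` (fst c \<inter> fst c')) (snd c' ` (fst c \<inter> fst c')) \<xi> \<and>
          (\<forall>p\<in>fst c \<inter> fst c'. \<xi> (snd c p) = snd c' p))"

definition foliated_atlas ::
    "'m topology \<Rightarrow> ('m, 'd::finite) chart set \<Rightarrow> ('m, 'k::finite) fchart set \<Rightarrow> bool" where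
  "foliated_atlas X A F \<longleftrightarrow>
     (\<forall>c\<in>F. foliated_chart X A c) \<and> (\<forall>c\<in>F. \<forall>c'\<in>F. fcompatible c c') \<and>
     (\<Union>c\<in>F. fst c) = topspace X"

definition plaques :: "'m topology \<Rightarrow> ('m, 'k::finite) fchart set \<Rightarrow> 'm set set" where
  "plaques X F =
     (\<Union>c\<in>F. \<Union>y. connected_components_of (subtopology X {p \<in> fst c. snd c p = y}))"

definition plaque_related :: "'m topology \<Rightarrow> ('m, 'k::finite) fchart set \<Rightarrow> 'm \<Rightarrow> 'm \<Rightarrow> bool" where
  "plaque_related X F x y \<longleftrightarrow>
     (\<exists>(l::nat) P. (\<forall>j\<le>l. P j \<in> plaques X F) \<and> x \<in> P 0 \<and> y \<in> P l \<and>
        (\<forall>j\<in>{1..l}. P (j - 1) \<inter> P j \<noteq> {}))"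

definition leaves :: "'m topology \<Rightarrow> ('m, 'k::finite) fchart set \<Rightarrow> 'm set set" where
  "leaves X F =
     topspace X // {(x, y). x \<in> topspace X \<and> y \<in> topspace X \<and> plaque_related X F x y}"

text \<open>The leaf topology, in which the plaques are open and carry the subspace topology of \<open>X\<close>.\<close>

definition leaf_topology :: "'m topology \<Rightarrow> ('m, 'k::finite) fchart set \<Rightarrow> 'm set \<Rightarrow> 'm topology" where
  "leaf_topology X F L =
     subtopology (topology_generated_by {W \<inter> P |W P. openin X W \<and> P \<in> plaques X F}) L"

text \<open>A foliation is represented by a foliated atlas. The atlas \<open>B\<close> below is the smooth structure of
  the leaf, which is determined, up to equivalence, by the leaf topology and by the
  inclusion being an immersion. Since the Lagrangian dimension is half of \<open>CARD('d)\<close>, the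
  codimension \<open>CARD('k)\<close> is also the dimension of the leaves.\<close>

definition lagrangian_foliation ::
    "'m topology \<Rightarrow> ('m, 'd::finite) chart set \<Rightarrow> ('m, 'd) form2 \<Rightarrow>
     ('m, 'k::finite) fchart set \<Rightarrow> bool" where
  "lagrangian_foliation X A \<omega> F \<longleftrightarrow>
     foliated_atlas X A F \<and>
     (\<forall>L\<in>leaves X F. \<exists>B :: ('m, 'k) chart set.
        lagrangian_submanifold X A \<omega> (leaf_topology X F L) B)"

definition leafwise_constant_functions ::
    "'m topology \<Rightarrow> ('m, 'd::finite) chart set \<Rightarrow> ('m, 'k::finite) fchart set \<Rightarrow>
     ('m \<Rightarrow> complex) set" where
  "leafwise_constant_functions X A F =
     {f \<in> smooth_functions X A. \<forall>L\<in>leaves X F. \<forall>x\<in>L. \<forall>y\<in>L. f x = f y}"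

section \<open>Hypotheses on the function space\<close>

definition complex_function_subspace :: "('m \<Rightarrow> complex) set \<Rightarrow> bool" where
  "complex_function_subspace V \<longleftrightarrow>
     (\<lambda>p. 0) \<in> V \<and> (\<forall>f\<in>V. \<forall>g\<in>V. (\<lambda>p. f p + g p) \<in> V) \<and>
     (\<forall>z. \<forall>f\<in>V. (\<lambda>p. z * f p) \<in> V)"

text \<open>Linear independence over \<open>\<real>\<close> of a finite family of functionals on a tangent space.\<close>

definition real_independent_family :: "('n::finite \<Rightarrow> real ^ 'd \<Rightarrow> complex) \<Rightarrow> bool" where
  "real_independent_family l \<longleftrightarrow>
     (\<forall>r :: 'n \<Rightarrow> real. (\<forall>v. (\<Sum>i\<in>UNIV. r i *\<^sub>R l i v) = 0) \<longrightarrow> (\<forall>i. r i = 0))"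

end

theory Submission
  imports Defs
begin

text \<open>Let \<open>a\<^sub>1, \<dots>, a\<^sub>n\<close> be real-valued commuting functions whose differentials are independent at a
  point, hence also near it. Commutation says that the Hamiltonian vectors of the \<open>a\<^sub>i\<close> lie in the
  common kernel of the differentials. This kernel has dimension \<open>2n - n = n\<close>, so it is the span of
  these \<open>n\<close> vectors. As \<open>\<omega>\<close> of the Hamiltonian field of \<open>a\<^sub>i\<close> with \<open>v\<close> is \<open>da\<^sub>i(v)\<close>, the form \<open>\<omega>\<close> vanishes
  on the kernel, and so does the differential of every function that commutes with all the \<open>a\<^sub>i\<close>
  (\<open>commuting_common_kernel\<close>). The submersion \<open>(a\<^sub>1, \<dots>, a\<^sub>n)\<close> is therefore a foliated chart whose
  fibres are Lagrangian, and all of \<open>\<A>\<close> is constant on connected pieces of its fibres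
  (\<open>constant_on_slices\<close>). The inverse function theorem completes the submersion to coordinates in
  which the fibres are slices of a product (\<open>ex_adapted\<close>).

  Two such charts need not be compatible: on the possibly disconnected fibres of one of them inside
  the intersection of the domains the other one may take several values. The functions of one chart
  are constant on the connected slices of the other, so near every point of the intersection both
  charts have the same fibres, and by shrinking the domains one obtains a countable family of boxes such
  that any two boxes have the same fibres on their whole intersection
  (\<open>ex_coherent_flow_boxes\<close>). This coherence gives the transition maps of a foliated atlas.

  Coherence also controls the leaves. A plaque that meets a box lies in one plaque of that box
  there (\<open>plaque_Int\<close>). So plaques meet in open subsets of each other, which identifies the leaf
  topology, and each leaf consists of countably many plaques, which makes it second countable. The
  second coordinates of the boxes are charts of the leaves, and the tangent spaces of a leaf are the
  isotropic kernels above.\<close>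

section \<open>Calculus of smooth maps\<close>

lemma Ck_on_cong:
  assumes "open S" "\<And>x. x \<in> S \<Longrightarrow> f x = g x"
  shows "Ck_on k S f \<longleftrightarrow> Ck_on k S g"
  using assms(2)
proof (induction k arbitrary: f g)
  case 0
  then show ?case by (simp cong: continuous_on_cong)
next
  case (Suc k)
  have D: "(f has_derivative D) (at x) \<longleftrightarrow> (g has_derivative D) (at x)" if "x \<in> S" for x D
    using has_derivative_transform_within_open[OF _ \<open>open S\<close> that] Suc.prems by metis
  have "f differentiable (at x) \<longleftrightarrow> g differentiable (at x)" if "x \<in> S" for x
    using D[OF that] by (simp add: differentiable_def)
  moreover have "frechet_derivative f (at x) = frechet_derivative g (at x)" if "x \<in> S" for x
    using D[OF that] by (simp add: frechet_derivative_def)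
  then have "Ck_on k S (\<lambda>x. frechet_derivative f (at x) v) \<longleftrightarrow>
      Ck_on k S (\<lambda>x. frechet_derivative g (at x) v)" for v
    by (intro Suc.IH) simp
  ultimately show ?case by simp
qed

lemma Ck_on_subset: "Ck_on k S f \<Longrightarrow> T \<subseteq> S \<Longrightarrow> Ck_on k T f"
proof (induction k arbitrary: f)
  case 0
  then show ?case using continuous_on_subset by auto
next
  case (Suc k)
  then show ?case by auto
qed

text \<open>Smoothness is checked on neighbourhoods; this is how domains that are only described as unions
  of coordinate patches are handled.\<close>

lemma Ck_on_local:
  assumes "\<And>x. x \<in> S \<Longrightarrow> \<exists>T. open T \<and> x \<in> T \<and> Ck_on k T f"
  shows "Ck_on k S f"
  using assms
proof (induction k arbitrary: f)
  case 0
  show ?case unfolding Ck_on.simps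
  proof (rule continuous_at_imp_continuous_on, rule ballI)
    fix x assume "x \<in> S"
    with 0 obtain T where "open T" "x \<in> T" "continuous_on T f" by auto
    then show "isCont f x" by (simp add: continuous_on_eq_continuous_at)
  qed
next
  case (Suc k)
  have "f differentiable at x" if "x \<in> S" for x
    using Suc.prems[OF that] by auto
  moreover have "Ck_on k S (\<lambda>x. frechet_derivative f (at x) v)" for v
    using Suc.prems by (intro Suc.IH) fastforce
  ultimately show ?case by simp
qed

lemma Ck_on_SucI:
  assumes "open S" "\<And>x. x \<in> S \<Longrightarrow> (f has_derivative f' x) (at x)"
    and "\<And>v. Ck_on k S (\<lambda>x. f' x v)"
  shows "Ck_on (Suc k) S f"
proof -
  have "frechet_derivative f (at x) = f' x" if "x \<in> S" for x
    using frechet_derivative_at[OF assms(2)[OF that]] by simp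
  then have "Ck_on k S (\<lambda>x. frechet_derivative f (at x) v)" for v
    using Ck_on_cong[OF assms(1), of "\<lambda>x. frechet_derivative f (at x) v" "\<lambda>x. f' x v"] assms(3)
    by simp
  then show ?thesis using assms(2) by (auto simp: differentiable_def)
qed

lemma Ck_on_SucD:
  assumes "Ck_on (Suc k) S f"
  shows "x \<in> S \<Longrightarrow> (f has_derivative frechet_derivative f (at x)) (at x)"
    and "Ck_on k S (\<lambda>x. frechet_derivative f (at x) v)"
  using assms by (auto simp: frechet_derivative_works)

lemma Ck_on_Suc_imp: "Ck_on (Suc k) S f \<Longrightarrow> Ck_on k S f"
proof (induction k arbitrary: f)
  case 0
  then show ?case
    by (auto intro!: continuous_at_imp_continuous_on differentiable_imp_continuous_within)
next
  case (Suc k)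
  have "Ck_on k S (\<lambda>x. frechet_derivative f (at x) v)" for v
    by (rule Suc.IH) (use Suc.prems in auto)
  then show ?case using Suc.prems by auto
qed

lemma Ck_on_continuous: "Ck_on k S f \<Longrightarrow> continuous_on S f"
  by (induction k) (simp, blast dest: Ck_on_Suc_imp)

lemma Ck_on_const: "Ck_on k S (\<lambda>x. c)"
  by (induction k arbitrary: c) (auto simp: frechet_derivative_const)

lemma Ck_on_bounded_linear:
  assumes "bounded_linear f"
  shows "Ck_on k S f"
proof (cases k)
  case 0
  then show ?thesis using assms by (simp add: linear_continuous_on)
next
  case (Suc j)
  have "Ck_on (Suc j) UNIV f"
    by (rule Ck_on_SucI[where f' = "\<lambda>_. f"])
      (auto intro: bounded_linear_imp_has_derivative assms Ck_on_const)
  then show ?thesis using Suc Ck_on_subset by blast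
qed

lemma Ck_on_add:
  assumes "open S" "Ck_on k S f" "Ck_on k S g"
  shows "Ck_on k S (\<lambda>x. f x + g x)"
  using assms(2,3)
proof (induction k arbitrary: f g)
  case 0
  then show ?case by (simp add: continuous_on_add)
next
  case (Suc k)
  show ?case
    by (rule Ck_on_SucI[OF \<open>open S\<close>])
      (auto intro!: has_derivative_add Ck_on_SucD[OF Suc.prems(1)] Ck_on_SucD[OF Suc.prems(2)] Suc.IH)
qed

lemma Ck_on_bilinear:
  assumes "bounded_bilinear B" "open S" "Ck_on k S f" "Ck_on k S g"
  shows "Ck_on k S (\<lambda>x. B (f x) (g x))"
  using assms(3,4)
proof (induction k arbitrary: f g)
  case 0
  then show ?case using bounded_bilinear.continuous_on[OF assms(1)] by auto
next
  case (Suc k)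
  note * = Suc.prems[THEN Ck_on_Suc_imp]
  show ?case
    by (rule Ck_on_SucI[OF \<open>open S\<close> bounded_bilinear.FDERIV[OF assms(1)]])
      (auto intro!: Ck_on_SucD[OF Suc.prems(1)] Ck_on_SucD[OF Suc.prems(2)] Ck_on_add
        \<open>open S\<close> Suc.IH * simp del: Ck_on.simps)
qed

lemma Ck_on_linear_compose:
  assumes "bounded_linear L" "open S" "Ck_on k S f"
  shows "Ck_on k S (\<lambda>x. L (f x))"
  using assms(3)
proof (induction k arbitrary: f)
  case 0
  then show ?case using bounded_linear.continuous_on[OF assms(1)] by auto
next
  case (Suc k)
  show ?case
    by (rule Ck_on_SucI[OF \<open>open S\<close> bounded_linear.has_derivative[OF assms(1)]])
      (auto intro!: Ck_on_SucD[OF Suc.prems(1)] Suc.IH)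
qed

lemma Ck_on_sum:
  assumes "open S" "\<And>i. i \<in> I \<Longrightarrow> Ck_on k S (f i)"
  shows "Ck_on k S (\<lambda>x. \<Sum>i\<in>I. f i x)"
  using assms(2)
  by (induction I rule: infinite_finite_induct) (auto intro!: Ck_on_const Ck_on_add assms(1))

lemma Ck_on_prod:
  fixes f :: "'i \<Rightarrow> 'a::real_normed_vector \<Rightarrow> real"
  assumes "open S" "\<And>i. i \<in> I \<Longrightarrow> Ck_on k S (f i)"
  shows "Ck_on k S (\<lambda>x. \<Prod>i\<in>I. f i x)"
  using assms(2)
  by (induction I rule: infinite_finite_induct)
    (auto intro!: Ck_on_const Ck_on_bilinear[OF bounded_bilinear_mult] assms(1))

lemma Ck_on_inverse:
  fixes f :: "'a::real_normed_vector \<Rightarrow> real"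
  assumes "open S" "Ck_on k S f" "\<And>x. x \<in> S \<Longrightarrow> f x \<noteq> 0"
  shows "Ck_on k S (\<lambda>x. inverse (f x))"
  using assms(2)
proof (induction k)
  case 0
  then show ?case using assms(3) by (auto intro: continuous_on_inverse)
next
  case (Suc k)
  have IH: "Ck_on k S (\<lambda>x. inverse (f x))"
    using Suc.IH Ck_on_Suc_imp[OF Suc.prems] by blast
  show ?case
  proof (rule Ck_on_SucI[OF assms(1)])
    fix x assume "x \<in> S"
    then show "((\<lambda>x. inverse (f x)) has_derivative
        (\<lambda>v. - (inverse (f x) * frechet_derivative f (at x) v * inverse (f x)))) (at x)"
      by (intro Deriv.has_derivative_inverse assms(3) Ck_on_SucD(1)[OF Suc.prems])
  next
    fix v
    show "Ck_on k S (\<lambda>x. - (inverse (f x) * frechet_derivative f (at x) v * inverse (f x)))"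
      by (rule Ck_on_linear_compose[OF bounded_linear_minus[OF bounded_linear_ident] assms(1)])
        (intro Ck_on_bilinear[OF bounded_bilinear_mult] assms(1) IH Ck_on_SucD(2)[OF Suc.prems])
  qed
qed

text \<open>The chain rule expresses a directional derivative of \<open>f \<circ> g\<close> as a finite sum of products of
  directional derivatives; this is where the space in the middle has to have a finite basis.\<close>

lemma Ck_on_compose:
  fixes g :: "'a::real_normed_vector \<Rightarrow> 'b::euclidean_space"
  assumes "open S" "open T" "g ` S \<subseteq> T" "Ck_on k S g" "Ck_on k T f"
  shows "Ck_on k S (\<lambda>x. f (g x))"
  using assms(4,5)
proof (induction k arbitrary: f)
  case 0
  then show ?case using assms(3) by (auto intro: continuous_on_compose2)
next
  case (Suc k)
  have gC: "Ck_on k S g" using Suc.prems(1) Ck_on_Suc_imp by blast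
  let ?f' = "\<lambda>x. frechet_derivative f (at x)" and ?g' = "\<lambda>x. frechet_derivative g (at x)"
  have expand: "?f' (g x) (?g' x v) = (\<Sum>b\<in>Basis. (?g' x v \<bullet> b) *\<^sub>R ?f' (g x) b)" if "x \<in> S" for x v
  proof -
    have "linear (?f' (g x))"
      using Suc.prems(2) assms(3) that by (auto intro: linear_frechet_derivative)
    then have "?f' (g x) (\<Sum>b\<in>Basis. (?g' x v \<bullet> b) *\<^sub>R b) = (\<Sum>b\<in>Basis. (?g' x v \<bullet> b) *\<^sub>R ?f' (g x) b)"
      by (simp add: linear_sum linear_scale)
    then show ?thesis by (simp add: euclidean_representation)
  qed
  show ?case
  proof (rule Ck_on_SucI[OF assms(1)])
    fix x assume x: "x \<in> S"
    then have "g x \<in> T" using assms(3) by auto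
    then show "((\<lambda>x. f (g x)) has_derivative (\<lambda>v. ?f' (g x) (?g' x v))) (at x)"
      using diff_chain_at[OF Ck_on_SucD(1)[OF Suc.prems(1) x] Ck_on_SucD(1)[OF Suc.prems(2)]]
      by (simp add: o_def)
  next
    fix v
    have "Ck_on k S (\<lambda>x. (?g' x v \<bullet> b) *\<^sub>R ?f' (g x) b)" for b
      by (intro Ck_on_bilinear[OF bounded_bilinear_scaleR] assms(1) Suc.IH[OF gC]
          Ck_on_linear_compose[OF bounded_linear_inner_left] Ck_on_SucD(2)[OF Suc.prems(1)]
          Ck_on_SucD(2)[OF Suc.prems(2)])
    then have "Ck_on k S (\<lambda>x. \<Sum>b\<in>Basis. (?g' x v \<bullet> b) *\<^sub>R ?f' (g x) b)"
      by (intro Ck_on_sum assms(1))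
    then show "Ck_on k S (\<lambda>x. ?f' (g x) (?g' x v))"
      using Ck_on_cong[OF assms(1), of "\<lambda>x. ?f' (g x) (?g' x v)"] expand by simp
  qed
qed

lemma Ck_on_vec_lambda:
  fixes f :: "'i::finite \<Rightarrow> 'a::real_normed_vector \<Rightarrow> real"
  assumes "open S" "\<And>i. Ck_on k S (f i)"
  shows "Ck_on k S (\<lambda>x. \<chi> i. f i x)"
proof -
  have "(\<chi> i. f i x) = (\<Sum>i\<in>UNIV. f i x *\<^sub>R axis i 1)" for x
    by (simp add: vec_eq_iff axis_def if_distrib cong: if_cong)
  moreover have "Ck_on k S (\<lambda>x. \<Sum>i\<in>UNIV. f i x *\<^sub>R axis i (1::real))"
    by (intro Ck_on_sum assms Ck_on_linear_compose[OF bounded_linear_scaleR_left])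
  ultimately show ?thesis by simp
qed

lemma Ck_on_Pair:
  assumes "open S" "Ck_on k S f" "Ck_on k S g"
  shows "Ck_on k S (\<lambda>x. (f x, g x))"
proof -
  have lin: "bounded_linear (\<lambda>u::'b. (u, 0::'c))" "bounded_linear (\<lambda>u::'c. (0::'b, u))"
    by (auto intro: bounded_linear_Pair bounded_linear_ident bounded_linear_zero)
  have "Ck_on k S (\<lambda>x. (f x, 0) + (0, g x))"
    using Ck_on_add[OF assms(1) Ck_on_linear_compose[OF lin(1) assms(1,2)]
        Ck_on_linear_compose[OF lin(2) assms(1,3)]] by simp
  then show ?thesis by simp
qed

lemma Ck_on_det:
  fixes M :: "'a::real_normed_vector \<Rightarrow> real ^ 'n ^ 'n"
  assumes "open S" "\<And>i j. Ck_on k S (\<lambda>x. M x $ i $ j)"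
  shows "Ck_on k S (\<lambda>x. det (M x))"
  unfolding det_def
  by (intro Ck_on_sum Ck_on_bilinear[OF bounded_bilinear_mult] Ck_on_const Ck_on_prod assms)

text \<open>By Cramer's rule the solution is a rational function of the coefficients.\<close>

lemma Ck_on_linear_solve:
  fixes M :: "'a::real_normed_vector \<Rightarrow> real ^ 'n ^ 'n"
  assumes S: "open S" and M: "\<And>i j. Ck_on k S (\<lambda>x. M x $ i $ j)"
    and b: "\<And>i. Ck_on k S (\<lambda>x. b x $ i)"
    and inj: "\<And>x v. x \<in> S \<Longrightarrow> M x *v v = 0 \<Longrightarrow> v = 0"
    and sol: "\<And>x. x \<in> S \<Longrightarrow> M x *v u x = b x"
  shows "Ck_on k S u"
proof -
  have d: "det (M x) \<noteq> 0" if "x \<in> S" for x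
    using inj[OF that] by (metis invertible_det_nz invertible_left_inverse matrix_left_invertible_ker)
  let ?N = "\<lambda>l x. (\<chi> i j. if j = l then b x $ i else M x $ i $ j) :: real ^ 'n ^ 'n"
  let ?u = "\<lambda>x. \<chi> l. det (?N l x) * inverse (det (M x))"
  have "u x = ?u x" if "x \<in> S" for x
    using cramer[OF d[OF that]] sol[OF that] by (simp add: divide_inverse)
  moreover have "Ck_on k S (\<lambda>x. ?N l x $ i $ j)" for l i j
    using M b by (cases "j = l") auto
  then have "Ck_on k S ?u"
    by (intro Ck_on_vec_lambda Ck_on_bilinear[OF bounded_bilinear_mult] S Ck_on_det Ck_on_inverse M d)
  ultimately show ?thesis using Ck_on_cong[OF S, of u ?u] by simp
qed

text \<open>Smoothness of an inverse map is a bootstrap: the derivative of the inverse solves a linear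
  system whose coefficients are derivatives of the map evaluated along the inverse, hence it is as
  often differentiable as the inverse itself.\<close>

lemma smooth_on_inverse_map:
  fixes f :: "real ^ 'n \<Rightarrow> real ^ 'n"
  assumes "open U" "open V" and f: "smooth_on U f" and g: "g ` V \<subseteq> U" "continuous_on V g"
    and g': "\<And>y. y \<in> V \<Longrightarrow> (g has_derivative g' y) (at y)"
    and inv: "\<And>y v. y \<in> V \<Longrightarrow> frechet_derivative f (at (g y)) (g' y v) = v"
    and bij: "\<And>y v. y \<in> V \<Longrightarrow> frechet_derivative f (at (g y)) v = 0 \<Longrightarrow> v = 0"
  shows "smooth_on V g"
proof -
  have "Ck_on k V g" for k
  proof (induction k)
    case 0
    then show ?case using g by simp
  next
    case (Suc k)
    have fk: "Ck_on (Suc k) U f" using f by (simp only: smooth_on_def)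
    let ?M = "\<lambda>y. matrix (frechet_derivative f (at (g y)))"
    have lin: "linear (frechet_derivative f (at (g y)))" if "y \<in> V" for y
      using g(1) fk that by (intro linear_frechet_derivative) auto
    have M: "?M y *v v = frechet_derivative f (at (g y)) v" if "y \<in> V" for y v
      using lin[OF that] by (simp add: matrix_vector_mul)
    show ?case
    proof (rule Ck_on_SucI[OF \<open>open V\<close> g'])
      fix v
      show "Ck_on k V (\<lambda>y. g' y v)"
      proof (rule Ck_on_linear_solve[OF \<open>open V\<close>, of k ?M "\<lambda>_. v"])
        fix i j
        have "Ck_on k V (\<lambda>y. frechet_derivative f (at (g y)) (axis j 1) \<bullet> axis i 1)"
          by (intro Ck_on_linear_compose[OF bounded_linear_inner_left \<open>open V\<close>]
              Ck_on_compose[OF \<open>open V\<close> \<open>open U\<close> g(1) Suc.IH] Ck_on_SucD(2)[OF fk])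
        then show "Ck_on k V (\<lambda>y. ?M y $ i $ j)"
          by (simp add: matrix_def inner_axis)
      qed (use M inv bij in \<open>auto intro: Ck_on_const\<close>)
    qed
  qed
  then show ?thesis by (simp add: smooth_on_def)
qed

lemma smooth_on_cong:
  "open S \<Longrightarrow> (\<And>x. x \<in> S \<Longrightarrow> f x = g x) \<Longrightarrow> smooth_on S f \<longleftrightarrow> smooth_on S g"
  using Ck_on_cong[of S f g] by (simp add: smooth_on_def)

lemma smooth_on_subset: "smooth_on S f \<Longrightarrow> T \<subseteq> S \<Longrightarrow> smooth_on T f"
  unfolding smooth_on_def using Ck_on_subset[of _ S f T] by blast

lemma smooth_on_local:
  "(\<And>x. x \<in> S \<Longrightarrow> \<exists>T. open T \<and> x \<in> T \<and> smooth_on T f) \<Longrightarrow> smooth_on S f"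
  unfolding smooth_on_def by (intro allI Ck_on_local) blast

lemma smooth_on_continuous: "smooth_on S f \<Longrightarrow> continuous_on S f"
  by (rule Ck_on_continuous[where k = 0]) (simp only: smooth_on_def)

lemma smooth_on_has_derivative:
  "smooth_on S f \<Longrightarrow> x \<in> S \<Longrightarrow> (f has_derivative frechet_derivative f (at x)) (at x)"
  by (rule Ck_on_SucD(1)[where k = 0]) (simp_all only: smooth_on_def)

lemma smooth_on_frechet_derivative:
  "smooth_on S f \<Longrightarrow> smooth_on S (\<lambda>x. frechet_derivative f (at x) v)"
  unfolding smooth_on_def by (intro allI Ck_on_SucD(2)) simp

lemma smooth_on_const: "smooth_on S (\<lambda>x. c)"
  by (simp add: smooth_on_def Ck_on_const)

lemma smooth_on_bounded_linear: "bounded_linear f \<Longrightarrow> smooth_on S f"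
  unfolding smooth_on_def using Ck_on_bounded_linear by blast

lemma smooth_on_linear_compose:
  "bounded_linear L \<Longrightarrow> open S \<Longrightarrow> smooth_on S f \<Longrightarrow> smooth_on S (\<lambda>x. L (f x))"
  unfolding smooth_on_def using Ck_on_linear_compose[of L S _ f] by blast

lemma smooth_on_compose:
  fixes g :: "'a::real_normed_vector \<Rightarrow> 'b::euclidean_space"
  shows "open S \<Longrightarrow> open T \<Longrightarrow> g ` S \<subseteq> T \<Longrightarrow> smooth_on S g \<Longrightarrow> smooth_on T f \<Longrightarrow>
    smooth_on S (\<lambda>x. f (g x))"
  unfolding smooth_on_def by (intro allI, rule Ck_on_compose[of S T g]) simp_all

lemma smooth_on_vec_lambda:
  fixes f :: "'i::finite \<Rightarrow> 'a::real_normed_vector \<Rightarrow> real"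
  shows "open S \<Longrightarrow> (\<And>i. smooth_on S (f i)) \<Longrightarrow> smooth_on S (\<lambda>x. \<chi> i. f i x)"
  unfolding smooth_on_def by (intro allI, rule Ck_on_vec_lambda) simp_all

lemma smooth_on_Pair:
  "open S \<Longrightarrow> smooth_on S f \<Longrightarrow> smooth_on S g \<Longrightarrow> smooth_on S (\<lambda>x. (f x, g x))"
  unfolding smooth_on_def using Ck_on_Pair[of S _ f g] by blast

lemma smooth_on_slice:
  fixes z :: "'c::euclidean_space" and f :: "'b::euclidean_space \<times> 'c \<Rightarrow> 'd::real_normed_vector"
  assumes "open S" "smooth_on S f"
  shows "smooth_on {w. (w, z) \<in> S} (\<lambda>w. f (w, z))" and "open {w. (w, z) \<in> S}"
proof -
  have "(\<lambda>w. (w, z)) -` S = {w. (w, z) \<in> S}" by auto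
  moreover have "open ((\<lambda>w. (w, z)) -` S)"
    by (auto intro!: open_vimage assms continuous_intros)
  ultimately show o: "open {w. (w, z) \<in> S}" by auto
  show "smooth_on {w. (w, z) \<in> S} (\<lambda>w. f (w, z))"
    by (rule smooth_on_compose[OF o assms(1) _ _ assms(2)])
      (auto intro: smooth_on_Pair[OF o smooth_on_bounded_linear[OF bounded_linear_ident] smooth_on_const])
qed

text \<open>The \<open>C\<^sup>1\<close> inverse function theorem provides a differentiable inverse, and the bootstrap makes it
  smooth.\<close>

lemma smooth_inverse_function:
  fixes f :: "real ^ 'n \<Rightarrow> real ^ 'n"
  assumes "open U" "smooth_on U f" "x0 \<in> U"
    and inj: "\<And>v. frechet_derivative f (at x0) v = 0 \<Longrightarrow> v = 0"
  obtains U' V g where "open U'" "U' \<subseteq> U" "x0 \<in> U'" "open V" "homeomorphism U' V f g" "smooth_on V g"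
proof -
  define f' where "f' x = Blinfun (frechet_derivative f (at x))" for x
  have der: "(f has_derivative blinfun_apply (f' x)) (at x)"
    and f'eq: "blinfun_apply (f' x) = frechet_derivative f (at x)" if "x \<in> U" for x
  proof -
    have *: "(f has_derivative frechet_derivative f (at x)) (at x)"
      using smooth_on_has_derivative assms that by blast
    show "blinfun_apply (f' x) = frechet_derivative f (at x)"
      unfolding f'_def by (rule bounded_linear_Blinfun_apply) (rule has_derivative_bounded_linear[OF *])
    with * show "(f has_derivative blinfun_apply (f' x)) (at x)" by simp
  qed
  have cont: "continuous_on U f'"
  proof (rule continuous_on_blinfun_componentwise)
    fix i :: "real ^ 'n"
    have "continuous_on U (\<lambda>x. frechet_derivative f (at x) i)"
      by (intro smooth_on_continuous smooth_on_frechet_derivative assms)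
    then show "continuous_on U (\<lambda>x. blinfun_apply (f' x) i)"
      by (simp add: f'eq cong: continuous_on_cong)
  qed
  have lin: "linear (blinfun_apply (f' x0))"
    by (simp add: blinfun.bounded_linear_right bounded_linear.linear)
  obtain h where h: "linear h" "h \<circ> blinfun_apply (f' x0) = id"
    using linear_injective_left_inverse[OF lin] inj f'eq[OF assms(3)]
    by (metis (no_types, lifting) lin linear_injective_0)
  have "Blinfun h o\<^sub>L f' x0 = id_blinfun"
    by (rule blinfun_eqI)
      (use h in \<open>auto simp: bounded_linear_Blinfun_apply linear_conv_bounded_linear fun_eq_iff\<close>)
  from inverse_function_theorem[OF assms(1) der cont assms(3) this]
  obtain U' V g g' where *: "open U'" "U' \<subseteq> U" "x0 \<in> U'" "open V" "f x0 \<in> V" "homeomorphism U' V f g"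
    "\<And>y. y \<in> V \<Longrightarrow> (g has_derivative (g' y)) (at y)"
    "\<And>y. y \<in> V \<Longrightarrow> g' y = inv (blinfun_apply (f'(g y)))"
    "\<And>y. y \<in> V \<Longrightarrow> bij (blinfun_apply (f'(g y)))" by metis
  have gU: "g y \<in> U" if "y \<in> V" for y using * that by (auto simp: homeomorphism_def)
  have "smooth_on V g"
  proof (rule smooth_on_inverse_map[OF assms(1) *(4) assms(2)])
    show "g ` V \<subseteq> U" using gU by auto
    show "continuous_on V g" using *(6) by (simp add: homeomorphism_def)
    fix y v assume y: "y \<in> V"
    show "(g has_derivative (g' y)) (at y)" using *(7) y .
    show "frechet_derivative f (at (g y)) (g' y v) = v"
      using *(8,9)[OF y] f'eq[OF gU[OF y]] by (metis bij_is_surj surj_f_inv_f)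
    assume "frechet_derivative f (at (g y)) v = 0"
    then have "blinfun_apply (f' (g y)) v = blinfun_apply (f' (g y)) 0"
      using f'eq[OF gU[OF y]] by (metis blinfun.zero_right)
    then show "v = 0" using *(9)[OF y] by (meson bij_is_inj injD)
  qed
  with * show ?thesis using that by blast
qed

lemma smooth_on_transform:
  "smooth_on S f \<Longrightarrow> open S \<Longrightarrow> (\<And>x. x \<in> S \<Longrightarrow> f x = g x) \<Longrightarrow> smooth_on S g"
  using smooth_on_cong[of S f g] by simp

section \<open>Coordinates and parametrizations\<close>

text \<open>Charts take values in \<open>real ^ 'd\<close>, whereas the coordinates in which a foliation becomes a product
  take values in a product space. Both are homeomorphisms \<open>g\<close> from an open set \<open>U\<close> onto an open set
  \<open>S\<close>, and the inverse \<open>e\<close> is a parameter, so that it can be \<open>inv_chart\<close> for a chart.\<close>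

definition local_coords ::
    "'m topology \<Rightarrow> 'm set \<Rightarrow> 'a::topological_space set \<Rightarrow> ('m \<Rightarrow> 'a) \<Rightarrow> ('a \<Rightarrow> 'm) \<Rightarrow> bool" where
  "local_coords X U S g e \<longleftrightarrow> openin X U \<and> open S \<and>
     homeomorphic_maps (subtopology X U) (top_of_set S) g e"

lemma local_coordsD:
  assumes "local_coords X U S g e"
  shows "openin X U" "open S" "U \<subseteq> topspace X"
    and "p \<in> U \<Longrightarrow> g p \<in> S" "p \<in> U \<Longrightarrow> e (g p) = p" "x \<in> S \<Longrightarrow> e x \<in> U" "x \<in> S \<Longrightarrow> g (e x) = x"
proof -
  show o: "openin X U" "open S" using assms by (auto simp: local_coords_def)
  then show U: "U \<subseteq> topspace X" using openin_subset by blast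
  have h: "homeomorphic_maps (subtopology X U) (top_of_set S) g e"
    using assms by (simp add: local_coords_def)
  then show "p \<in> U \<Longrightarrow> g p \<in> S" "p \<in> U \<Longrightarrow> e (g p) = p" "x \<in> S \<Longrightarrow> e x \<in> U" "x \<in> S \<Longrightarrow> g (e x) = x"
    using U by (auto simp: homeomorphic_maps_def continuous_map_def Pi_iff)
qed

lemma local_coords_open_image:
  assumes "local_coords X U S g e" "openin X V"
  shows "open (g ` (U \<inter> V))" "g ` (U \<inter> V) = {x \<in> S. e x \<in> V}"
proof -
  note * = local_coordsD[OF assms(1)]
  show eq: "g ` (U \<inter> V) = {x \<in> S. e x \<in> V}"
  proof
    show "g ` (U \<inter> V) \<subseteq> {x \<in> S. e x \<in> V}" using * by auto
    show "{x \<in> S. e x \<in> V} \<subseteq> g ` (U \<inter> V)"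
    proof
      fix x assume "x \<in> {x \<in> S. e x \<in> V}"
      then have "e x \<in> U \<inter> V" "x = g (e x)" using * by auto
      then show "x \<in> g ` (U \<inter> V)" by blast
    qed
  qed
  have "continuous_map (top_of_set S) (subtopology X U) e"
    using assms by (simp add: local_coords_def homeomorphic_maps_def)
  then have "continuous_map (top_of_set S) X e"
    using continuous_map_in_subtopology by blast
  then have "openin (top_of_set S) {x \<in> S. e x \<in> V}"
    using openin_continuous_map_preimage[of "top_of_set S" X e V] assms(2) by simp
  then show "open (g ` (U \<inter> V))"
    using eq *(2) openin_open_eq by metis
qed

lemma local_coords_open_preimage:
  assumes "local_coords X U S g e" "open N"
  shows "openin X {p \<in> U. g p \<in> N}"
proof -
  note * = local_coordsD[OF assms(1)]
  have "continuous_map (subtopology X U) (top_of_set S) g"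
    using assms by (simp add: local_coords_def homeomorphic_maps_def)
  then have "openin (subtopology X U) {p \<in> topspace (subtopology X U). g p \<in> S \<inter> N}"
    by (rule openin_continuous_map_preimage) (simp add: assms openin_open_Int)
  moreover have "{p \<in> topspace (subtopology X U). g p \<in> S \<inter> N} = {p \<in> U. g p \<in> N}"
    using * by auto
  ultimately show ?thesis using *(1) openin_trans_full by metis
qed

lemma is_chart_local_coords:
  assumes "is_chart X c"
  shows "local_coords X (fst c) (snd c ` fst c) (snd c) (inv_chart c)"
proof -
  have o: "openin X (fst c)" "open (snd c ` fst c)"
    and h: "homeomorphic_map (subtopology X (fst c)) (top_of_set (snd c ` fst c)) (snd c)"
    using assms by (auto simp: is_chart_def)
  have ts: "topspace (subtopology X (fst c)) = fst c"
    using openin_subset[OF o(1)] by auto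
  obtain e where e: "homeomorphic_maps (subtopology X (fst c)) (top_of_set (snd c ` fst c)) (snd c) e"
    using h homeomorphic_map_maps by blast
  have inj: "inj_on (snd c) (fst c)"
    using homeomorphic_imp_injective_map[OF h] ts by simp
  have "inv_chart c x = e x" if "x \<in> snd c ` fst c" for x
    using that e ts inv_into_f_f[OF inj] unfolding inv_chart_def homeomorphic_maps_def
    by (metis imageE)
  then have "homeomorphic_maps (subtopology X (fst c)) (top_of_set (snd c ` fst c)) (snd c) (inv_chart c)"
    using homeomorphic_maps_eq[OF e] by auto
  with o show ?thesis by (simp add: local_coords_def)
qed

text \<open>A smooth map from a normed space to the manifold. Inverses of charts, inverses of product
  coordinates and parametrizations of leaves are all of this form. Openness of the preimages of chart
  domains expresses continuity.\<close>

definition smooth_param ::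
    "'m topology \<Rightarrow> ('m, 'd::finite) chart set \<Rightarrow> 'a::real_normed_vector set \<Rightarrow> ('a \<Rightarrow> 'm) \<Rightarrow> bool" where
  "smooth_param X A N \<sigma> \<longleftrightarrow> open N \<and> \<sigma> ` N \<subseteq> topspace X \<and>
     (\<forall>c\<in>A. open {z \<in> N. \<sigma> z \<in> fst c} \<and> smooth_on {z \<in> N. \<sigma> z \<in> fst c} (snd c \<circ> \<sigma>))"

text \<open>Coordinates refer to the chart chosen at the image point, so that the values are tangent vectors
  of the manifold. For the inverse of a chart this is \<open>coord_vector\<close>.\<close>

definition param_derivative ::
    "('m, 'd::finite) chart set \<Rightarrow> ('a::real_normed_vector \<Rightarrow> 'm) \<Rightarrow> 'a \<Rightarrow> 'a \<Rightarrow> real ^ 'd" where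
  "param_derivative A \<sigma> z = frechet_derivative (snd (chart_at A (\<sigma> z)) \<circ> \<sigma>) (at z)"

lemma coord_vector_eq: "coord_vector A c x = param_derivative A (inv_chart c) x"
  by (simp add: coord_vector_def param_derivative_def fun_eq_iff)

locale manifold =
  fixes X :: "'m topology" and A :: "('m, 'd::finite) chart set"
  assumes smooth_manifold: "smooth_manifold X A"
begin

lemma chart_coords: "c \<in> A \<Longrightarrow> local_coords X (fst c) (snd c ` fst c) (snd c) (inv_chart c)"
  using smooth_manifold by (intro is_chart_local_coords) (auto simp: smooth_manifold_def)

lemma chart_open: "c \<in> A \<Longrightarrow> openin X (fst c)"
  using chart_coords local_coordsD(1) by blast

lemma chart_around: "p \<in> topspace X \<Longrightarrow> chart_at A p \<in> A \<and> p \<in> fst (chart_at A p)"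
proof -
  assume "p \<in> topspace X"
  then have "p \<in> (\<Union>c\<in>A. fst c)" using smooth_manifold by (simp add: smooth_manifold_def)
  then have "\<exists>c. c \<in> A \<and> p \<in> fst c" by blast
  then show ?thesis unfolding chart_at_def by (rule someI_ex)
qed

lemma smooth_param_chart:
  assumes "c \<in> A"
  shows "smooth_param X A (snd c ` fst c) (inv_chart c)"
  unfolding smooth_param_def
proof (intro conjI ballI)
  note * = chart_coords[OF assms] local_coordsD[OF chart_coords[OF assms]]
  show "open (snd c ` fst c)" "inv_chart c ` (snd c ` fst c) \<subseteq> topspace X" using * by auto
  fix c' assume c': "c' \<in> A"
  have eq: "snd c ` (fst c \<inter> fst c') = {z \<in> snd c ` fst c. inv_chart c z \<in> fst c'}"
    and o: "open (snd c ` (fst c \<inter> fst c'))"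
    using local_coords_open_image[OF *(1) chart_open[OF c']] by auto
  show "open {z \<in> snd c ` fst c. inv_chart c z \<in> fst c'}" using eq o by simp
  have "smooth_on (snd c ` (fst c \<inter> fst c')) (snd c' \<circ> inv_chart c)"
    using smooth_manifold assms c' by (simp add: smooth_manifold_def)
  then show "smooth_on {z \<in> snd c ` fst c. inv_chart c z \<in> fst c'} (snd c' \<circ> inv_chart c)"
    unfolding eq .
qed

lemma smooth_param_reparametrize:
  fixes N :: "'b::euclidean_space set"
  assumes "smooth_param X A N \<sigma>" "open M" "g ` M \<subseteq> N" "smooth_on M g"
  shows "smooth_param X A M (\<lambda>z. \<sigma> (g z))"
  unfolding smooth_param_def
proof (intro conjI ballI)
  show "open M" "(\<lambda>z. \<sigma> (g z)) ` M \<subseteq> topspace X"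
    using assms by (auto simp: smooth_param_def)
  fix c assume "c \<in> A"
  let ?N = "{z \<in> N. \<sigma> z \<in> fst c}" and ?M = "{z \<in> M. \<sigma> (g z) \<in> fst c}"
  have N: "open ?N" "smooth_on ?N (snd c \<circ> \<sigma>)"
    using assms(1) \<open>c \<in> A\<close> by (auto simp: smooth_param_def)
  have eq: "?M = {z \<in> M. g z \<in> ?N}" using assms(3) by auto
  have "openin (top_of_set M) {z \<in> topspace (top_of_set M). g z \<in> ?N}"
    by (rule openin_continuous_map_preimage[where Y = euclidean])
      (use smooth_on_continuous[OF assms(4)] N(1) in auto)
  then show o: "open ?M" unfolding eq using openin_open_eq[OF assms(2)] by simp
  have "smooth_on ?M (\<lambda>z. (snd c \<circ> \<sigma>) (g z))"
    by (rule smooth_on_compose[OF o N(1) _ smooth_on_subset[OF assms(4)] N(2)]) (use assms(3) in auto)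
  then show "smooth_on ?M (snd c \<circ> (\<lambda>z. \<sigma> (g z)))" by (simp add: o_def)
qed

lemma smooth_param_subset:
  assumes "smooth_param X A N \<sigma>" "open M" "M \<subseteq> N"
  shows "smooth_param X A M \<sigma>"
  unfolding smooth_param_def
proof (intro conjI ballI)
  show "open M" "\<sigma> ` M \<subseteq> topspace X" using assms by (auto simp: smooth_param_def)
  fix c assume "c \<in> A"
  then have N: "open {z \<in> N. \<sigma> z \<in> fst c}" "smooth_on {z \<in> N. \<sigma> z \<in> fst c} (snd c \<circ> \<sigma>)"
    using assms(1) by (auto simp: smooth_param_def)
  have "{z \<in> M. \<sigma> z \<in> fst c} = M \<inter> {z \<in> N. \<sigma> z \<in> fst c}" using assms(3) by auto
  then show "open {z \<in> M. \<sigma> z \<in> fst c}" using N(1) assms(2) by auto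
  show "smooth_on {z \<in> M. \<sigma> z \<in> fst c} (snd c \<circ> \<sigma>)"
    by (rule smooth_on_subset[OF N(2)]) (use assms(3) in auto)
qed

text \<open>Near each point the composite factors through the coordinates of a chart.\<close>

lemma smooth_param_compose:
  assumes "smooth_param X A N \<sigma>" "openin X U" "smooth_fun_on A U f" "\<sigma> ` N \<subseteq> U"
  shows "smooth_on N (f \<circ> \<sigma>)"
proof (rule smooth_on_local)
  fix z assume z: "z \<in> N"
  then have "\<sigma> z \<in> topspace X" using assms(1) by (auto simp: smooth_param_def)
  then obtain c where c: "c \<in> A" "\<sigma> z \<in> fst c" using chart_around by blast
  let ?N = "{z \<in> N. \<sigma> z \<in> fst c}"
  have N: "open ?N" "smooth_on ?N (snd c \<circ> \<sigma>)"
    using assms(1) c(1) by (auto simp: smooth_param_def)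
  have f: "smooth_on (snd c ` (fst c \<inter> U)) (f \<circ> inv_chart c)"
    using assms(3) c by (simp add: smooth_fun_on_def)
  have "smooth_on ?N (\<lambda>z. (f \<circ> inv_chart c) ((snd c \<circ> \<sigma>) z))"
    by (rule smooth_on_compose[OF N(1) local_coords_open_image(1)[OF chart_coords[OF c(1)] assms(2)] _ N(2) f])
      (use assms c in auto)
  then have "smooth_on ?N (f \<circ> \<sigma>)"
    by (rule smooth_on_transform[OF _ N(1)])
      (use local_coordsD(5)[OF chart_coords[OF c(1)]] in auto)
  then show "\<exists>T. open T \<and> z \<in> T \<and> smooth_on T (f \<circ> \<sigma>)" using N(1) z c(2) by blast
qed

lemma smooth_fun_on_chart:
  assumes "c \<in> A"
  shows "smooth_fun_on A (fst c) (snd c)"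
  using smooth_manifold assms by (simp add: smooth_fun_on_def smooth_manifold_def)

lemma smooth_fun_on_subset: "smooth_fun_on A U f \<Longrightarrow> V \<subseteq> U \<Longrightarrow> smooth_fun_on A V f"
  unfolding smooth_fun_on_def by (blast intro: smooth_on_subset)

text \<open>The chart chosen at \<open>\<sigma> z\<close> enters both the differential of \<open>f\<close> and the derivative of \<open>\<sigma>\<close>, and
  cancels in the chain rule.\<close>

lemma differential_chain:
  assumes "smooth_param X A N \<sigma>" "z \<in> N" "openin X U" "smooth_fun_on A U f" "\<sigma> z \<in> U"
  shows "(f \<circ> \<sigma> has_derivative (\<lambda>v. differential A f (\<sigma> z) (param_derivative A \<sigma> z v))) (at z)"
proof -
  let ?c = "chart_at A (\<sigma> z)"
  have c: "?c \<in> A" "\<sigma> z \<in> fst ?c"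
    using assms(1,2) chart_around[of "\<sigma> z"] by (auto simp: smooth_param_def)
  let ?N = "{z \<in> N. \<sigma> z \<in> fst ?c}"
  have N: "open ?N" "smooth_on ?N (snd ?c \<circ> \<sigma>)"
    using assms(1) c(1) by (auto simp: smooth_param_def)
  have 1: "((snd ?c \<circ> \<sigma>) has_derivative param_derivative A \<sigma> z) (at z)"
    unfolding param_derivative_def
    by (rule smooth_on_has_derivative[OF N(2)]) (use assms c in auto)
  have "smooth_on (snd ?c ` (fst ?c \<inter> U)) (f \<circ> inv_chart ?c)"
    using assms(4) c(1) by (simp add: smooth_fun_on_def)
  then have 2: "((f \<circ> inv_chart ?c) has_derivative differential A f (\<sigma> z)) (at ((snd ?c \<circ> \<sigma>) z))"
    unfolding differential_def o_apply[of "snd ?c"]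
    by (rule smooth_on_has_derivative) (use assms c in auto)
  have "((f \<circ> inv_chart ?c) \<circ> (snd ?c \<circ> \<sigma>) has_derivative
      (differential A f (\<sigma> z) \<circ> param_derivative A \<sigma> z)) (at z)"
    by (rule diff_chain_at[OF 1 2])
  then have "((f \<circ> inv_chart ?c) \<circ> (snd ?c \<circ> \<sigma>) has_derivative
      (\<lambda>v. differential A f (\<sigma> z) (param_derivative A \<sigma> z v))) (at z)"
    by (simp add: o_def)
  then show ?thesis
    by (rule has_derivative_transform_within_open[OF _ N(1)])
      (use assms c local_coordsD(5)[OF chart_coords[OF c(1)]] in auto)
qed

lemma linear_param_derivative:
  assumes "smooth_param X A N \<sigma>" "z \<in> N"
  shows "linear (param_derivative A \<sigma> z)"
proof -
  let ?c = "chart_at A (\<sigma> z)"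
  have c: "?c \<in> A" "\<sigma> z \<in> fst ?c"
    using assms(1,2) chart_around[of "\<sigma> z"] by (auto simp: smooth_param_def)
  then have "smooth_on {z \<in> N. \<sigma> z \<in> fst ?c} (snd ?c \<circ> \<sigma>)"
    using assms(1) by (auto simp: smooth_param_def)
  then have "(snd ?c \<circ> \<sigma> has_derivative param_derivative A \<sigma> z) (at z)"
    unfolding param_derivative_def by (rule smooth_on_has_derivative) (use assms c in auto)
  then show ?thesis by (rule has_derivative_linear)
qed

lemma linear_differential:
  assumes "openin X U" "smooth_fun_on A U f" "p \<in> U"
  shows "linear (differential A f p)"
proof -
  let ?c = "chart_at A p"
  have c: "?c \<in> A" "p \<in> fst ?c"
    using assms openin_subset chart_around[of p] by blast+
  then have "smooth_on (snd ?c ` (fst ?c \<inter> U)) (f \<circ> inv_chart ?c)"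
    using assms(2) by (simp add: smooth_fun_on_def)
  then have "(f \<circ> inv_chart ?c has_derivative differential A f p) (at (snd ?c p))"
    unfolding differential_def by (rule smooth_on_has_derivative) (use assms c in auto)
  then show ?thesis by (rule has_derivative_linear)
qed

lemma differential_linear_compose:
  assumes "openin X U" "smooth_fun_on A U f" "p \<in> U" "bounded_linear L"
  shows "differential A (\<lambda>q. L (f q)) p v = L (differential A f p v)"
proof -
  let ?c = "chart_at A p"
  have c: "?c \<in> A" "p \<in> fst ?c"
    using assms openin_subset chart_around[of p] by blast+
  then have "smooth_on (snd ?c ` (fst ?c \<inter> U)) (f \<circ> inv_chart ?c)"
    using assms(2) by (simp add: smooth_fun_on_def)
  then have "(f \<circ> inv_chart ?c has_derivative differential A f p) (at (snd ?c p))"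
    unfolding differential_def by (rule smooth_on_has_derivative) (use assms c in auto)
  then have "((\<lambda>x. L ((f \<circ> inv_chart ?c) x)) has_derivative (\<lambda>v. L (differential A f p v))) (at (snd ?c p))"
    by (rule bounded_linear.has_derivative[OF assms(4)])
  then have "((\<lambda>q. L (f q)) \<circ> inv_chart ?c has_derivative (\<lambda>v. L (differential A f p v))) (at (snd ?c p))"
    by (simp add: o_def)
  then show ?thesis using frechet_derivative_at by (metis differential_def)
qed

lemma smooth_fun_on_linear_compose:
  assumes "openin X U" "smooth_fun_on A U f" "bounded_linear L"
  shows "smooth_fun_on A U (\<lambda>q. L (f q))"
  unfolding smooth_fun_on_def
proof
  fix c assume c: "c \<in> A"
  then have "smooth_on (snd c ` (fst c \<inter> U)) (f \<circ> inv_chart c)"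
    using assms(2) by (simp add: smooth_fun_on_def)
  then have "smooth_on (snd c ` (fst c \<inter> U)) (\<lambda>x. L ((f \<circ> inv_chart c) x))"
    by (rule smooth_on_linear_compose[OF assms(3) local_coords_open_image(1)[OF chart_coords[OF c] assms(1)]])
  then show "smooth_on (snd c ` (fst c \<inter> U)) ((\<lambda>q. L (f q)) \<circ> inv_chart c)"
    by (simp add: o_def)
qed

text \<open>The chain rule gives the first composite. The second one follows because an injective linear map
  between spaces of equal dimension is bijective.\<close>

lemma differential_coord_vector:
  assumes "c \<in> A" "x \<in> snd c ` fst c"
  shows "differential A (snd c) (inv_chart c x) (coord_vector A c x u) = u"
    and "coord_vector A c x (differential A (snd c) (inv_chart c x) v) = v"
    and "linear (coord_vector A c x)"
proof -
  note * = local_coordsD[OF chart_coords[OF assms(1)]]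
  have "inv_chart c x \<in> fst c" using * assms(2) by blast
  have "(snd c \<circ> inv_chart c has_derivative
      (\<lambda>u. differential A (snd c) (inv_chart c x) (coord_vector A c x u))) (at x)"
    unfolding coord_vector_eq
    by (rule differential_chain[OF smooth_param_chart assms(2) chart_open smooth_fun_on_chart])
      (use assms \<open>inv_chart c x \<in> fst c\<close> in auto)
  moreover have "(snd c \<circ> inv_chart c has_derivative (\<lambda>u. u)) (at x)"
    by (rule has_derivative_transform_within_open[OF has_derivative_ident *(2) assms(2)])
      (use * in auto)
  ultimately have 1: "differential A (snd c) (inv_chart c x) (coord_vector A c x u) = u" for u
    using has_derivative_unique by metis
  then show "differential A (snd c) (inv_chart c x) (coord_vector A c x u) = u" .
  have lin: "linear (coord_vector A c x)"
    unfolding coord_vector_eq by (rule linear_param_derivative[OF smooth_param_chart]) (use assms in auto)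
  then show "linear (coord_vector A c x)" .
  have "inj (coord_vector A c x)" using 1 by (metis injI)
  then have "surj (coord_vector A c x)" using lin linear_injective_imp_surjective by blast
  then show "coord_vector A c x (differential A (snd c) (inv_chart c x) v) = v"
    using 1 by (metis surjD)
qed

end

section \<open>Hamiltonian fields of commuting functions\<close>

lemma linear_axis_expansion:
  fixes f :: "real ^ 'n \<Rightarrow> 'b::real_vector"
  assumes "linear f"
  shows "f v = (\<Sum>i\<in>UNIV. v $ i *\<^sub>R f (axis i 1))"
proof -
  have "v = (\<Sum>i\<in>UNIV. v $ i *\<^sub>R axis i 1)"
    by (simp add: vec_eq_iff axis_def if_distrib cong: if_cong)
  then have "f v = f (\<Sum>i\<in>UNIV. v $ i *\<^sub>R axis i 1)" by simp
  also have "\<dots> = (\<Sum>i\<in>UNIV. v $ i *\<^sub>R f (axis i 1))"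
    using assms by (simp add: linear_sum linear_scale)
  finally show ?thesis .
qed

lemma linear_eqI_axis:
  fixes f g :: "real ^ 'n \<Rightarrow> 'b::real_vector"
  assumes "linear f" "linear g" "\<And>i. f (axis i 1) = g (axis i 1)"
  shows "f = g"
  by (rule linear_eq_stdbasis[OF assms(1,2)]) (use axis_inverse assms(3) in metis)

text \<open>A linear right inverse of \<open>f\<close> embeds the target as a complement of the kernel.\<close>

lemma dim_kernel:
  fixes f :: "'a::euclidean_space \<Rightarrow> 'b::euclidean_space"
  assumes "linear f" "surj f"
  shows "dim {v. f v = 0} + DIM('b) = DIM('a)"
proof -
  obtain s where s: "linear s" "f \<circ> s = id"
    using linear_surjective_right_inverse[OF assms] by blast
  have fs: "f (s w) = w" for w using s(2) by (metis comp_apply id_apply)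
  let ?K = "{v. f v = 0}" and ?R = "range s"
  have sub: "subspace ?K" "subspace ?R"
    using assms(1) s(1) by (auto intro: linear_subspace_kernel linear_subspace_image)
  have "v \<in> {x + y |x y. x \<in> ?K \<and> y \<in> ?R}" for v
  proof -
    have "f (v - s (f v)) = 0" using linear_diff[OF assms(1)] fs by simp
    then have "v - s (f v) \<in> ?K" "v = (v - s (f v)) + s (f v)" by simp_all
    then show ?thesis by blast
  qed
  then have sum: "{x + y |x y. x \<in> ?K \<and> y \<in> ?R} = UNIV" by blast
  have "?K \<inter> ?R = {0}"
    using fs linear_0[OF s(1)] linear_0[OF assms(1)] by (auto intro: image_eqI[of _ _ 0])
  then have int: "dim (?K \<inter> ?R) = 0" by simp
  have "inj s" using fs by (metis injI)
  then have "dim ?R = DIM('b)"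
    using dim_image_eq[OF s(1), of UNIV] by (simp add: inj_on_def)
  then show ?thesis
    using dim_sums_Int[OF sub] unfolding sum int by simp
qed

text \<open>The range of \<open>s\<close> lies in the kernel, and both have half the dimension of the space.\<close>

lemma kernel_eq_range:
  fixes f :: "'a::euclidean_space \<Rightarrow> 'b::euclidean_space" and s :: "'b \<Rightarrow> 'a"
  assumes "linear f" "surj f" "linear s" "inj s" "\<And>w. f (s w) = 0" "DIM('a) = 2 * DIM('b)"
  shows "{v. f v = 0} = range s"
proof -
  have "dim (range s) = DIM('b)"
    using dim_image_eq[OF assms(3), of UNIV] assms(4) by (simp add: inj_on_def)
  then have "range s = {v. f v = 0}"
    using dim_kernel[OF assms(1,2)] assms(5,6)
    by (intro subspace_dim_equal)
      (auto intro: linear_subspace_kernel[OF assms(1)] linear_subspace_image[OF assms(3)])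
  then show ?thesis by simp
qed

text \<open>A proper subspace of \<open>real ^ 'n\<close> has a nonzero normal vector. The normal vectors of the range are
  exactly the linear relations between the components of \<open>f\<close>.\<close>

lemma surj_if_no_annihilator:
  fixes f :: "'a::real_vector \<Rightarrow> real ^ 'n"
  assumes "linear f" "\<And>r. (\<And>v. r \<bullet> f v = 0) \<Longrightarrow> r = 0"
  shows "surj f"
proof (rule ccontr)
  assume "\<not> surj f"
  have sub: "subspace (range f)" using assms(1) by (simp add: linear_subspace_image)
  then have "span (range f) \<noteq> UNIV" using \<open>\<not> surj f\<close> by (metis span_eq_iff)
  then have "span (range f) \<subset> span UNIV" by (simp add: psubset_eq)
  then obtain r where "r \<noteq> 0" "\<And>y. y \<in> span (range f) \<Longrightarrow> orthogonal r y"
    using orthogonal_to_subspace_exists_gen[of "range f" UNIV] by metis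
  then show False using assms(2)[of r] by (metis orthogonal_def rangeI span_base)
qed

locale symplectic = manifold X A for X :: "'m topology" and A :: "('m, 'd::finite) chart set" +
  fixes \<omega> :: "('m, 'd) form2"
  assumes symplectic: "symplectic_manifold X A \<omega>"
begin

lemma form_bilinear: "p \<in> topspace X \<Longrightarrow> bilinear (\<omega> p)"
  and form_nondegenerate: "p \<in> topspace X \<Longrightarrow> (\<And>v. \<omega> p u v = 0) \<Longrightarrow> u = 0"
  and form_smooth: "c \<in> A \<Longrightarrow> smooth_on (snd c ` fst c) (local_form A \<omega> c u v)"
  using symplectic by (auto simp: symplectic_manifold_def smooth_2_form_def)

lemma form_linear:
  assumes "p \<in> topspace X"
  shows "linear (\<omega> p u)" "linear (\<lambda>u. \<omega> p u v)"
  using form_bilinear[OF assms] by (auto simp: bilinear_def)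

lemma form_left:
  assumes "p \<in> topspace X"
  shows "\<omega> p (u + u') v = \<omega> p u v + \<omega> p u' v" "\<omega> p (r *\<^sub>R u) v = r * \<omega> p u v"
    "\<omega> p (\<Sum>i\<in>I. f i) v = (\<Sum>i\<in>I. \<omega> p (f i) v)" "\<omega> p 0 v = 0"
  using linear_add[OF form_linear(2)[OF assms, of v]] linear_scale[OF form_linear(2)[OF assms, of v]]
    linear_sum[OF form_linear(2)[OF assms, of v]] linear_0[OF form_linear(2)[OF assms, of v]]
  by simp_all

text \<open>Nondegeneracy makes the map from \<open>u\<close> to the coefficients of \<open>\<omega>(u, -)\<close> injective, hence surjective.\<close>

lemma ex_form_dual:
  assumes "p \<in> topspace X" "linear L"
  shows "\<exists>u. \<forall>v. \<omega> p u v = L v"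
proof -
  let ?f = "\<lambda>u. \<chi> j. \<omega> p u (axis j 1)"
  have lin: "linear ?f"
    by (intro linearI) (simp_all add: vec_eq_iff form_left[OF assms(1)])
  have ext: "\<omega> p u = L'" if "linear L'" "?f u = (\<chi> j. L' (axis j 1))" for u L'
    using that form_linear(1)[OF assms(1)] by (intro linear_eqI_axis) (auto simp: vec_eq_iff)
  have "u = 0" if "?f u = 0" for u
  proof (rule form_nondegenerate[OF assms(1)])
    have "?f u = (\<chi> j. (\<lambda>_. 0) (axis j (1::real)))" using that by (simp add: vec_eq_iff)
    then have "\<omega> p u = (\<lambda>_. 0)" by (intro ext) (simp_all add: linear_zero)
    then show "\<omega> p u v = 0" for v by simp
  qed
  then have "inj ?f" using lin linear_injective_0 by blast
  then have "surj ?f" using lin linear_injective_imp_surjective by blast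
  from surjD[OF this, of "\<chi> j. L (axis j 1)"]
  obtain u where "(\<chi> j. L (axis j 1)) = ?f u" ..
  then have "\<omega> p u = L" using ext[OF assms(2), of u] by simp
  then show ?thesis by auto
qed

text \<open>In a chart the coordinates of the dual field solve a linear system whose matrix holds the
  coefficients of \<open>\<omega>\<close>, so the field is smooth.\<close>

lemma smooth_dual_field:
  fixes r :: "'m \<Rightarrow> real"
  assumes r: "smooth_fun_on A (topspace X) r"
    and Z: "\<And>p v. p \<in> topspace X \<Longrightarrow> \<omega> p (Z p) v = differential A r p v"
  shows "smooth_vector_field A Z"
  unfolding smooth_vector_field_def
proof
  fix c assume c: "c \<in> A"
  note lc = local_coordsD[OF chart_coords[OF c]]
  let ?S = "snd c ` fst c" and ?T = "coord_vector A c"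
  let ?u = "\<lambda>x. differential A (snd c) (inv_chart c x) (Z (inv_chart c x))"
  let ?M = "\<lambda>x. (\<chi> j i. local_form A \<omega> c (axis i 1) (axis j 1) x) :: real ^ 'd ^ 'd"
  let ?b = "\<lambda>x. (\<chi> j. frechet_derivative (r \<circ> inv_chart c) (at x) (axis j 1)) :: real ^ 'd"
  have smooth: "smooth_on ?S (r \<circ> inv_chart c)"
    using r c lc(3) by (auto simp: smooth_fun_on_def dest!: bspec[of A _ c] elim!: smooth_on_subset)
  have top: "inv_chart c x \<in> topspace X" if "x \<in> ?S" for x using lc that by auto
  have lin: "linear (?T x)" and Tu: "?T x (?u x) = Z (inv_chart c x)" and surj: "surj (?T x)"
    and injT: "?T x v = 0 \<Longrightarrow> v = 0" if "x \<in> ?S" for x v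
    using differential_coord_vector[OF c that] linear_0[of "?T x"] by (metis surjI)+
  have M: "?M x *v v = (\<chi> j. \<omega> (inv_chart c x) (?T x v) (?T x (axis j 1)))" if x: "x \<in> ?S" for x v
  proof -
    have "(\<chi> j. \<omega> (inv_chart c x) (?T x v) (?T x (axis j 1))) $ j = (?M x *v v) $ j" for j
    proof -
      let ?g = "\<lambda>v. \<omega> (inv_chart c x) (?T x v) (?T x (axis j 1))"
      have "linear ?g"
        using linear_compose[OF lin[OF x] form_linear(2)[OF top[OF x]]] by (simp add: o_def)
      from linear_axis_expansion[OF this, of v] show ?thesis
        by (simp add: matrix_vector_mult_def local_form_def mult.commute)
    qed
    then show ?thesis by (simp add: vec_eq_iff)
  qed
  have "Ck_on k ?S ?u" for k
  proof (rule Ck_on_linear_solve[OF lc(2), of k ?M ?b])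
    fix i j
    show "Ck_on k ?S (\<lambda>x. ?M x $ i $ j)"
      using form_smooth[OF c] by (simp add: smooth_on_def)
    show "Ck_on k ?S (\<lambda>x. ?b x $ i)"
      using smooth_on_frechet_derivative[OF smooth] by (simp add: smooth_on_def)
  next
    fix x v assume x: "x \<in> ?S" and "?M x *v v = 0"
    then have 0: "\<omega> (inv_chart c x) (?T x v) (?T x (axis j 1)) = 0" for j
      using M[OF x] by (simp add: vec_eq_iff)
    have "\<omega> (inv_chart c x) (?T x v) \<circ> ?T x = (\<lambda>_. 0)"
      by (rule linear_eqI_axis)
        (use 0 linear_compose[OF lin[OF x] form_linear(1)[OF top[OF x]]] in \<open>auto simp: linear_zero\<close>)
    then have "\<omega> (inv_chart c x) (?T x v) w = 0" for w
      using surj[OF x] by (metis comp_apply surjD)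
    then show "v = 0" using form_nondegenerate[OF top[OF x]] injT[OF x] by blast
  next
    fix x assume x: "x \<in> ?S"
    have "(r \<circ> inv_chart c has_derivative
        (\<lambda>v. differential A r (inv_chart c x) (?T x v))) (at x)"
      unfolding coord_vector_eq
      by (rule differential_chain[OF smooth_param_chart[OF c] x openin_topspace r top[OF x]])
    then show "?M x *v ?u x = ?b x"
      unfolding M[OF x] Tu[OF x] Z[OF top[OF x]]
      using frechet_derivative_at[of "r \<circ> inv_chart c" _ x] by (simp add: vec_eq_iff)
  qed
  then show "smooth_on ?S ?u" by (simp add: smooth_on_def)
qed

text \<open>The Poisson bracket refers to a chosen Hamiltonian field, so it carries information only once
  such a field is known to exist. For a complex function it is the field of the real part plus \<open>\<i>\<close>
  times the field of the imaginary part.\<close>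

lemma hamiltonian_field:
  assumes f: "f \<in> smooth_functions X A"
  shows "is_hamiltonian_field X A \<omega> f (hamiltonian_field X A \<omega> f)"
proof -
  have f': "smooth_fun_on A (topspace X) f" using f by (simp add: smooth_functions_def)
  note top = openin_topspace[of X]
  have D: "differential A (\<lambda>q. Re (f q)) p v = Re (differential A f p v)"
    "differential A (\<lambda>q. Im (f q)) p v = Im (differential A f p v)" if "p \<in> topspace X" for p v
    using differential_linear_compose[OF top f' that bounded_linear_Re]
      differential_linear_compose[OF top f' that bounded_linear_Im] by auto
  have lin: "linear (\<lambda>v. Re (differential A f p v))" "linear (\<lambda>v. Im (differential A f p v))"
    if "p \<in> topspace X" for p
    using linear_compose[OF linear_differential[OF top f' that], of Re]
      linear_compose[OF linear_differential[OF top f' that], of Im]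
      bounded_linear.linear[OF bounded_linear_Re] bounded_linear.linear[OF bounded_linear_Im]
    by (auto simp: o_def)
  have "\<forall>p\<in>topspace X. \<exists>u. \<forall>v. \<omega> p u v = Re (differential A f p v)"
    using ex_form_dual[OF _ lin(1)] by blast
  then obtain P where P: "\<And>p v. p \<in> topspace X \<Longrightarrow> \<omega> p (P p) v = Re (differential A f p v)"
    by (auto dest!: bchoice)
  have "\<forall>p\<in>topspace X. \<exists>u. \<forall>v. \<omega> p u v = Im (differential A f p v)"
    using ex_form_dual[OF _ lin(2)] by blast
  then obtain Q where Q: "\<And>p v. p \<in> topspace X \<Longrightarrow> \<omega> p (Q p) v = Im (differential A f p v)"
    by (auto dest!: bchoice)
  let ?Z = "\<lambda>p. (\<chi> i. Complex (P p $ i) (Q p $ i))"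
  have RI: "Re_vec (?Z p) = P p" "Im_vec (?Z p) = Q p" for p
    by (simp_all add: Re_vec_def Im_vec_def vec_eq_iff)
  have "smooth_vector_field A P"
    by (rule smooth_dual_field[OF smooth_fun_on_linear_compose[OF top f' bounded_linear_Re]])
      (simp add: P D)
  moreover have "smooth_vector_field A Q"
    by (rule smooth_dual_field[OF smooth_fun_on_linear_compose[OF top f' bounded_linear_Im]])
      (simp add: Q D)
  ultimately have "is_hamiltonian_field X A \<omega> f ?Z"
    by (simp add: is_hamiltonian_field_def smooth_complex_vector_field_def RI complex_ext_def
        complex_ext2_def P Q complex_eq_iff)
  then show ?thesis unfolding hamiltonian_field_def
    by (rule someI[of "is_hamiltonian_field X A \<omega> f"])
qed

lemma hamiltonian_field_dual:
  assumes f: "f \<in> smooth_functions X A" and p: "p \<in> topspace X"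
  shows "\<omega> p (Re_vec (hamiltonian_field X A \<omega> f p)) v = Re (differential A f p v)"
    and "\<omega> p (Im_vec (hamiltonian_field X A \<omega> f p)) v = Im (differential A f p v)"
proof -
  let ?Z = "hamiltonian_field X A \<omega> f p" and ?v = "(\<chi> i. complex_of_real (v $ i)) :: complex ^ 'd"
  have f': "smooth_fun_on A (topspace X) f" using f by (simp add: smooth_functions_def)
  have RI: "Re_vec ?v = v" "Im_vec ?v = 0"
    by (simp_all add: Re_vec_def Im_vec_def vec_eq_iff)
  have 0: "differential A f p 0 = 0" "\<omega> p u 0 = 0" for u
    using linear_0[OF linear_differential[OF openin_topspace f' p]] linear_0[OF form_linear(1)[OF p]]
    by auto
  have "complex_ext (differential A f p) ?v = complex_ext2 (\<omega> p) ?Z ?v"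
    using hamiltonian_field[OF f] p unfolding is_hamiltonian_field_def
    by (elim conjE allE[of _ "\<lambda>_. ?v"]) blast
  then show "\<omega> p (Re_vec ?Z) v = Re (differential A f p v)" "\<omega> p (Im_vec ?Z) v = Im (differential A f p v)"
    unfolding complex_ext_def complex_ext2_def RI 0 by (auto simp: complex_eq_iff)
qed

text \<open>The imaginary part of the Hamiltonian vector of \<open>a\<close> vanishes, so the bracket is a derivative along
  a real tangent vector.\<close>

lemma poisson_bracket_real:
  assumes "b \<in> smooth_functions X A" "a \<in> smooth_functions X A" "p \<in> topspace X"
    and "\<And>v. Im (differential A a p v) = 0"
  shows "poisson_bracket X A \<omega> b a p = differential A b p (Re_vec (hamiltonian_field X A \<omega> a p))"
proof -
  have "Im_vec (hamiltonian_field X A \<omega> a p) = 0"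
    using form_nondegenerate[OF assms(3)] hamiltonian_field_dual(2)[OF assms(2,3)] assms(4) by simp
  moreover have "\<omega> p u 0 = 0" for u using linear_0[OF form_linear(1)[OF assms(3)]] .
  ultimately show ?thesis
    using hamiltonian_field_dual[OF assms(1,3)]
    by (simp add: poisson_bracket_def complex_ext2_def complex_eq_iff)
qed

lemma Im_differential_real_valued:
  assumes a: "a \<in> smooth_functions X A" and real: "\<And>q. q \<in> topspace X \<Longrightarrow> a q \<in> \<real>"
    and p: "p \<in> topspace X"
  shows "Im (differential A a p v) = 0"
proof -
  have a': "smooth_fun_on A (topspace X) a" using a by (simp add: smooth_functions_def)
  let ?c = "chart_at A p"
  have c: "?c \<in> A" "p \<in> fst ?c" using chart_around[OF p] by auto
  note lc = local_coordsD[OF chart_coords[OF c(1)]]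
  have "((\<lambda>q. Im (a q)) \<circ> inv_chart ?c has_derivative (\<lambda>v. 0)) (at (snd ?c p))"
    by (rule has_derivative_transform_within_open[OF has_derivative_const[of 0] lc(2)])
      (use lc c real in \<open>auto simp: complex_is_Real_iff\<close>)
  then have "differential A (\<lambda>q. Im (a q)) p v = 0"
    unfolding differential_def using frechet_derivative_at by metis
  then show ?thesis
    using differential_linear_compose[OF openin_topspace a' p bounded_linear_Im] by simp
qed

text \<open>The Hamiltonian vectors of \<open>n\<close> independent commuting functions span an \<open>n\<close>-dimensional space
  on which all the differentials vanish. By dimension it is the common kernel of these
  differentials, and \<open>\<omega>\<close> vanishes on it because \<open>\<omega>(X\<^sub>a, v) = da(v)\<close>.\<close>

lemma commuting_common_kernel:
  fixes a :: "'n::finite \<Rightarrow> 'm \<Rightarrow> complex"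
  assumes dim: "CARD('d) = 2 * CARD('n)"
    and a: "\<And>i. a i \<in> smooth_functions X A" "\<And>i q. q \<in> topspace X \<Longrightarrow> a i q \<in> \<real>"
    and p: "p \<in> topspace X"
    and indep: "real_independent_family (\<lambda>i. differential A (a i) p)"
    and comm: "\<And>i j. poisson_bracket X A \<omega> (a i) (a j) p = 0"
    and v: "\<And>i. differential A (a i) p v = 0"
  shows "(\<And>i. differential A (a i) p w = 0) \<Longrightarrow> \<omega> p v w = 0"
    and "b \<in> smooth_functions X A \<Longrightarrow> (\<And>i. poisson_bracket X A \<omega> b (a i) p = 0) \<Longrightarrow>
      differential A b p v = 0"
proof -
  let ?d = "\<lambda>i. differential A (a i) p"
  have Im0: "Im (?d i v) = 0" for i v
    using Im_differential_real_valued[OF a(1) a(2) p] .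
  define H where "H i = Re_vec (hamiltonian_field X A \<omega> (a i) p)" for i
  have H: "\<omega> p (H i) w = Re (?d i w)" for i w
    unfolding H_def by (rule hamiltonian_field_dual(1)[OF a(1) p])
  have dH: "differential A b p (H i) = 0"
    if "b \<in> smooth_functions X A" "poisson_bracket X A \<omega> b (a i) p = 0" for b i
    using poisson_bracket_real[OF that(1) a(1) p Im0] that(2) by (simp add: H_def)
  define \<Phi> where "\<Phi> v = (\<chi> i. \<omega> p (H i) v)" for v
  define \<sigma> where "\<sigma> r = (\<Sum>i\<in>UNIV. r $ i *\<^sub>R H i)" for r :: "real ^ 'n"
  have lin: "linear \<Phi>" "linear \<sigma>"
    using form_linear(1)[OF p] unfolding \<Phi>_def \<sigma>_def
    by (auto intro!: linearI simp: vec_eq_iff linear_add linear_scale sum.distrib scaleR_left_distrib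
        scaleR_sum_right)
  have indep': "r = 0" if "\<And>v. (\<Sum>i\<in>UNIV. r $ i * \<omega> p (H i) v) = 0" for r :: "real ^ 'n"
  proof -
    have "(\<Sum>i\<in>UNIV. r $ i *\<^sub>R ?d i v) = 0" for v
      using that[of v] Im0 by (simp add: complex_eq_iff H)
    then have "\<forall>i. r $ i = 0"
      using indep unfolding real_independent_family_def by blast
    then show ?thesis by (simp add: vec_eq_iff)
  qed
  have \<sigma>: "\<omega> p (\<sigma> r) v = (\<Sum>i\<in>UNIV. r $ i * \<omega> p (H i) v)" for r v
    by (simp add: \<sigma>_def form_left[OF p])
  have "surj \<Phi>"
    by (rule surj_if_no_annihilator[OF lin(1)], rule indep') (simp add: \<Phi>_def inner_vec_def)
  moreover have "inj \<sigma>"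
  proof (rule iffD2[OF linear_injective_0[OF lin(2)]], intro allI impI)
    fix r assume "\<sigma> r = 0"
    then have "\<omega> p (\<sigma> r) v = 0" for v using linear_0[OF form_linear(2)[OF p]] by simp
    then show "r = 0" using indep' \<sigma> by simp
  qed
  moreover have "\<Phi> (\<sigma> r) = 0" for r
  proof -
    have "\<omega> p (H i) (H j) = 0" for i j using H dH[OF a(1) comm] by simp
    then show ?thesis
      using form_linear(1)[OF p] by (simp add: \<Phi>_def \<sigma>_def linear_sum linear_scale vec_eq_iff)
  qed
  ultimately have "{v. \<Phi> v = 0} = range \<sigma>"
    using lin dim by (intro kernel_eq_range) simp_all
  moreover have "\<Phi> v = 0" using v H by (simp add: \<Phi>_def vec_eq_iff)
  ultimately obtain r where r: "v = \<sigma> r" by blast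
  show "\<omega> p v w = 0" if "\<And>i. ?d i w = 0"
    unfolding r \<sigma> using that by (simp add: H)
  show "differential A b p v = 0"
    if "b \<in> smooth_functions X A" "\<And>i. poisson_bracket X A \<omega> b (a i) p = 0"
  proof -
    have "linear (differential A b p)"
      using that(1) p by (intro linear_differential[OF openin_topspace]) (auto simp: smooth_functions_def)
    then show ?thesis
      using dH[OF that] by (simp add: r \<sigma>_def linear_sum linear_scale)
  qed
qed

end

lemma local_coordsI:
  assumes "openin X U" "open S" "g ` U \<subseteq> S" "e ` S \<subseteq> U"
    and "\<And>p. p \<in> U \<Longrightarrow> e (g p) = p" "\<And>x. x \<in> S \<Longrightarrow> g (e x) = x"
    and "\<And>N. open N \<Longrightarrow> openin X {p \<in> U. g p \<in> N}" "\<And>V. openin X V \<Longrightarrow> open {x \<in> S. e x \<in> V}"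
  shows "local_coords X U S g e"
proof -
  have U: "topspace (subtopology X U) = U" using openin_subset[OF assms(1)] by auto
  have "continuous_map (subtopology X U) euclidean g"
    unfolding continuous_map_def U using assms(7) assms(1)
    by (auto simp: openin_open_subtopology)
  then have "continuous_map (subtopology X U) (top_of_set S) g"
    using assms(3) U by (simp add: continuous_map_in_subtopology image_subset_iff_funcset)
  moreover have "continuous_map (top_of_set S) X e"
    unfolding continuous_map_def using assms(1,2,4,8) openin_subset[OF assms(1)]
    by (auto simp: openin_open_subtopology openin_open_eq)
  then have "continuous_map (top_of_set S) (subtopology X U) e"
    using assms(4) by (simp add: continuous_map_in_subtopology image_subset_iff_funcset)
  ultimately show ?thesis
    using assms(1,2,5,6) U by (simp add: local_coords_def homeomorphic_maps_def)
qed

lemma smooth_on_open_preimage: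
  assumes "smooth_on S f" "open S" "open N"
  shows "open {x \<in> S. f x \<in> N}"
proof -
  have "{x \<in> S. f x \<in> N} = S \<inter> f -` N" by auto
  then show ?thesis using continuous_open_preimage[OF smooth_on_continuous[OF assms(1)] assms(2,3)] by simp
qed

context manifold
begin

text \<open>Maps that are smooth in charts are continuous for the topology of the manifold.\<close>

lemma smooth_param_open_preimage:
  assumes "smooth_param X A N \<sigma>" "openin X V"
  shows "open {z \<in> N. \<sigma> z \<in> V}"
proof (subst open_subopen, rule ballI)
  fix z assume z: "z \<in> {z \<in> N. \<sigma> z \<in> V}"
  then have "\<sigma> z \<in> topspace X" using assms(1) by (auto simp: smooth_param_def)
  then obtain c where c: "c \<in> A" "\<sigma> z \<in> fst c" using chart_around by blast
  note lc = local_coordsD[OF chart_coords[OF c(1)]]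
  let ?N = "{z \<in> N. \<sigma> z \<in> fst c}" and ?V = "snd c ` (fst c \<inter> V)"
  have N: "open ?N" "smooth_on ?N (snd c \<circ> \<sigma>)"
    using assms(1) c(1) by (auto simp: smooth_param_def)
  have V: "open ?V" by (rule local_coords_open_image(1)[OF chart_coords[OF c(1)] assms(2)])
  have "open {w \<in> ?N. (snd c \<circ> \<sigma>) w \<in> ?V}"
    by (rule smooth_on_open_preimage[OF N(2,1) V])
  moreover have "z \<in> {w \<in> ?N. (snd c \<circ> \<sigma>) w \<in> ?V}" using z c by auto
  moreover have "{w \<in> ?N. (snd c \<circ> \<sigma>) w \<in> ?V} \<subseteq> {z \<in> N. \<sigma> z \<in> V}"
  proof
    fix w assume "w \<in> {w \<in> ?N. (snd c \<circ> \<sigma>) w \<in> ?V}"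
    then obtain q where "w \<in> N" "\<sigma> w \<in> fst c" "q \<in> fst c" "q \<in> V" "snd c (\<sigma> w) = snd c q" by auto
    then have "\<sigma> w = q" using lc(5) by metis
    with \<open>w \<in> N\<close> \<open>q \<in> V\<close> show "w \<in> {z \<in> N. \<sigma> z \<in> V}" by simp
  qed
  ultimately show "\<exists>T. open T \<and> z \<in> T \<and> T \<subseteq> {z \<in> N. \<sigma> z \<in> V}" by blast
qed

lemma smooth_fun_on_open_preimage:
  assumes "openin X U" "smooth_fun_on A U f" "open N"
  shows "openin X {p \<in> U. f p \<in> N}"
proof (subst openin_subopen, rule ballI)
  fix p assume p: "p \<in> {p \<in> U. f p \<in> N}"
  then obtain c where c: "c \<in> A" "p \<in> fst c"
    using openin_subset[OF assms(1)] chart_around[of p] by blast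
  note lc = local_coordsD[OF chart_coords[OF c(1)]]
  let ?S = "snd c ` (fst c \<inter> U)"
  have S: "open ?S" by (rule local_coords_open_image(1)[OF chart_coords[OF c(1)] assms(1)])
  have "smooth_on ?S (f \<circ> inv_chart c)" using assms(2) c(1) by (simp add: smooth_fun_on_def)
  then have "open {x \<in> ?S. (f \<circ> inv_chart c) x \<in> N}"
    by (rule smooth_on_open_preimage[OF _ S assms(3)])
  then have o: "openin X {q \<in> fst c. snd c q \<in> {x \<in> ?S. (f \<circ> inv_chart c) x \<in> N}}"
    by (rule local_coords_open_preimage[OF chart_coords[OF c(1)]])
  have "{q \<in> fst c. snd c q \<in> {x \<in> ?S. (f \<circ> inv_chart c) x \<in> N}} \<subseteq> {p \<in> U. f p \<in> N}"
  proof
    fix q assume "q \<in> {q \<in> fst c. snd c q \<in> {x \<in> ?S. (f \<circ> inv_chart c) x \<in> N}}"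
    then obtain q' where q: "q \<in> fst c" "f (inv_chart c (snd c q)) \<in> N"
      and q': "q' \<in> fst c" "q' \<in> U" "snd c q = snd c q'" by auto
    then have "q = q'" using lc(5) by metis
    with q q' lc(5)[OF q(1)] show "q \<in> {p \<in> U. f p \<in> N}" by simp
  qed
  moreover have "p \<in> {q \<in> fst c. snd c q \<in> {x \<in> ?S. (f \<circ> inv_chart c) x \<in> N}}"
    using p c lc(5) by auto
  ultimately show "\<exists>T. openin X T \<and> p \<in> T \<and> T \<subseteq> {p \<in> U. f p \<in> N}" using o by blast
qed

lemma smooth_fun_on_Pair:
  assumes "openin X U" "smooth_fun_on A U f" "smooth_fun_on A U g"
  shows "smooth_fun_on A U (\<lambda>q. (f q, g q))"
  unfolding smooth_fun_on_def
proof
  fix c assume c: "c \<in> A"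
  have "smooth_on (snd c ` (fst c \<inter> U)) (\<lambda>x. ((f \<circ> inv_chart c) x, (g \<circ> inv_chart c) x))"
    using assms(2,3) c
    by (intro smooth_on_Pair local_coords_open_image(1)[OF chart_coords[OF c] assms(1)])
      (auto simp only: smooth_fun_on_def)
  then show "smooth_on (snd c ` (fst c \<inter> U)) ((\<lambda>q. (f q, g q)) \<circ> inv_chart c)"
    by (simp add: o_def)
qed

lemma smooth_fun_on_vec_lambda:
  fixes f :: "'i::finite \<Rightarrow> 'm \<Rightarrow> real"
  assumes "openin X U" "\<And>i. smooth_fun_on A U (f i)"
  shows "smooth_fun_on A U (\<lambda>q. \<chi> i. f i q)"
  unfolding smooth_fun_on_def
proof
  fix c assume c: "c \<in> A"
  have "smooth_on (snd c ` (fst c \<inter> U)) (\<lambda>x. \<chi> i. (f i \<circ> inv_chart c) x)"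
    using assms(2) c
    by (intro smooth_on_vec_lambda local_coords_open_image(1)[OF chart_coords[OF c] assms(1)])
      (auto simp only: smooth_fun_on_def)
  then show "smooth_on (snd c ` (fst c \<inter> U)) ((\<lambda>q. \<chi> i. f i q) \<circ> inv_chart c)"
    by (simp add: o_def)
qed

end

section \<open>Coordinates adapted to commuting functions\<close>

locale commuting_functions = symplectic X A \<omega>
  for X :: "'m topology" and A :: "('m, 'd::finite) chart set" and \<omega> :: "('m, 'd) form2" +
  fixes \<A> :: "('m \<Rightarrow> complex) set"
  assumes functions_smooth: "\<A> \<subseteq> smooth_functions X A"
    and commuting: "\<And>a b p. a \<in> \<A> \<Longrightarrow> b \<in> \<A> \<Longrightarrow> p \<in> topspace X \<Longrightarrow> poisson_bracket X A \<omega> a b p = 0"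
begin

text \<open>Coordinates \<open>G\<close> with inverse \<open>E\<close> whose first component consists of functions in \<open>\<A>\<close>.
  They take values in a product, so that the fibres of the first component are the slices
  \<open>z \<mapsto> E (y, z)\<close>. The equation between the dimensions makes these slices half-dimensional.\<close>

definition adapted ::
    "'m set \<Rightarrow> ((real ^ 'n::finite) \<times> (real ^ 'n)) set \<Rightarrow> ('m \<Rightarrow> (real ^ 'n) \<times> (real ^ 'n)) \<Rightarrow>
     ((real ^ 'n) \<times> (real ^ 'n) \<Rightarrow> 'm) \<Rightarrow> bool" where
  "adapted W \<Omega> G E \<longleftrightarrow> CARD('d) = 2 * CARD('n) \<and> local_coords X W \<Omega> G E \<and>
     smooth_fun_on A W G \<and> smooth_param X A \<Omega> E \<and>
     (\<exists>a. (\<forall>i. a i \<in> \<A> \<and> (\<forall>q\<in>topspace X. a i q \<in> \<real>)) \<and>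
          (\<forall>q\<in>W. \<forall>i. a i q = complex_of_real (fst (G q) $ i)))"

lemma adaptedD:
  assumes "adapted W \<Omega> G E"
  shows "local_coords X W \<Omega> G E" "smooth_fun_on A W G" "smooth_param X A \<Omega> E"
  using assms by (auto simp: adapted_def)

lemma smooth_function: "b \<in> \<A> \<Longrightarrow> smooth_fun_on A (topspace X) b"
  using functions_smooth by (auto simp: smooth_functions_def)

text \<open>In adapted coordinates \<open>a\<^sub>i\<close> is the \<open>i\<close>-th coordinate function. So the \<open>a\<^sub>i\<close> are independent at every
  point of the domain and the vectors \<open>(0, s)\<close> lie in the common kernel of their differentials.\<close>

lemma adapted_slice_derivative:
  fixes E :: "(real ^ 'n::finite) \<times> (real ^ 'n) \<Rightarrow> 'm"
  assumes ad: "adapted W \<Omega> G E" and x: "x \<in> \<Omega>"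
  shows "\<omega> (E x) (param_derivative A E x (0, s)) (param_derivative A E x (0, s')) = 0"
    and "b \<in> \<A> \<Longrightarrow> differential A b (E x) (param_derivative A E x (0, s)) = 0"
proof -
  obtain a :: "'n \<Rightarrow> 'm \<Rightarrow> complex" where a: "\<And>i. a i \<in> \<A>" "\<And>i q. q \<in> topspace X \<Longrightarrow> a i q \<in> \<real>"
    and aG: "\<And>i q. q \<in> W \<Longrightarrow> a i q = complex_of_real (fst (G q) $ i)"
    using ad unfolding adapted_def by blast
  have dim: "CARD('d) = 2 * CARD('n)" using ad by (simp add: adapted_def)
  note lc = local_coordsD[OF adaptedD(1)[OF ad]]
  have p: "E x \<in> topspace X" using lc x by blast
  let ?D = "param_derivative A E x"
  have da: "differential A (a i) (E x) (?D v) = complex_of_real (fst v $ i)" for i v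
  proof -
    have "(a i \<circ> E has_derivative (\<lambda>v. differential A (a i) (E x) (?D v))) (at x)"
      by (rule differential_chain[OF adaptedD(3)[OF ad] x openin_topspace smooth_function[OF a(1)] p])
    moreover have "((\<lambda>w. complex_of_real (fst w $ i)) has_derivative (\<lambda>w. complex_of_real (fst w $ i))) (at x)"
      by (intro bounded_linear_imp_has_derivative bounded_linear_compose[OF bounded_linear_of_real]
          bounded_linear_compose[OF bounded_linear_vec_nth] bounded_linear_fst)
    then have "(a i \<circ> E has_derivative (\<lambda>w. complex_of_real (fst w $ i))) (at x)"
      by (rule has_derivative_transform_within_open[OF _ lc(2) x]) (use lc aG in auto)
    ultimately show ?thesis using has_derivative_unique by metis
  qed
  have indep: "real_independent_family (\<lambda>i. differential A (a i) (E x))"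
    unfolding real_independent_family_def
  proof (intro allI impI)
    fix r :: "'n \<Rightarrow> real" and j
    assume "\<forall>v. (\<Sum>i\<in>UNIV. r i *\<^sub>R differential A (a i) (E x) v) = 0"
    then have "(\<Sum>i\<in>UNIV. r i *\<^sub>R differential A (a i) (E x) (?D (axis j 1, 0))) = 0" by blast
    then have "complex_of_real (\<Sum>i\<in>UNIV. r i * axis j 1 $ i) = 0"
      unfolding da by (simp add: scaleR_conv_of_real)
    then have "(\<Sum>i\<in>UNIV. r i * axis j 1 $ i) = 0" by (simp only: of_real_eq_0_iff)
    then show "r j = 0" by (simp add: axis_def if_distrib cong: if_cong)
  qed
  have s: "\<And>i. a i \<in> smooth_functions X A" using a functions_smooth by blast
  have comm: "\<And>i j. poisson_bracket X A \<omega> (a i) (a j) (E x) = 0" using commuting a p by blast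
  have 0: "differential A (a i) (E x) (?D (0, s)) = 0" for i s by (simp add: da)
  note ck = commuting_common_kernel[OF dim s a(2) p indep comm 0]
  show "\<omega> (E x) (?D (0, s)) (?D (0, s')) = 0" by (rule ck(1)) (simp_all add: 0)
  show "differential A b (E x) (?D (0, s)) = 0" if "b \<in> \<A>"
    by (rule ck(2)) (use that functions_smooth commuting a p in auto)
qed

text \<open>The derivative along a slice vanishes, and a convex slice joins any two of its points.\<close>

lemma constant_on_slices:
  assumes ad: "adapted W \<Omega> G E" and b: "b \<in> \<A>"
    and C: "convex C" "{y} \<times> C \<subseteq> \<Omega>" "z \<in> C" "z' \<in> C"
  shows "b (E (y, z)) = b (E (y, z'))"
proof -
  have "((\<lambda>z. b (E (y, z))) has_derivative (\<lambda>h. 0)) (at w within C)" if "w \<in> C" for w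
  proof -
    have w: "(y, w) \<in> \<Omega>" using C that by blast
    then have "E (y, w) \<in> topspace X" using local_coordsD[OF adaptedD(1)[OF ad]] by blast
    then have "(b \<circ> E has_derivative
        (\<lambda>v. differential A b (E (y, w)) (param_derivative A E (y, w) v))) (at (y, w))"
      by (rule differential_chain[OF adaptedD(3)[OF ad] w openin_topspace smooth_function[OF b]])
    moreover have "((\<lambda>z. (y, z)) has_derivative (\<lambda>h. (0, h))) (at w)"
      by (auto intro!: derivative_eq_intros)
    ultimately have "(b \<circ> E \<circ> (\<lambda>z. (y, z)) has_derivative
        (\<lambda>v. differential A b (E (y, w)) (param_derivative A E (y, w) v)) \<circ> (\<lambda>h. (0, h))) (at w)"
      by (rule diff_chain_at[rotated])
    then have "((\<lambda>z. b (E (y, z))) has_derivative (\<lambda>h. 0)) (at w)"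
      using adapted_slice_derivative(2)[OF ad w b] by (simp add: o_def)
    then show ?thesis by (rule has_derivative_at_withinI)
  qed
  then obtain k where "\<And>w. w \<in> C \<Longrightarrow> b (E (y, w)) = k"
    using has_derivative_zero_constant[OF C(1), of "\<lambda>z. b (E (y, z))"] by blast
  with C show ?thesis by simp
qed

lemma adapted_restrict:
  assumes ad: "adapted W \<Omega> G E" and "open \<Omega>'" "\<Omega>' \<subseteq> \<Omega>"
  shows "adapted (E ` \<Omega>') \<Omega>' G E"
proof -
  note lc = local_coordsD[OF adaptedD(1)[OF ad]]
  have eq: "E ` \<Omega>' = {q \<in> W. G q \<in> \<Omega>'}"
  proof (intro equalityI subsetI)
    fix q assume "q \<in> E ` \<Omega>'"
    then obtain x where "q = E x" "x \<in> \<Omega>'" by blast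
    moreover from this have "x \<in> \<Omega>" using assms(3) by blast
    ultimately show "q \<in> {q \<in> W. G q \<in> \<Omega>'}" using lc(6,7)[of x] by simp
  next
    fix q assume "q \<in> {q \<in> W. G q \<in> \<Omega>'}"
    then show "q \<in> E ` \<Omega>'" using lc(5)[of q] by (metis (mono_tags, lifting) imageI mem_Collect_eq)
  qed
  have o: "openin X (E ` \<Omega>')"
    unfolding eq by (rule local_coords_open_preimage[OF adaptedD(1)[OF ad] assms(2)])
  have sp: "smooth_param X A \<Omega>' E" by (rule smooth_param_subset[OF adaptedD(3)[OF ad] assms(2,3)])
  have sub: "E ` \<Omega>' \<subseteq> W" unfolding eq by auto
  have sf: "smooth_fun_on A (E ` \<Omega>') G"
    by (rule smooth_fun_on_subset[OF adaptedD(2)[OF ad] sub])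
  have "local_coords X (E ` \<Omega>') \<Omega>' G E"
  proof (rule local_coordsI[OF o assms(2)])
    show "G ` E ` \<Omega>' \<subseteq> \<Omega>'" unfolding eq by blast
    show "E (G p) = p" if "p \<in> E ` \<Omega>'" for p using that sub lc(5) by blast
    show "G (E x) = x" if "x \<in> \<Omega>'" for x using that assms(3) lc(7) by blast
  qed (use smooth_fun_on_open_preimage[OF o sf] smooth_param_open_preimage[OF sp] in simp_all)
  with sf sp ad sub show ?thesis unfolding adapted_def by blast
qed

text \<open>The functions \<open>a\<close> are completed to coordinates by a linear function of the chart that is
  injective on the common kernel of their differentials.\<close>

lemma ex_adapted:
  fixes a :: "'n::finite \<Rightarrow> 'm \<Rightarrow> complex"
  assumes dim: "CARD('d) = 2 * CARD('n)" and p: "p \<in> topspace X"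
    and a: "\<And>i. a i \<in> \<A>" "\<And>i q. q \<in> topspace X \<Longrightarrow> a i q \<in> \<real>"
    and indep: "real_independent_family (\<lambda>i. differential A (a i) p)"
  shows "\<exists>W \<Omega> (G :: 'm \<Rightarrow> (real ^ 'n) \<times> (real ^ 'n)) E. adapted W \<Omega> G E \<and> p \<in> W"
proof -
  define c where "c = chart_at A p"
  have c: "c \<in> A" "p \<in> fst c" using chart_around[OF p] by (auto simp: c_def)
  note lc = local_coordsD[OF chart_coords[OF c(1)]]
  let ?S = "snd c ` fst c" and ?x = "snd c p"
  have x: "?x \<in> ?S" using c by blast
  have asm: "\<And>i. smooth_fun_on A (fst c) (a i)"
    using smooth_fun_on_subset[OF smooth_function[OF a(1)] lc(3)] .
  have Im0: "Im (differential A (a i) p v) = 0" for i v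
    using Im_differential_real_valued[of "a i" p v] a functions_smooth p by blast
  define L where "L v = (\<chi> i. Re (differential A (a i) p v))" for v
  have lind: "linear (differential A (a i) p)" for i
    using linear_differential[OF openin_topspace smooth_function[OF a(1)] p] .
  have L: "linear L"
    unfolding L_def by (auto intro!: linearI simp: vec_eq_iff linear_add[OF lind] linear_scale[OF lind])
  have "surj L"
  proof (rule surj_if_no_annihilator[OF L])
    fix r :: "real ^ 'n" assume "\<And>v. r \<bullet> L v = 0"
    then have "\<forall>v. (\<Sum>i\<in>UNIV. r $ i *\<^sub>R differential A (a i) p v) = 0"
      using Im0 by (simp add: complex_eq_iff inner_vec_def L_def)
    then have "\<forall>i. r $ i = 0" using indep unfolding real_independent_family_def by blast
    then show "r = 0" by (simp add: vec_eq_iff)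
  qed
  then obtain s where s: "linear s" "L \<circ> s = id" using linear_surjective_right_inverse[OF L] by blast
  have "dim {v. L v = 0} = dim (UNIV :: (real ^ 'n) set)"
    using dim_kernel[OF L \<open>surj L\<close>] dim by simp
  then obtain f g where f: "linear f" and g: "linear g"
    and gf: "\<And>v. v \<in> {v. L v = 0} \<Longrightarrow> g (f v :: real ^ 'n) = v"
    using isometries_subspaces[OF linear_subspace_kernel[OF L] subspace_UNIV] by metis
  define l where "l v = f (v - s (L v))" for v
  have l: "linear l"
    unfolding l_def by (auto intro!: linearI simp: linear_add[OF f] linear_add[OF L] linear_add[OF s(1)]
        linear_diff[OF f] linear_scale[OF f] linear_scale[OF L] linear_scale[OF s(1)] scaleR_diff_right)
  \<comment> \<open>\<open>v - s (L v)\<close> projects to the kernel of \<open>L\<close>, which \<open>f\<close> identifies with the second factor.\<close>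
  have inj: "v = 0" if "L v = 0" "l v = 0" for v
    using that gf[of v] linear_0[OF s(1)] linear_0[OF g] by (simp add: l_def)
  \<comment> \<open>The inverse function theorem is applied to a self-map of \<open>real ^ 'd\<close>, so the product is identified
    with that space by a linear isomorphism.\<close>
  have "dim (UNIV :: ((real ^ 'n) \<times> (real ^ 'n)) set) = dim (UNIV :: (real ^ 'd) set)"
    using dim by simp
  then obtain J :: "(real ^ 'n) \<times> (real ^ 'n) \<Rightarrow> real ^ 'd" and J' where J: "linear J" "linear J'"
    and JJ: "\<And>w. J' (J w) = w" "\<And>v. J (J' v) = v"
    using isometries_subspaces[OF subspace_UNIV subspace_UNIV] by (metis UNIV_I)
  note bl = J[unfolded linear_conv_bounded_linear] l[unfolded linear_conv_bounded_linear]
  let ?G = "\<lambda>q. (\<chi> i. Re (a i q), l (snd c q))"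
  have sG: "smooth_fun_on A (fst c) ?G"
    by (intro smooth_fun_on_Pair lc smooth_fun_on_vec_lambda smooth_fun_on_linear_compose[OF lc(1) _ bl(3)]
        smooth_fun_on_linear_compose[OF lc(1) asm bounded_linear_Re] smooth_fun_on_chart[OF c(1)])
  define F where "F = (\<lambda>q. J (?G q)) \<circ> inv_chart c"
  have sF: "smooth_on ?S F"
    using smooth_param_compose[OF smooth_param_chart[OF c(1)] lc(1)
        smooth_fun_on_linear_compose[OF lc(1) sG bl(1)]] lc(6) by (auto simp: F_def)
  have dF: "frechet_derivative F (at ?x) v = J (L v, l v)" for v
  proof -
    have da: "(a i \<circ> inv_chart c has_derivative differential A (a i) p) (at ?x)" for i
      unfolding differential_def c_def[symmetric]
      by (rule smooth_on_has_derivative[of ?S])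
        (use smooth_param_compose[OF smooth_param_chart[OF c(1)] lc(1) asm] lc(6) x in auto)
    have "((\<lambda>x. \<Sum>i\<in>UNIV. Re ((a i \<circ> inv_chart c) x) *\<^sub>R axis i (1::real)) has_derivative
        (\<lambda>v. \<Sum>i\<in>UNIV. Re (differential A (a i) p v) *\<^sub>R axis i 1)) (at ?x)"
      by (intro has_derivative_sum has_derivative_scaleR_left
          bounded_linear.has_derivative[OF bounded_linear_Re] da)
    moreover have "(\<Sum>i\<in>UNIV. g i *\<^sub>R axis i (1::real)) = (\<chi> i. g i)" for g :: "'n \<Rightarrow> real"
      by (simp add: vec_eq_iff axis_def if_distrib cong: if_cong)
    ultimately have "((\<lambda>x. \<chi> i. Re (a i (inv_chart c x))) has_derivative L) (at ?x)"
      by (simp add: L_def[abs_def])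
    then have "((\<lambda>x. J (\<chi> i. Re (a i (inv_chart c x)), l x)) has_derivative (\<lambda>v. J (L v, l v))) (at ?x)"
      by (intro bounded_linear.has_derivative[OF bl(1)] has_derivative_Pair
          bounded_linear_imp_has_derivative[OF bl(3)])
    then have "(F has_derivative (\<lambda>v. J (L v, l v))) (at ?x)"
      by (rule has_derivative_transform_within_open[OF _ lc(2) x]) (use lc in \<open>auto simp: F_def\<close>)
    then have "frechet_derivative F (at ?x) = (\<lambda>v. J (L v, l v))"
      by (rule frechet_derivative_at[symmetric])
    then show ?thesis by simp
  qed
  have "v = 0" if "frechet_derivative F (at ?x) v = 0" for v
  proof -
    have "J' (J (L v, l v)) = 0" using that dF linear_0[OF J(2)] by simp
    then show ?thesis using inj by (simp add: JJ zero_prod_def)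
  qed
  from smooth_inverse_function[OF lc(2) sF x this]
  obtain U V h where U: "open U" "U \<subseteq> ?S" "?x \<in> U" and V: "open V"
    and hom: "homeomorphism U V F h" and h: "smooth_on V h" by blast
  have hF: "\<And>x. x \<in> U \<Longrightarrow> h (F x) = x \<and> F x \<in> V" "\<And>y. y \<in> V \<Longrightarrow> F (h y) = y \<and> h y \<in> U"
    using hom by (auto simp: homeomorphism_def)
  let ?W = "{q \<in> fst c. snd c q \<in> U}" and ?\<Omega> = "J -` V" and ?E = "\<lambda>w. inv_chart c (h (J w))"
  have W: "openin X ?W" by (rule local_coords_open_preimage[OF chart_coords[OF c(1)] U(1)])
  have sW: "smooth_fun_on A ?W ?G" by (rule smooth_fun_on_subset[OF sG]) auto
  have \<Omega>: "open ?\<Omega>"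
    using V linear_continuous_on[OF bl(1), of UNIV] by (simp add: continuous_on_open_vimage)
  have JV: "J ` ?\<Omega> \<subseteq> V" by auto
  have "smooth_param X A ?\<Omega> ?E"
  proof (rule smooth_param_reparametrize[OF smooth_param_chart[OF c(1)] \<Omega>])
    show "(\<lambda>w. h (J w)) ` ?\<Omega> \<subseteq> ?S" using hF(2) U(2) by auto
    show "smooth_on ?\<Omega> (\<lambda>w. h (J w))"
      by (rule smooth_on_compose[OF \<Omega> V JV smooth_on_bounded_linear[OF bl(1)] h])
  qed
  note sE = this
  have JG: "J (?G q) = F (snd c q)" if "q \<in> fst c" for q using that lc by (simp add: F_def)
  have "local_coords X ?W ?\<Omega> ?G ?E"
  proof (rule local_coordsI[OF W \<Omega>])
    show "?G ` ?W \<subseteq> ?\<Omega>" using JG hF(1) by auto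
    show "?E ` ?\<Omega> \<subseteq> ?W"
    proof (rule image_subsetI)
      fix w assume "w \<in> ?\<Omega>"
      then have "h (J w) \<in> U" using hF(2) by simp
      then show "?E w \<in> ?W" using lc(6,7)[of "h (J w)"] U(2) by auto
    qed
    show "?E (?G q) = q" if "q \<in> ?W" for q using that JG hF(1) lc by auto
    show "?G (?E w) = w" if "w \<in> ?\<Omega>" for w
    proof -
      have "h (J w) \<in> ?S" using that hF(2) U(2) by auto
      then have "J (?G (?E w)) = F (h (J w))" by (simp add: F_def)
      then have "J (?G (?E w)) = J w" using hF(2) that by simp
      then show ?thesis using JJ by metis
    qed
  qed (use smooth_fun_on_open_preimage[OF W sW] smooth_param_open_preimage[OF sE] in auto)
  moreover have "a i q = complex_of_real (fst (?G q) $ i)" if "q \<in> ?W" for i q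
    using a(2)[of q i] that lc(3) by auto
  ultimately have "adapted ?W ?\<Omega> ?G ?E"
    unfolding adapted_def using dim sW sE a by blast
  moreover have "p \<in> ?W" using c U by auto
  ultimately show ?thesis by blast
qed

end

section \<open>A countable coherent family of flow boxes\<close>

lemma Lindelof_indexed:
  assumes "Lindelof_space X" "\<And>p. p \<in> topspace X \<Longrightarrow> openin X (V p)" "\<And>p. p \<in> topspace X \<Longrightarrow> p \<in> V p"
  obtains I where "countable I" "I \<subseteq> topspace X" "(\<Union>p\<in>I. V p) = topspace X"
proof -
  have "(\<Union>p\<in>topspace X. V p) = topspace X"
    using assms(2,3) openin_subset by fastforce
  then obtain \<V> where \<V>: "countable \<V>" "\<V> \<subseteq> V ` topspace X" "\<Union>\<V> = topspace X"
    using assms(1,2) unfolding Lindelof_space_def by (metis (no_types, lifting) imageE)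
  then obtain I where "countable I" "I \<subseteq> topspace X" "\<V> = V ` I"
    by (metis countable_subset_image)
  with \<V>(3) that show ?thesis by blast
qed

lemma finite_common_neighbourhood:
  assumes "finite I" "x \<in> topspace X"
    and "\<And>i. i \<in> I \<Longrightarrow> \<exists>N. openin X N \<and> x \<in> N \<and> P i N"
    and "\<And>i M N. P i N \<Longrightarrow> M \<subseteq> N \<Longrightarrow> P i M"
  shows "\<exists>N. openin X N \<and> x \<in> N \<and> (\<forall>i\<in>I. P i N)"
  using assms(1,3)
proof (induction I)
  case empty
  then show ?case using assms(2) openin_topspace by blast
next
  case (insert i I)
  then obtain N M where "openin X N" "x \<in> N" "\<forall>j\<in>I. P j N" "openin X M" "x \<in> M" "P i M"
    by (metis insert_iff)
  then have "openin X (N \<inter> M)" "x \<in> N \<inter> M" "\<forall>j\<in>insert i I. P j (N \<inter> M)"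
    using assms(4) by blast+
  then show ?case by blast
qed

context commuting_functions
begin

text \<open>Convexity of the second side makes the slices of a box connected.\<close>

definition flow_box ::
    "'m set \<Rightarrow> (real ^ 'n::finite) set \<Rightarrow> (real ^ 'n) set \<Rightarrow> ('m \<Rightarrow> (real ^ 'n) \<times> (real ^ 'n)) \<Rightarrow>
     ((real ^ 'n) \<times> (real ^ 'n) \<Rightarrow> 'm) \<Rightarrow> bool" where
  "flow_box U B C G E \<longleftrightarrow> adapted U (B \<times> C) G E \<and> open B \<and> open C \<and> convex C \<and> C \<noteq> {}"

lemma ex_flow_box:
  assumes ad: "adapted W \<Omega> G E" and "x \<in> W" "openin X N" "x \<in> N"
  shows "\<exists>U B C. flow_box U B C G E \<and> x \<in> U \<and> U \<subseteq> N \<and> U \<subseteq> W"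
proof -
  note lc = local_coordsD[OF adaptedD(1)[OF ad]]
  let ?\<Omega> = "{w \<in> \<Omega>. E w \<in> N}"
  have "open ?\<Omega>" by (rule smooth_param_open_preimage[OF adaptedD(3)[OF ad] assms(3)])
  moreover have "G x \<in> ?\<Omega>" using lc assms by simp
  ultimately obtain B C' where B: "open B" "open C'" "G x \<in> B \<times> C'" "B \<times> C' \<subseteq> ?\<Omega>"
    by (rule open_prod_elim)
  then have "snd (G x) \<in> C'" by auto
  then obtain e where e: "e > 0" "ball (snd (G x)) e \<subseteq> C'"
    using B(2) open_contains_ball by blast
  let ?C = "ball (snd (G x)) e"
  have x: "G x \<in> B \<times> ?C" using B(3) e(1) by (cases "G x") auto
  have sub: "B \<times> ?C \<subseteq> ?\<Omega>" using B(4) e(2) by blast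
  have "adapted (E ` (B \<times> ?C)) (B \<times> ?C) G E"
    by (rule adapted_restrict[OF ad open_Times[OF B(1) open_ball]]) (use sub in blast)
  then have "flow_box (E ` (B \<times> ?C)) B ?C G E" using B(1) e(1) by (simp add: flow_box_def)
  moreover have "x \<in> E ` (B \<times> ?C)" using x lc(5)[OF assms(2)] by (metis imageI)
  moreover have "E ` (B \<times> ?C) \<subseteq> N" "E ` (B \<times> ?C) \<subseteq> W" using sub lc(6) by auto
  ultimately show ?thesis by blast
qed

lemma flow_box_constant:
  assumes fb: "flow_box U B C G E" and b: "b \<in> \<A>" and q: "q \<in> U" "q' \<in> U" "fst (G q) = fst (G q')"
  shows "b q = b q'"
proof -
  have ad: "adapted U (B \<times> C) G E" and C: "convex C" using fb by (auto simp: flow_box_def)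
  note lc = local_coordsD[OF adaptedD(1)[OF ad]]
  obtain y z where y: "G q = (y, z)" by fastforce
  obtain z' where z': "G q' = (y, z')" using q(3) y by (metis fst_conv surj_pair)
  have "(y, z) \<in> B \<times> C" "(y, z') \<in> B \<times> C" using lc(4) q y z' by metis+
  then have "b (E (y, z)) = b (E (y, z'))"
    by (intro constant_on_slices[OF ad b C]) auto
  then show ?thesis using lc(5) q y z' by metis
qed

text \<open>The first coordinates of \<open>G'\<close> are functions in \<open>\<A>\<close>, hence constant on the slices of the box.\<close>

lemma flow_box_finer:
  assumes fb: "flow_box U B C G E" and ad: "adapted W \<Omega> G' E'"
    and q: "q \<in> U \<inter> W" "q' \<in> U \<inter> W" "fst (G q) = fst (G q')"
  shows "fst (G' q) = fst (G' q')"
proof -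
  obtain a where a: "\<And>i. a i \<in> \<A>" "\<And>i q. q \<in> W \<Longrightarrow> a i q = complex_of_real (fst (G' q) $ i)"
    using ad unfolding adapted_def by blast
  have "complex_of_real (fst (G' q) $ i) = complex_of_real (fst (G' q') $ i)" for i
    using flow_box_constant[OF fb a(1)[of i], of q q'] a(2)[of q i] a(2)[of q' i] q by simp
  then show ?thesis by (simp add: vec_eq_iff)
qed

text \<open>Each of the two coordinate systems has a box around \<open>x\<close> in the domain of the other one; on the
  intersection of these boxes both inclusions between the fibres hold.\<close>

lemma ex_common_fibres:
  assumes "adapted W1 \<Omega>1 G1 E1" "adapted W2 \<Omega>2 G2 E2" "x \<in> W1" "x \<in> W2"
  shows "\<exists>N. openin X N \<and> x \<in> N \<and>
    (\<forall>q\<in>N. \<forall>q'\<in>N. fst (G1 q) = fst (G1 q') \<longleftrightarrow> fst (G2 q) = fst (G2 q'))"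
proof -
  have o: "openin X W1" "openin X W2" using assms adaptedD(1) local_coordsD(1) by blast+
  obtain U1 B1 C1 where 1: "flow_box U1 B1 C1 G1 E1" "x \<in> U1" "U1 \<subseteq> W2" "U1 \<subseteq> W1"
    using ex_flow_box[OF assms(1,3) o(2) assms(4)] by blast
  obtain U2 B2 C2 where 2: "flow_box U2 B2 C2 G2 E2" "x \<in> U2" "U2 \<subseteq> W1" "U2 \<subseteq> W2"
    using ex_flow_box[OF assms(2,4) o(1) assms(3)] by blast
  have "openin X U1" "openin X U2"
    using 1(1) 2(1) unfolding flow_box_def by (blast dest: adaptedD(1) local_coordsD(1))+
  then have "openin X (U1 \<inter> U2)" by blast
  moreover have "\<forall>q\<in>U1 \<inter> U2. \<forall>q'\<in>U1 \<inter> U2. fst (G1 q) = fst (G1 q') \<longleftrightarrow> fst (G2 q) = fst (G2 q')"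
    using flow_box_finer[OF 1(1) assms(2)] flow_box_finer[OF 2(1) assms(1)] 1 2 by blast
  ultimately show ?thesis using 1(2) 2(2) by blast
qed

text \<open>The image of a closed ball is compact, hence closed in the Hausdorff manifold.\<close>

lemma ex_shrunk:
  assumes ad: "adapted W \<Omega> G E" and "x \<in> W"
  shows "\<exists>V K. openin X V \<and> closedin X K \<and> x \<in> V \<and> V \<subseteq> K \<and> K \<subseteq> W"
proof -
  note lc = local_coordsD[OF adaptedD(1)[OF ad]]
  obtain e where e: "e > 0" "cball (G x) e \<subseteq> \<Omega>"
    using lc(2) lc(4)[OF assms(2)] open_contains_cball by blast
  let ?V = "{q \<in> W. G q \<in> ball (G x) e}" and ?K = "E ` cball (G x) e"
  have "openin X ?V"
    by (rule local_coords_open_preimage[OF adaptedD(1)[OF ad] open_ball])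
  moreover have "continuous_map (top_of_set \<Omega>) (subtopology X W) E"
    using adaptedD(1)[OF ad] by (simp add: local_coords_def homeomorphic_maps_def)
  then have "continuous_map (top_of_set \<Omega>) X E" using continuous_map_in_subtopology by blast
  then have "compactin X ?K"
    by (rule image_compactin[rotated]) (use e in \<open>simp add: compactin_subtopology\<close>)
  then have "closedin X ?K"
    using smooth_manifold compactin_imp_closedin by (auto simp: smooth_manifold_def)
  moreover have "x \<in> ?V" using assms(2) e(1) by simp
  moreover have "?V \<subseteq> ?K"
  proof
    fix q assume "q \<in> ?V"
    then have "q = E (G q)" "G q \<in> cball (G x) e" using lc(5) by auto
    then show "q \<in> ?K" by blast
  qed
  moreover have "?K \<subseteq> W" using e(2) lc(6) by blast
  ultimately show ?thesis by blast
qed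

text \<open>Number a countable family of adapted coordinates whose shrunken domains cover the manifold,
  and give every point \<open>x\<close> an index \<open>k x\<close> whose shrunken domain contains it. The box
  around \<open>x\<close> is built in the coordinates \<open>k x\<close> and so small that, for each of the finitely many
  indices up to \<open>k x\<close>, it either misses the shrunken domain or lies where those coordinates have the
  same fibres. Of two boxes that meet, the one with the larger index was compared in this way with
  the coordinates of the other one. To miss a shrunken domain is an
  open condition once that domain is enlarged to a closed set inside the original one.\<close>

lemma ex_coherent_flow_boxes:
  assumes cover: "\<And>p. p \<in> topspace X \<Longrightarrow>
      \<exists>W \<Omega> (G :: 'm \<Rightarrow> (real ^ 'n::finite) \<times> (real ^ 'n)) E. adapted W \<Omega> G E \<and> p \<in> W"
  obtains J U B C and G :: "'m \<Rightarrow> 'm \<Rightarrow> (real ^ 'n) \<times> (real ^ 'n)" and E where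
    "countable J" "(\<Union>x\<in>J. U x) = topspace X"
    "\<And>x. x \<in> J \<Longrightarrow> flow_box (U x) (B x) (C x) (G x) (E x)"
    "\<And>x y p q. x \<in> J \<Longrightarrow> y \<in> J \<Longrightarrow> p \<in> U x \<inter> U y \<Longrightarrow> q \<in> U x \<inter> U y \<Longrightarrow>
      fst (G x p) = fst (G x q) \<longleftrightarrow> fst (G y p) = fst (G y q)"
proof -
  have L: "Lindelof_space X"
    using smooth_manifold second_countable_imp_Lindelof_space by (auto simp: smooth_manifold_def)
  have "\<forall>p\<in>topspace X. \<exists>W \<Omega> (G :: 'm \<Rightarrow> (real ^ 'n) \<times> (real ^ 'n)) E V K. adapted W \<Omega> G E \<and>
      openin X V \<and> closedin X K \<and> p \<in> V \<and> V \<subseteq> K \<and> K \<subseteq> W"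
    using cover ex_shrunk by meson
  then obtain W \<Omega> E V K and G :: "'m \<Rightarrow> 'm \<Rightarrow> (real ^ 'n) \<times> (real ^ 'n)" where
    ad: "\<And>p. p \<in> topspace X \<Longrightarrow> adapted (W p) (\<Omega> p) (G p) (E p)"
    and V: "\<And>p. p \<in> topspace X \<Longrightarrow> openin X (V p)" "\<And>p. p \<in> topspace X \<Longrightarrow> p \<in> V p"
    and K: "\<And>p. p \<in> topspace X \<Longrightarrow> closedin X (K p)"
    and VK: "\<And>p. p \<in> topspace X \<Longrightarrow> V p \<subseteq> K p" and KW: "\<And>p. p \<in> topspace X \<Longrightarrow> K p \<subseteq> W p"
    unfolding bchoice_iff by blast
  obtain I where I: "countable I" "I \<subseteq> topspace X" "(\<Union>p\<in>I. V p) = topspace X"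
    using Lindelof_indexed[OF L V] by blast
  define rank where "rank = to_nat_on I"
  have rank: "inj_on rank I" using I(1) by (simp add: rank_def inj_on_to_nat_on)
  have "\<forall>x\<in>topspace X. \<exists>k. k \<in> I \<and> x \<in> V k" using I(3) by blast
  then obtain k where k: "\<And>x. x \<in> topspace X \<Longrightarrow> k x \<in> I" "\<And>x. x \<in> topspace X \<Longrightarrow> x \<in> V (k x)"
    unfolding bchoice_iff by blast
  \<comment> \<open>\<open>P x j N\<close> depends only on \<open>N\<close> being small, so finitely many instances can be met at once.\<close>
  define P where "P x j N \<longleftrightarrow> (if x \<in> K j then \<forall>q\<in>N. \<forall>q'\<in>N.
      fst (G j q) = fst (G j q') \<longleftrightarrow> fst (G (k x) q) = fst (G (k x) q') else N \<inter> K j = {})" for x j N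
  have P: "\<exists>N. openin X N \<and> x \<in> N \<and> P x j N" if x: "x \<in> topspace X" and j: "j \<in> I" for x j
  proof (cases "x \<in> K j")
    case True
    have j': "j \<in> topspace X" and kx: "k x \<in> topspace X" using j k(1)[OF x] I(2) by auto
    have "x \<in> W j" "x \<in> W (k x)" using True KW[OF j'] KW[OF kx] VK[OF kx] k(2)[OF x] by auto
    from ex_common_fibres[OF ad[OF j'] ad[OF kx] this] show ?thesis using True by (simp add: P_def)
  next
    case False
    have "openin X (topspace X - K j)" using j K I(2) by blast
    then show ?thesis using False x unfolding P_def by auto
  qed
  have "\<exists>U B C. flow_box U B C (G (k x)) (E (k x)) \<and> x \<in> U \<and> U \<subseteq> V (k x) \<and>
      (\<forall>j\<in>I. rank j \<le> rank (k x) \<longrightarrow> P x j U)" if x: "x \<in> topspace X" for x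
  proof -
    have kx: "k x \<in> topspace X" using k(1)[OF x] I(2) by auto
    let ?I = "{j \<in> I. rank j \<le> rank (k x)}"
    have "finite (rank ` ?I)" by (rule finite_subset[of _ "{..rank (k x)}"]) auto
    then have "finite ?I" by (rule finite_imageD) (use rank in \<open>auto intro: inj_on_subset\<close>)
    have mono: "P x j M" if "P x j N" "M \<subseteq> N" for j M N
      using that unfolding P_def by (auto split: if_splits)
    have nbhd: "\<exists>N. openin X N \<and> x \<in> N \<and> P x j N" if "j \<in> ?I" for j
      using P[OF x] that by blast
    have "\<exists>N. openin X N \<and> x \<in> N \<and> (\<forall>j\<in>?I. P x j N)"
      by (rule finite_common_neighbourhood[of ?I x X "P x", OF \<open>finite ?I\<close> x])
        (fact nbhd, fact mono)
    then obtain N where N: "openin X N" "x \<in> N" "\<forall>j\<in>?I. P x j N" by (elim exE conjE)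
    have "x \<in> W (k x)" using KW[OF kx] VK[OF kx] k(2)[OF x] by blast
    moreover have "openin X (N \<inter> V (k x))" using N(1) V(1)[OF kx] by blast
    ultimately obtain U B C where U: "flow_box U B C (G (k x)) (E (k x))" "x \<in> U" "U \<subseteq> N \<inter> V (k x)"
      using ex_flow_box[OF ad[OF kx], of x "N \<inter> V (k x)"] N(2) k(2)[OF x] by blast
    then have "\<forall>j\<in>I. rank j \<le> rank (k x) \<longrightarrow> P x j U" using N(3) mono by blast
    with U show ?thesis by blast
  qed
  then have "\<forall>x\<in>topspace X. \<exists>U B C. flow_box U B C (G (k x)) (E (k x)) \<and> x \<in> U \<and> U \<subseteq> V (k x) \<and>
      (\<forall>j\<in>I. rank j \<le> rank (k x) \<longrightarrow> P x j U)" by blast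
  then obtain U B C where fb: "\<And>x. x \<in> topspace X \<Longrightarrow> flow_box (U x) (B x) (C x) (G (k x)) (E (k x))"
    and U: "\<And>x. x \<in> topspace X \<Longrightarrow> x \<in> U x" "\<And>x. x \<in> topspace X \<Longrightarrow> U x \<subseteq> V (k x)"
    and PU: "\<And>x j. x \<in> topspace X \<Longrightarrow> j \<in> I \<Longrightarrow> rank j \<le> rank (k x) \<Longrightarrow> P x j (U x)"
    unfolding bchoice_iff by blast
  have coherent: "fst (G (k x) p) = fst (G (k x) q) \<longleftrightarrow> fst (G (k y) p) = fst (G (k y) q)"
    if x: "x \<in> topspace X" and y: "y \<in> topspace X" and pq: "p \<in> U x \<inter> U y" "q \<in> U x \<inter> U y"
      and le: "rank (k y) \<le> rank (k x)" for x y p q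
  proof -
    have "p \<in> K (k y)" using pq U(2)[OF y] VK k(1)[OF y] I(2) by blast
    then have "U x \<inter> K (k y) \<noteq> {}" using pq by blast
    then show ?thesis using PU[OF x k(1)[OF y] le] pq unfolding P_def by (auto split: if_splits)
  qed
  have "openin X (U x)" if "x \<in> topspace X" for x
    using fb[OF that] unfolding flow_box_def by (blast dest: adaptedD(1) local_coordsD(1))
  then obtain J where J: "countable J" "J \<subseteq> topspace X" "(\<Union>x\<in>J. U x) = topspace X"
    using Lindelof_indexed[OF L _ U(1)] by blast
  show ?thesis
  proof (rule that[OF J(1,3)])
    show "flow_box (U x) (B x) (C x) (G (k x)) (E (k x))" if "x \<in> J" for x
      using fb that J(2) by blast
    show "fst (G (k x) p) = fst (G (k x) q) \<longleftrightarrow> fst (G (k y) p) = fst (G (k y) q)"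
      if "x \<in> J" "y \<in> J" "p \<in> U x \<inter> U y" "q \<in> U x \<inter> U y" for x y p q
    proof -
      have xy: "x \<in> topspace X" "y \<in> topspace X" using that J(2) by auto
      show ?thesis
        using coherent[OF xy that(3,4)] coherent[OF xy(2,1), of p q] that(3,4) nat_le_linear by blast
    qed
  qed
qed

end

section \<open>The foliated atlas\<close>

locale coherent_flow_boxes = commuting_functions X A \<omega> \<A>
  for X :: "'m topology" and A :: "('m, 'd::finite) chart set" and \<omega> :: "('m, 'd) form2"
    and \<A> :: "('m \<Rightarrow> complex) set" +
  fixes J :: "'i set" and U :: "'i \<Rightarrow> 'm set" and B C :: "'i \<Rightarrow> (real ^ 'n::finite) set"
    and G :: "'i \<Rightarrow> 'm \<Rightarrow> (real ^ 'n) \<times> (real ^ 'n)" and E :: "'i \<Rightarrow> (real ^ 'n) \<times> (real ^ 'n) \<Rightarrow> 'm"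
  assumes countable_index: "countable J" and boxes_cover: "(\<Union>x\<in>J. U x) = topspace X"
    and box: "\<And>x. x \<in> J \<Longrightarrow> flow_box (U x) (B x) (C x) (G x) (E x)"
    and coherent: "\<And>x y p q. x \<in> J \<Longrightarrow> y \<in> J \<Longrightarrow> p \<in> U x \<inter> U y \<Longrightarrow> q \<in> U x \<inter> U y \<Longrightarrow>
      fst (G x p) = fst (G x q) \<longleftrightarrow> fst (G y p) = fst (G y q)"
begin

definition atlas :: "('m, 'n) fchart set" where
  "atlas = (\<lambda>x. (U x, \<lambda>q. fst (G x q))) ` J"

context
  fixes x assumes x: "x \<in> J"
begin

lemma box_adapted: "adapted (U x) (B x \<times> C x) (G x) (E x)"
  and box_sides: "open (B x)" "open (C x)" "convex (C x)" "C x \<noteq> {}"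
  using box[OF x] by (auto simp: flow_box_def)

lemmas box_coords = adaptedD(1)[OF box_adapted]
lemmas box_smooth = adaptedD(2,3)[OF box_adapted]

lemma box_open: "openin X (U x)" and box_subset: "U x \<subseteq> topspace X"
  using local_coordsD(1,3)[OF box_coords] by auto

lemma box_in:
  "p \<in> U x \<Longrightarrow> fst (G x p) \<in> B x" "p \<in> U x \<Longrightarrow> snd (G x p) \<in> C x" "p \<in> U x \<Longrightarrow> E x (G x p) = p"
  "y \<in> B x \<Longrightarrow> z \<in> C x \<Longrightarrow> E x (y, z) \<in> U x" "y \<in> B x \<Longrightarrow> z \<in> C x \<Longrightarrow> G x (E x (y, z)) = (y, z)"
  using local_coordsD(4-7)[OF box_coords] by (auto simp: mem_Times_iff)

lemma smooth_first_coords: "smooth_fun_on A (U x) (\<lambda>q. fst (G x q))"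
  and smooth_second_coords: "smooth_fun_on A (U x) (\<lambda>q. snd (G x q))"
  by (rule smooth_fun_on_linear_compose[OF box_open box_smooth(1)], simp add: bounded_linear_fst bounded_linear_snd)+

lemma first_coords_image: "(\<lambda>q. fst (G x q)) ` U x = B x"
proof
  show "(\<lambda>q. fst (G x q)) ` U x \<subseteq> B x" using box_in(1) by blast
  obtain z where z: "z \<in> C x" using box_sides(4) by blast
  show "B x \<subseteq> (\<lambda>q. fst (G x q)) ` U x"
  proof
    fix y assume y: "y \<in> B x"
    show "y \<in> (\<lambda>q. fst (G x q)) ` U x"
      by (rule image_eqI[of _ _ "E x (y, z)"]) (use box_in(4,5) y z in auto)
  qed
qed

lemma foliated_chart_box: "foliated_chart X A (U x, \<lambda>q. fst (G x q))"
  unfolding foliated_chart_def fst_conv snd_conv first_coords_image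
proof (intro conjI ballI)
  fix p assume p: "p \<in> U x"
  then have w: "G x p \<in> B x \<times> C x" "E x (G x p) = p"
    using box_in by (auto simp: mem_Times_iff)
  let ?h = "\<lambda>q. fst (G x q)"
  have "(?h \<circ> E x has_derivative
      (\<lambda>v. differential A ?h (E x (G x p)) (param_derivative A (E x) (G x p) v))) (at (G x p))"
    by (rule differential_chain[OF box_smooth(2) w(1) box_open smooth_first_coords]) (simp add: w p)
  moreover have "(?h \<circ> E x has_derivative fst) (at (G x p))"
    by (rule has_derivative_transform_within_open[OF bounded_linear_imp_has_derivative[OF bounded_linear_fst]
          open_Times[OF box_sides(1,2)] w(1)]) (use box_in in auto)
  ultimately have "(\<lambda>v. differential A ?h p (param_derivative A (E x) (G x p) v)) = fst"
    using has_derivative_unique w(2) by metis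
  then have *: "differential A ?h p (param_derivative A (E x) (G x p) v) = fst v" for v
    by (rule fun_cong)
  show "surj (differential A ?h p)"
    by (rule surjI[of _ "\<lambda>y. param_derivative A (E x) (G x p) (y, 0)"]) (simp add: *)
qed (fact box_open box_sides smooth_first_coords)+

end

text \<open>Fixing the second coordinate gives a local section of the first coordinates of \<open>x\<close>; composed
  with the first coordinates of \<open>y\<close> it shows that the transition map is smooth.\<close>

lemma smooth_transition:
  assumes x: "x \<in> J" and y: "y \<in> J"
    and \<xi>: "\<And>p. p \<in> U x \<inter> U y \<Longrightarrow> \<xi> (fst (G x p)) = fst (G y p)"
  shows "open ((\<lambda>q. fst (G x q)) ` (U x \<inter> U y))" "smooth_on ((\<lambda>q. fst (G x q)) ` (U x \<inter> U y)) \<xi>"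
proof -
  let ?D = "U x \<inter> U y" and ?S = "(\<lambda>q. fst (G x q)) ` (U x \<inter> U y)"
  have D: "open (G x ` ?D)" "G x ` ?D = {w \<in> B x \<times> C x. E x w \<in> U y}"
    using local_coords_open_image[OF box_coords[OF x] box_open[OF y]] by auto
  have "smooth_param X A (G x ` ?D) (E x)"
    by (rule smooth_param_subset[OF box_smooth(2)[OF x] D(1)]) (use D(2) in auto)
  then have s: "smooth_on (G x ` ?D) ((\<lambda>q. fst (G y q)) \<circ> E x)"
    by (rule smooth_param_compose[OF _ box_open[OF y] smooth_first_coords[OF y]]) (use D(2) in auto)
  show "open ?S" using open_image_fst[OF D(1)] by (simp add: image_image)
  show "smooth_on ?S \<xi>"
  proof (rule smooth_on_local)
    fix r assume "r \<in> ?S"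
    then obtain p where p: "p \<in> ?D" "r = fst (G x p)" by blast
    define z where "z = snd (G x p)"
    let ?T = "{w. (w, z) \<in> G x ` ?D}"
    have T: "smooth_on ?T (\<lambda>w. ((\<lambda>q. fst (G y q)) \<circ> E x) (w, z))" "open ?T"
      using smooth_on_slice[OF D(1) s] by auto
    have "smooth_on ?T \<xi>"
    proof (rule smooth_on_transform[OF T])
      fix w assume "w \<in> ?T"
      then obtain q where q: "q \<in> ?D" "(w, z) = G x q" by blast
      then have "E x (w, z) = q" using box_in(3)[OF x, of q] by simp
      then show "((\<lambda>q. fst (G y q)) \<circ> E x) (w, z) = \<xi> w"
        using \<xi>[OF q(1)] q(2) by (metis comp_apply fst_conv)
    qed
    moreover have "r \<in> ?T" using p by (auto simp: z_def intro!: image_eqI[of _ _ p])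
    ultimately show "\<exists>T. open T \<and> r \<in> T \<and> smooth_on T \<xi>" using T(2) by blast
  qed
qed

text \<open>Coherence says that the value of one submersion determines the value of the other one on the whole
  intersection, so the transition map is well defined and injective.\<close>

lemma fcompatible_boxes:
  assumes x: "x \<in> J" and y: "y \<in> J"
  shows "fcompatible (U x, \<lambda>q. fst (G x q)) (U y, \<lambda>q. fst (G y q))"
proof -
  let ?D = "U x \<inter> U y" and ?hx = "\<lambda>q. fst (G x q)" and ?hy = "\<lambda>q. fst (G y q)"
  define \<xi> where "\<xi> r = ?hy (inv_into ?D ?hx r)" for r
  have \<xi>: "\<xi> (?hx p) = ?hy p" if p: "p \<in> ?D" for p
  proof -
    have "inv_into ?D ?hx (?hx p) \<in> ?D" "?hx (inv_into ?D ?hx (?hx p)) = ?hx p"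
      using inv_into_into[of "?hx p" ?hx ?D] f_inv_into_f[of "?hx p" ?hx ?D] p by blast+
    then show ?thesis unfolding \<xi>_def using coherent[OF x y _ p] by blast
  qed
  have inj: "inj_on \<xi> (?hx ` ?D)"
  proof (rule inj_onI)
    fix r r' assume "r \<in> ?hx ` ?D" "r' \<in> ?hx ` ?D" "\<xi> r = \<xi> r'"
    then obtain p p' where p: "p \<in> ?D" "p' \<in> ?D" "r = ?hx p" "r' = ?hx p'" by blast
    then have "?hy p = ?hy p'" using \<open>\<xi> r = \<xi> r'\<close> \<xi> by metis
    then show "r = r'" using coherent[OF x y p(1,2)] p by simp
  qed
  have im: "\<xi> ` ?hx ` ?D = ?hy ` ?D" unfolding image_image by (rule image_cong[OF refl]) (rule \<xi>)
  have inv: "inv_into (?hx ` ?D) \<xi> (?hy p) = ?hx p" if "p \<in> ?D" for p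
    using inv_into_f_f[OF inj, of "?hx p"] \<xi>[OF that] that by simp
  have D: "U y \<inter> U x = ?D" by blast
  have "diffeomorphism (?hx ` ?D) (?hy ` ?D) \<xi>"
    unfolding diffeomorphism_def bij_betw_def
    using smooth_transition[OF x y \<xi>] smooth_transition[OF y x, of "inv_into (?hx ` ?D) \<xi>"] inv inj im
    unfolding D by blast
  then show ?thesis unfolding fcompatible_def using \<xi> by auto
qed

lemma foliated_atlas: "foliated_atlas X A atlas"
  unfolding foliated_atlas_def atlas_def
  using foliated_chart_box fcompatible_boxes boxes_cover by auto

section \<open>Plaques and leaves\<close>

text \<open>For \<open>s\<close> outside the first side \<open>B x\<close> this is empty; otherwise it is a connected slice, and thus
  the only component of its fibre.\<close>

definition plaque :: "'i \<Rightarrow> real ^ 'n \<Rightarrow> 'm set" where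
  "plaque x s = {p \<in> U x. fst (G x p) = s}"

lemma plaque_eq_image:
  assumes "x \<in> J" "s \<in> B x"
  shows "plaque x s = (\<lambda>z. E x (s, z)) ` C x"
proof (intro equalityI subsetI)
  fix p assume "p \<in> plaque x s"
  then have p: "p \<in> U x" "G x p = (s, snd (G x p))" by (auto simp: plaque_def prod_eq_iff)
  show "p \<in> (\<lambda>z. E x (s, z)) ` C x"
    by (rule image_eqI[of _ _ "snd (G x p)"]) (use p box_in(2,3)[OF assms(1) p(1)] in metis)+
next
  fix p assume "p \<in> (\<lambda>z. E x (s, z)) ` C x"
  then show "p \<in> plaque x s" using box_in(4,5)[OF assms(1,2)] by (auto simp: plaque_def)
qed

lemma continuous_map_slice:
  assumes "x \<in> J" "s \<in> B x"
  shows "continuous_map (top_of_set (C x)) X (\<lambda>z. E x (s, z))"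
proof -
  have "continuous_map (top_of_set (B x \<times> C x)) (subtopology X (U x)) (E x)"
    using box_coords[OF assms(1)] by (simp add: local_coords_def homeomorphic_maps_def)
  then have "continuous_map (top_of_set (B x \<times> C x)) X (E x)"
    using continuous_map_in_subtopology by blast
  moreover have "continuous_map (top_of_set (C x)) (top_of_set (B x \<times> C x)) (\<lambda>z. (s, z))"
    using assms(2) by (auto intro!: continuous_intros)
  ultimately have "continuous_map (top_of_set (C x)) X (E x \<circ> (\<lambda>z. (s, z)))"
    by (rule continuous_map_compose[rotated])
  then show ?thesis by (simp add: o_def)
qed

lemma connectedin_plaque:
  assumes "x \<in> J" "s \<in> B x"
  shows "connectedin X (plaque x s)"
  unfolding plaque_eq_image[OF assms]
  by (rule connectedin_continuous_map_image[OF continuous_map_slice[OF assms]])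
    (use box_sides(3)[OF assms(1)] in \<open>simp add: connectedin_subtopology convex_connected\<close>)

lemma plaque_nonempty: "x \<in> J \<Longrightarrow> s \<in> B x \<Longrightarrow> plaque x s \<noteq> {}"
  using box_sides(4) by (simp add: plaque_eq_image)

lemma plaque_empty: "x \<in> J \<Longrightarrow> s \<notin> B x \<Longrightarrow> plaque x s = {}"
  using box_in(1) by (auto simp: plaque_def)

lemma plaque_subset: "x \<in> J \<Longrightarrow> plaque x s \<subseteq> topspace X"
  using box_subset by (auto simp: plaque_def)

lemma plaques_atlas: "plaques X atlas = {plaque x s |x s. x \<in> J \<and> s \<in> B x}"
proof -
  have "connected_components_of (subtopology X (plaque x s)) = (if s \<in> B x then {plaque x s} else {})"
    if x: "x \<in> J" for x s
  proof (cases "s \<in> B x")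
    case True
    have ts: "topspace (subtopology X (plaque x s)) = plaque x s" using plaque_subset[OF x] by auto
    have "connected_space (subtopology X (plaque x s))"
      using connectedin_plaque[OF x True] by (simp add: connectedin_def)
    moreover have "subtopology X (plaque x s) \<noteq> trivial_topology"
      using plaque_nonempty[OF x True] ts by (metis topspace_discrete_topology)
    ultimately show ?thesis
      using True ts by (simp add: connected_components_of_connected_space)
  next
    case False
    then show ?thesis using plaque_empty[OF x] by (simp add: connected_components_of_eq_empty)
  qed
  then have "plaques X atlas = (\<Union>x\<in>J. \<Union>s. if s \<in> B x then {plaque x s} else {})"
    unfolding plaques_def atlas_def by (simp add: plaque_def)
  then show ?thesis by (auto split: if_splits)
qed

text \<open>By coherence, a plaque that meets a box lies in a single plaque of that box there. This single
  fact makes intersections of plaques open and keeps the number of plaques in a leaf countable.\<close>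

lemma plaque_Int:
  assumes "x \<in> J" "y \<in> J" "plaque x s \<inter> plaque y t \<noteq> {}"
  shows "plaque x s \<inter> plaque y t = plaque x s \<inter> U y"
proof -
  obtain p where p: "p \<in> U x" "p \<in> U y" "fst (G x p) = s" "fst (G y p) = t"
    using assms(3) by (auto simp: plaque_def)
  have "fst (G y q) = t" if "q \<in> U x" "q \<in> U y" "fst (G x q) = s" for q
    using coherent[OF assms(1,2), of p q] p that by simp
  then show ?thesis by (auto simp: plaque_def)
qed

definition meet :: "('m set \<times> 'm set) set" where
  "meet = {(P, Q). P \<in> plaques X atlas \<and> Q \<in> plaques X atlas \<and> P \<inter> Q \<noteq> {}}"

text \<open>Chains of plaques are reachability in the graph of meeting plaques, which gives induction on the
  length of a chain.\<close>

lemma plaque_related_iff: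
  "plaque_related X atlas p q \<longleftrightarrow>
    (\<exists>P Q. P \<in> plaques X atlas \<and> p \<in> P \<and> q \<in> Q \<and> (P, Q) \<in> meet\<^sup>*)"
proof
  assume "plaque_related X atlas p q"
  then obtain l P where P: "\<forall>j\<le>l. P j \<in> plaques X atlas" "p \<in> P 0" "q \<in> P l"
    "\<forall>j\<in>{1..l::nat}. P (j - 1) \<inter> P j \<noteq> {}"
    unfolding plaque_related_def by blast
  have "(P i, P (Suc i)) \<in> meet" if "i < l" for i
    using P(1) P(4)[rule_format, of "Suc i"] that by (simp add: meet_def)
  then have "(P 0, P l) \<in> meet ^^ l" unfolding relpow_fun_conv by blast
  then have "(P 0, P l) \<in> meet\<^sup>*" by (rule relpow_imp_rtrancl)
  with P show "\<exists>P Q. P \<in> plaques X atlas \<and> p \<in> P \<and> q \<in> Q \<and> (P, Q) \<in> meet\<^sup>*" by blast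
next
  assume "\<exists>P Q. P \<in> plaques X atlas \<and> p \<in> P \<and> q \<in> Q \<and> (P, Q) \<in> meet\<^sup>*"
  then obtain P Q l where P: "P \<in> plaques X atlas" "p \<in> P" "q \<in> Q" "(P, Q) \<in> meet ^^ l"
    by (meson rtrancl_imp_relpow)
  then obtain f where f: "f 0 = P" "f l = Q" "\<forall>i<l. (f i, f (Suc i)) \<in> meet"
    unfolding relpow_fun_conv by blast
  have "f j \<in> plaques X atlas" if "j \<le> l" for j
    using that f P(1) by (cases j) (auto simp: meet_def Suc_le_eq)
  moreover have "f (j - 1) \<inter> f j \<noteq> {}" if "j \<in> {1..l}" for j
  proof -
    have "j - 1 < l" "Suc (j - 1) = j" using that by auto
    then show ?thesis using f(3)[rule_format, of "j - 1"] by (simp add: meet_def)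
  qed
  ultimately show "plaque_related X atlas p q"
    unfolding plaque_related_def using f(1,2) P(2,3) by blast
qed

lemma ex_plaque: "p \<in> topspace X \<Longrightarrow> \<exists>P\<in>plaques X atlas. p \<in> P"
proof -
  assume "p \<in> topspace X"
  then obtain x where x: "x \<in> J" "p \<in> U x" using boxes_cover by blast
  then have "p \<in> plaque x (fst (G x p))" "fst (G x p) \<in> B x" using box_in(1) by (auto simp: plaque_def)
  then show ?thesis unfolding plaques_atlas using x(1) by blast
qed

lemma meet_plaque: "(P, Q) \<in> meet\<^sup>* \<Longrightarrow> P \<in> plaques X atlas \<Longrightarrow> Q \<in> plaques X atlas"
  by (induction rule: rtrancl_induct) (auto simp: meet_def)

lemma leafE:
  assumes "L \<in> leaves X atlas"
  obtains P0 where "P0 \<in> plaques X atlas" "L = \<Union> (meet\<^sup>* `` {P0})"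
proof -
  obtain p where p: "p \<in> topspace X" "L = {q \<in> topspace X. plaque_related X atlas p q}"
    using assms unfolding leaves_def quotient_def by auto
  obtain P0 where P0: "P0 \<in> plaques X atlas" "p \<in> P0" using ex_plaque[OF p(1)] by blast
  have sub: "Q \<subseteq> topspace X" if "Q \<in> plaques X atlas" for Q
    using that plaque_subset unfolding plaques_atlas by blast
  have "L = \<Union> (meet\<^sup>* `` {P0})"
  proof (intro equalityI subsetI)
    fix q assume "q \<in> L"
    then obtain P Q where PQ: "P \<in> plaques X atlas" "p \<in> P" "q \<in> Q" "(P, Q) \<in> meet\<^sup>*"
      using p(2) plaque_related_iff by auto
    then have "(P0, P) \<in> meet" using P0 by (auto simp: meet_def)
    then show "q \<in> \<Union> (meet\<^sup>* `` {P0})" using PQ by (auto intro: converse_rtrancl_into_rtrancl)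
  next
    fix q assume "q \<in> \<Union> (meet\<^sup>* `` {P0})"
    then show "q \<in> L" using P0 meet_plaque sub p(2) plaque_related_iff by blast
  qed
  with P0(1) that show ?thesis by blast
qed

lemma plaque_in_leaf:
  assumes "L \<in> leaves X atlas" "P \<in> plaques X atlas" "P \<inter> L \<noteq> {}"
  shows "P \<subseteq> L"
proof -
  obtain P0 where P0: "P0 \<in> plaques X atlas" "L = \<Union> (meet\<^sup>* `` {P0})" using leafE[OF assms(1)] .
  obtain q Q where q: "q \<in> P" "q \<in> Q" "(P0, Q) \<in> meet\<^sup>*" using assms(3) P0(2) by blast
  then have "Q \<in> plaques X atlas" using P0(1) meet_plaque by blast
  then have "(Q, P) \<in> meet" using q assms(2) by (auto simp: meet_def)
  with q(3) have "(P0, P) \<in> meet\<^sup>*" by (rule rtrancl_into_rtrancl)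
  then show ?thesis using P0(2) by blast
qed

lemma leaf_eq_Union: "L \<in> leaves X atlas \<Longrightarrow> L = \<Union> {P \<in> plaques X atlas. P \<subseteq> L}"
proof -
  assume L: "L \<in> leaves X atlas"
  then have "L \<subseteq> topspace X" unfolding leaves_def quotient_def by auto
  show ?thesis
  proof (intro equalityI subsetI)
    fix q assume "q \<in> L"
    then obtain P where "P \<in> plaques X atlas" "q \<in> P" using ex_plaque \<open>L \<subseteq> topspace X\<close> by blast
    moreover from this have "P \<subseteq> L" using plaque_in_leaf[OF L] \<open>q \<in> L\<close> by blast
    ultimately show "q \<in> \<Union> {P \<in> plaques X atlas. P \<subseteq> L}" by blast
  qed blast
qed

text \<open>A plaque meets at most one plaque of each box, so after each number of steps only countably many
  plaques are reached.\<close>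

lemma countable_leaf_plaques:
  assumes "L \<in> leaves X atlas"
  shows "countable {P \<in> plaques X atlas. P \<subseteq> L}"
proof -
  have step: "countable (meet `` {P})" for P
  proof (cases "P \<in> plaques X atlas")
    case True
    then obtain x s where P: "x \<in> J" "P = plaque x s" unfolding plaques_atlas by blast
    have "meet `` {P} \<subseteq> (\<Union>y\<in>J. {plaque y t |t. P \<inter> plaque y t \<noteq> {}})"
      unfolding meet_def plaques_atlas by blast
    moreover have "countable {plaque y t |t. P \<inter> plaque y t \<noteq> {}}" if y: "y \<in> J" for y
    proof -
      have "t = t'" if t: "P \<inter> plaque y t \<noteq> {}" and t': "P \<inter> plaque y t' \<noteq> {}" for t t'
        using plaque_Int[OF P(1) y, of s t] plaque_Int[OF P(1) y, of s t'] t t'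
        unfolding P(2) by (auto simp: plaque_def)
      then have "{plaque y t |t. P \<inter> plaque y t \<noteq> {}} = {} \<or>
          (\<exists>Q. {plaque y t |t. P \<inter> plaque y t \<noteq> {}} = {Q})" by blast
      then show ?thesis by auto
    qed
    ultimately show ?thesis using countable_index by (meson countable_UN countable_subset)
  next
    case False
    then have "meet `` {P} = {}" by (auto simp: meet_def)
    then show ?thesis by simp
  qed
  have power: "countable ((meet ^^ n) `` {P})" for n P
  proof (induction n)
    case (Suc n)
    have "(meet ^^ Suc n) `` {P} = (\<Union>Q\<in>(meet ^^ n) `` {P}. meet `` {Q})" by auto
    then show ?case using Suc step by simp
  qed simp
  obtain P0 where P0: "P0 \<in> plaques X atlas" "L = \<Union> (meet\<^sup>* `` {P0})" using leafE[OF assms] .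
  have "{P \<in> plaques X atlas. P \<subseteq> L} \<subseteq> meet\<^sup>* `` {P0}"
  proof clarify
    fix P assume P: "P \<in> plaques X atlas" "P \<subseteq> L"
    then have "P \<noteq> {}" unfolding plaques_atlas using plaque_nonempty by blast
    then obtain q Q where q: "q \<in> P" "q \<in> Q" "(P0, Q) \<in> meet\<^sup>*" using P(2) P0(2) by blast
    then have "Q \<in> plaques X atlas" using P0(1) meet_plaque by blast
    then have "(Q, P) \<in> meet" using q P(1) by (auto simp: meet_def)
    with q(3) show "(P0, P) \<in> meet\<^sup>*" by (rule rtrancl_into_rtrancl)
  qed
  also have "meet\<^sup>* `` {P0} = (\<Union>n. (meet ^^ n) `` {P0})" by (auto simp: rtrancl_power)
  finally show ?thesis using power by (meson countable_UN countableI_type countable_subset)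
qed

lemma constant_on_leaf:
  assumes L: "L \<in> leaves X atlas" and b: "b \<in> \<A>" and p: "p \<in> L" "q \<in> L"
  shows "b p = b q"
proof -
  have const: "b p = b q" if "P \<in> plaques X atlas" "p \<in> P" "q \<in> P" for P p q
  proof -
    obtain x s where x: "x \<in> J" "P = plaque x s" using \<open>P \<in> plaques X atlas\<close> unfolding plaques_atlas by blast
    show ?thesis
      by (rule flow_box_constant[OF box[OF x(1)] b]) (use that x(2) in \<open>auto simp: plaque_def\<close>)
  qed
  obtain P0 where P0: "P0 \<in> plaques X atlas" "L = \<Union> (meet\<^sup>* `` {P0})" using leafE[OF L] .
  obtain r where r: "r \<in> P0" using P0(1) unfolding plaques_atlas using plaque_nonempty by blast
  have "\<forall>p\<in>P. b p = b r" if "(P0, P) \<in> meet\<^sup>*" for P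
    using that
  proof (induction rule: rtrancl_induct)
    case base
    then show ?case using const[OF P0(1)] r by blast
  next
    case (step P Q)
    then obtain p where "p \<in> P" "p \<in> Q" "Q \<in> plaques X atlas" by (auto simp: meet_def)
    then show ?case using const[of Q _ p] step.IH by auto
  qed
  then have "\<forall>p\<in>L. b p = b r" using P0(2) by blast
  then show ?thesis using p by simp
qed

end

section \<open>Leaves as Lagrangian submanifolds\<close>

text \<open>Countable bases of the members of a countable open cover form together a countable base.\<close>

lemma second_countable_open_cover:
  assumes "countable \<P>" "\<And>P. P \<in> \<P> \<Longrightarrow> openin Y P" "\<Union>\<P> = topspace Y"
    and "\<And>P. P \<in> \<P> \<Longrightarrow> second_countable (subtopology Y P)"
  shows "second_countable Y"
proof -
  have "\<forall>P\<in>\<P>. \<exists>\<B>. countable \<B> \<and> (\<forall>V\<in>\<B>. openin (subtopology Y P) V) \<and>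
      (\<forall>U x. openin (subtopology Y P) U \<and> x \<in> U \<longrightarrow> (\<exists>V\<in>\<B>. x \<in> V \<and> V \<subseteq> U))"
    using assms(4) unfolding second_countable_def by blast
  from bchoice[OF this] obtain \<B> where *: "\<forall>P\<in>\<P>. countable (\<B> P) \<and>
      (\<forall>V\<in>\<B> P. openin (subtopology Y P) V) \<and>
      (\<forall>U x. openin (subtopology Y P) U \<and> x \<in> U \<longrightarrow> (\<exists>V\<in>\<B> P. x \<in> V \<and> V \<subseteq> U))" ..
  have \<B>: "countable (\<B> P)" "V \<in> \<B> P \<Longrightarrow> openin (subtopology Y P) V"
    "openin (subtopology Y P) U \<Longrightarrow> x \<in> U \<Longrightarrow> \<exists>V\<in>\<B> P. x \<in> V \<and> V \<subseteq> U" if "P \<in> \<P>" for P U V x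
    using bspec[OF * that] by auto
  show ?thesis
    unfolding second_countable_def
  proof (intro exI[of _ "\<Union>P\<in>\<P>. \<B> P"] conjI ballI allI impI)
    show "countable (\<Union>P\<in>\<P>. \<B> P)" using assms(1) \<B>(1) by blast
    show "openin Y V" if "V \<in> (\<Union>P\<in>\<P>. \<B> P)" for V
      using that \<B>(2) assms(2) openin_trans_full by blast
    fix U x assume U: "openin Y U \<and> x \<in> U"
    then have "x \<in> topspace Y" using openin_subset by blast
    then obtain P where P: "P \<in> \<P>" "x \<in> P" using assms(3) by blast
    have "openin (subtopology Y P) (U \<inter> P)" using U openin_subtopology by blast
    then obtain V where "V \<in> \<B> P" "x \<in> V" "V \<subseteq> U \<inter> P"
      using \<B>(3)[OF P(1)] U P(2) by blast
    then show "\<exists>V\<in>\<Union>P\<in>\<P>. \<B> P. x \<in> V \<and> V \<subseteq> U" using P(1) by blast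
  qed
qed

context coherent_flow_boxes
begin

lemma openin_plaque_Int:
  assumes "P \<in> plaques X atlas" "Q \<in> plaques X atlas"
  shows "openin (subtopology X P) (Q \<inter> P)"
proof -
  obtain x s y t where xy: "x \<in> J" "P = plaque x s" "y \<in> J" "Q = plaque y t"
    using assms unfolding plaques_atlas by blast
  show ?thesis
  proof (cases "P \<inter> Q = {}")
    case False
    then have "Q \<inter> P = U y \<inter> P" using plaque_Int[OF xy(1,3), of s t] xy by blast
    then show ?thesis using box_open[OF xy(3)] openin_subtopology by blast
  qed (simp add: Int_commute)
qed

context
  fixes L assumes L: "L \<in> leaves X atlas"
begin

lemma leaf_subset: "L \<subseteq> topspace X"
  using L unfolding leaves_def quotient_def by auto

text \<open>The traces of open sets on plaques generate the leaf topology, and a plaque traces an open set on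
  every other plaque. Hence a subset of a leaf is open iff its trace on each plaque is open there.\<close>

lemma openin_leaf:
  "openin (leaf_topology X atlas L) V \<longleftrightarrow>
    V \<subseteq> L \<and> (\<forall>P\<in>plaques X atlas. P \<subseteq> L \<longrightarrow> openin (subtopology X P) (V \<inter> P))"
proof
  assume "openin (leaf_topology X atlas L) V"
  then obtain T where T: "generate_topology_on {W \<inter> P |W P. openin X W \<and> P \<in> plaques X atlas} T" "V = T \<inter> L"
    unfolding leaf_topology_def openin_subtopology openin_topology_generated_by_iff by blast
  have "openin (subtopology X P) (T \<inter> P)" if P: "P \<in> plaques X atlas" for P
    using T(1)
  proof induction
    case (Int a b)
    have "openin (subtopology X P) ((a \<inter> P) \<inter> (b \<inter> P))" by (rule openin_Int[OF Int.IH])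
    moreover have "(a \<inter> P) \<inter> (b \<inter> P) = (a \<inter> b) \<inter> P" by blast
    ultimately show ?case by simp
  next
    case (UN K)
    have *: "\<Union>K \<inter> P = (\<Union>k\<in>K. k \<inter> P)" by blast
    show ?case unfolding * using UN.IH by (intro openin_Union) auto
  next
    case (Basis s)
    then obtain W Q where s: "openin X W" "Q \<in> plaques X atlas" "s = W \<inter> Q" by blast
    have "openin (subtopology X P) ((W \<inter> P) \<inter> (Q \<inter> P))"
      using openin_plaque_Int[OF P s(2)] s(1) openin_subtopology by blast
    moreover have "(W \<inter> P) \<inter> (Q \<inter> P) = s \<inter> P" using s(3) by blast
    ultimately show ?case by simp
  qed simp
  moreover have "V \<inter> P = T \<inter> P" if "P \<subseteq> L" for P using that T(2) by blast
  ultimately show "V \<subseteq> L \<and> (\<forall>P\<in>plaques X atlas. P \<subseteq> L \<longrightarrow> openin (subtopology X P) (V \<inter> P))"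
    using T(2) by simp
next
  assume V: "V \<subseteq> L \<and> (\<forall>P\<in>plaques X atlas. P \<subseteq> L \<longrightarrow> openin (subtopology X P) (V \<inter> P))"
  let ?\<B> = "{W \<inter> P |W P. openin X W \<and> P \<in> plaques X atlas}"
  have "openin (topology_generated_by ?\<B>) (V \<inter> P)" if "P \<in> plaques X atlas" "P \<subseteq> L" for P
  proof -
    obtain W where "openin X W" "V \<inter> P = W \<inter> P" using V \<open>P \<in> _\<close> \<open>P \<subseteq> L\<close> unfolding openin_subtopology by blast
    then show ?thesis using that(1) by (intro topology_generated_by_Basis) blast
  qed
  then have "openin (topology_generated_by ?\<B>) (\<Union>P\<in>{P \<in> plaques X atlas. P \<subseteq> L}. V \<inter> P)" by blast
  moreover have "(\<Union>P\<in>{P \<in> plaques X atlas. P \<subseteq> L}. V \<inter> P) = V \<inter> L"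
    using leaf_eq_Union[OF L] by blast
  ultimately have "openin (topology_generated_by ?\<B>) (V \<inter> L)" by simp
  moreover have "V = (V \<inter> L) \<inter> L" using V by blast
  ultimately show "openin (leaf_topology X atlas L) V"
    unfolding leaf_topology_def openin_subtopology by (intro exI[of _ "V \<inter> L"] conjI)
qed

lemma openin_leaf_Int: "openin X W \<Longrightarrow> openin (leaf_topology X atlas L) (W \<inter> L)"
  unfolding openin_leaf openin_subtopology by blast

lemma topspace_leaf: "topspace (leaf_topology X atlas L) = L"
proof
  show "topspace (leaf_topology X atlas L) \<subseteq> L" using openin_leaf[of "topspace _"] by blast
  have "openin (leaf_topology X atlas L) (topspace X \<inter> L)" by (rule openin_leaf_Int) simp
  then show "L \<subseteq> topspace (leaf_topology X atlas L)" using leaf_subset openin_subset by blast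
qed

lemma openin_leaf_plaque:
  assumes "P \<in> plaques X atlas" "P \<subseteq> L"
  shows "openin (leaf_topology X atlas L) P"
  unfolding openin_leaf using assms openin_plaque_Int by blast

lemma subtopology_leaf_plaque:
  assumes P: "P \<in> plaques X atlas" "P \<subseteq> L"
  shows "subtopology (leaf_topology X atlas L) P = subtopology X P"
proof (rule topology_eq[THEN iffD2], rule allI)
  fix T
  have "openin (subtopology X P) T" if "openin (subtopology (leaf_topology X atlas L) P) T"
    using that P unfolding openin_subtopology[of "leaf_topology X atlas L"] openin_leaf by blast
  moreover have "openin (subtopology (leaf_topology X atlas L) P) T" if T: "openin (subtopology X P) T"
  proof -
    obtain W where W: "openin X W" "T = W \<inter> P" using T unfolding openin_subtopology by blast
    then have "T = (W \<inter> L) \<inter> P" using P(2) by blast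
    then show ?thesis using openin_leaf_Int[OF W(1)] unfolding openin_subtopology by blast
  qed
  ultimately show "openin (subtopology (leaf_topology X atlas L) P) T = openin (subtopology X P) T" by blast
qed

lemma continuous_map_leaf_inclusion: "continuous_map (leaf_topology X atlas L) X id"
proof -
  have "{x \<in> L. x \<in> W} = W \<inter> L" for W by blast
  then show ?thesis
    unfolding continuous_map_def topspace_leaf using openin_leaf_Int leaf_subset by auto
qed

lemma Hausdorff_leaf: "Hausdorff_space (leaf_topology X atlas L)"
  using Hausdorff_space_injective_preimage[OF _ continuous_map_leaf_inclusion] smooth_manifold
  by (simp add: smooth_manifold_def)

lemma second_countable_leaf: "second_countable (leaf_topology X atlas L)"
proof (rule second_countable_open_cover[OF countable_leaf_plaques[OF L]])
  show "\<Union> {P \<in> plaques X atlas. P \<subseteq> L} = topspace (leaf_topology X atlas L)"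
    unfolding topspace_leaf using leaf_eq_Union[OF L] by simp
  show "openin (leaf_topology X atlas L) P" if "P \<in> {P \<in> plaques X atlas. P \<subseteq> L}" for P
    using that openin_leaf_plaque by blast
  show "second_countable (subtopology (leaf_topology X atlas L) P)" if "P \<in> {P \<in> plaques X atlas. P \<subseteq> L}" for P
    using that subtopology_leaf_plaque smooth_manifold
    by (simp add: smooth_manifold_def second_countable_subtopology)
qed

end

definition leaf_atlas :: "'m set \<Rightarrow> ('m, 'n) chart set" where
  "leaf_atlas L = {(plaque x s, \<lambda>q. snd (G x q)) |x s. x \<in> J \<and> s \<in> B x \<and> plaque x s \<subseteq> L}"

text \<open>The slices \<open>z \<mapsto> E x (s, z)\<close> are the inverses of the charts of the leaves.\<close>

lemma smooth_param_slice:
  assumes "x \<in> J" "s \<in> B x"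
  shows "smooth_param X A (C x) (\<lambda>z. E x (s, z))"
proof (rule smooth_param_reparametrize[OF box_smooth(2)[OF assms(1)] box_sides(2)[OF assms(1)]])
  show "smooth_on (C x) (\<lambda>z. (s, z))"
    by (rule smooth_on_Pair[OF box_sides(2)[OF assms(1)] smooth_on_const
          smooth_on_bounded_linear[OF bounded_linear_ident]])
qed (use assms(2) in auto)

lemma plaque_chart:
  assumes "x \<in> J" "s \<in> B x"
  shows "(\<lambda>q. snd (G x q)) ` plaque x s = C x"
    and "z \<in> C x \<Longrightarrow> inv_chart (plaque x s, \<lambda>q. snd (G x q)) z = E x (s, z)"
proof -
  note in' = box_in(4,5)[OF assms(1,2)]
  show "(\<lambda>q. snd (G x q)) ` plaque x s = C x"
    unfolding plaque_eq_image[OF assms] image_image using in' by force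
  have inj: "inj_on (\<lambda>q. snd (G x q)) (plaque x s)"
    unfolding plaque_eq_image[OF assms] by (rule inj_onI) (use in' in auto)
  assume z: "z \<in> C x"
  then have "E x (s, z) \<in> plaque x s" unfolding plaque_eq_image[OF assms] by blast
  then show "inv_chart (plaque x s, \<lambda>q. snd (G x q)) z = E x (s, z)"
    unfolding inv_chart_def fst_conv snd_conv using inv_into_f_eq[OF inj] in' z by simp
qed

lemma homeomorphic_map_plaque:
  assumes "x \<in> J" "s \<in> B x"
  shows "homeomorphic_map (subtopology X (plaque x s)) (top_of_set (C x)) (\<lambda>q. snd (G x q))"
proof -
  note in' = box_in(4,5)[OF assms(1,2)]
  have ts: "topspace (subtopology X (plaque x s)) = plaque x s" using plaque_subset[OF assms(1)] by auto
  have "continuous_map (subtopology X (U x)) (top_of_set (B x \<times> C x)) (G x)"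
    using box_coords[OF assms(1)] by (simp add: local_coords_def homeomorphic_maps_def)
  then have "continuous_map (subtopology X (U x)) euclidean (G x)"
    using continuous_map_in_subtopology by blast
  moreover have "continuous_map euclidean euclidean (snd :: (real ^ 'n) \<times> (real ^ 'n) \<Rightarrow> _)"
    by (simp add: continuous_on_snd continuous_on_id)
  ultimately have "continuous_map (subtopology X (U x)) euclidean (snd \<circ> G x)"
    by (rule continuous_map_compose)
  then have "continuous_map (subtopology X (plaque x s)) euclidean (snd \<circ> G x)"
    by (rule continuous_map_from_subtopology_mono) (auto simp: plaque_def)
  then have 1: "continuous_map (subtopology X (plaque x s)) (top_of_set (C x)) (\<lambda>q. snd (G x q))"
    using plaque_chart(1)[OF assms] ts by (simp add: continuous_map_in_subtopology o_def image_subset_iff_funcset [symmetric])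
  have 2: "continuous_map (top_of_set (C x)) (subtopology X (plaque x s)) (\<lambda>z. E x (s, z))"
    using continuous_map_slice[OF assms] plaque_eq_image[OF assms]
    by (simp add: continuous_map_in_subtopology image_subset_iff_funcset [symmetric])
  have "homeomorphic_maps (subtopology X (plaque x s)) (top_of_set (C x)) (\<lambda>q. snd (G x q)) (\<lambda>z. E x (s, z))"
    unfolding homeomorphic_maps_def ts using 1 2 in' plaque_eq_image[OF assms] by auto
  then show ?thesis using homeomorphic_map_maps by blast
qed

text \<open>The differential of \<open>G x\<close> is a left inverse of the derivative of \<open>E x\<close>, which gives injectivity.\<close>

lemma slice_derivative:
  assumes "x \<in> J" "s \<in> B x" "z \<in> C x"
  shows "param_derivative A (\<lambda>z. E x (s, z)) z v = param_derivative A (E x) (s, z) (0, v)"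
    and "inj (param_derivative A (\<lambda>z. E x (s, z)) z)"
proof -
  have w: "(s, z) \<in> B x \<times> C x" using assms by blast
  have p: "E x (s, z) \<in> U x" using box_in(4) assms by blast
  then have pt: "E x (s, z) \<in> topspace X" using box_subset[OF assms(1)] by blast
  define c where "c = chart_at A (E x (s, z))"
  have c: "c \<in> A" "E x (s, z) \<in> fst c" using chart_around[OF pt] by (auto simp: c_def)
  have "smooth_on {w \<in> B x \<times> C x. E x w \<in> fst c} (snd c \<circ> E x)"
    using box_smooth(2)[OF assms(1)] c(1) by (auto simp: smooth_param_def)
  then have "(snd c \<circ> E x has_derivative param_derivative A (E x) (s, z)) (at (s, z))"
    unfolding param_derivative_def c_def[symmetric]
    by (rule smooth_on_has_derivative) (use w c in auto)
  moreover have "((\<lambda>z. (s, z)) has_derivative (\<lambda>v. (0, v))) (at z)"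
    by (auto intro!: derivative_eq_intros)
  ultimately have "(snd c \<circ> E x \<circ> (\<lambda>z. (s, z)) has_derivative
      param_derivative A (E x) (s, z) \<circ> (\<lambda>v. (0, v))) (at z)"
    by (rule diff_chain_at[rotated])
  then have "(snd c \<circ> (\<lambda>z. E x (s, z)) has_derivative (\<lambda>v. param_derivative A (E x) (s, z) (0, v))) (at z)"
    by (simp add: o_def)
  from frechet_derivative_at[OF this]
  have eq: "param_derivative A (\<lambda>z. E x (s, z)) z = (\<lambda>v. param_derivative A (E x) (s, z) (0, v))"
    by (simp add: param_derivative_def c_def)
  then show "param_derivative A (\<lambda>z. E x (s, z)) z v = param_derivative A (E x) (s, z) (0, v)" by simp
  let ?d = "differential A (G x) (E x (s, z))"
  have "(G x \<circ> E x has_derivative (\<lambda>v. ?d (param_derivative A (E x) (s, z) v))) (at (s, z))"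
    by (rule differential_chain[OF box_smooth(2)[OF assms(1)] w box_open[OF assms(1)] box_smooth(1)[OF assms(1)] p])
  moreover have "(G x \<circ> E x has_derivative (\<lambda>v. v)) (at (s, z))"
    by (rule has_derivative_transform_within_open[OF has_derivative_ident open_Times[OF box_sides(1,2)[OF assms(1)]] w])
      (use box_in(5)[OF assms(1)] in auto)
  ultimately have "(\<lambda>v. ?d (param_derivative A (E x) (s, z) v)) = (\<lambda>v. v)"
    by (rule has_derivative_unique)
  then have left: "?d (param_derivative A (E x) (s, z) v) = v" for v by (rule fun_cong)
  show "inj (param_derivative A (\<lambda>z. E x (s, z)) z)"
  proof (rule inj_on_inverseI)
    fix v show "snd (?d (param_derivative A (\<lambda>z. E x (s, z)) z v)) = v"
      by (simp only: eq left snd_conv)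
  qed
qed

context
  fixes L assumes L: "L \<in> leaves X atlas"
begin

text \<open>Where two plaques meet, the transition map is the second coordinate of one box along a slice of the
  other one.\<close>

lemma smooth_manifold_leaf: "smooth_manifold (leaf_topology X atlas L) (leaf_atlas L)"
  unfolding smooth_manifold_def
proof (intro conjI ballI)
  show "Hausdorff_space (leaf_topology X atlas L)" "second_countable (leaf_topology X atlas L)"
    using Hausdorff_leaf[OF L] second_countable_leaf[OF L] by auto
  show "is_chart (leaf_topology X atlas L) c" if mem: "c \<in> leaf_atlas L" for c
  proof -
    obtain x s where c: "c = (plaque x s, \<lambda>q. snd (G x q))" "x \<in> J" "s \<in> B x" "plaque x s \<subseteq> L"
      using mem unfolding leaf_atlas_def by blast
    then have P: "plaque x s \<in> plaques X atlas" unfolding plaques_atlas by blast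
    show ?thesis
      unfolding is_chart_def c(1) fst_conv snd_conv plaque_chart(1)[OF c(2,3)]
        subtopology_leaf_plaque[OF L P c(4)]
      using openin_leaf_plaque[OF L P c(4)] box_sides(2)[OF c(2)] homeomorphic_map_plaque[OF c(2,3)] by blast
  qed
  have "(\<Union>c\<in>leaf_atlas L. fst c) = \<Union> {P \<in> plaques X atlas. P \<subseteq> L}"
    unfolding leaf_atlas_def plaques_atlas by auto blast+
  then show "(\<Union>c\<in>leaf_atlas L. fst c) = topspace (leaf_topology X atlas L)"
    unfolding topspace_leaf[OF L] using leaf_eq_Union[OF L] by simp
  fix c c' assume "c \<in> leaf_atlas L" "c' \<in> leaf_atlas L"
  then obtain x s y t where c: "c = (plaque x s, \<lambda>q. snd (G x q))" "x \<in> J" "s \<in> B x"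
    and c': "c' = (plaque y t, \<lambda>q. snd (G y q))" "y \<in> J" "t \<in> B y"
    unfolding leaf_atlas_def by blast
  note in' = box_in(4,5)[OF c(2,3)]
  show "smooth_on (snd c ` (fst c \<inter> fst c')) (snd c' \<circ> inv_chart c)"
  proof (cases "plaque x s \<inter> plaque y t = {}")
    case True
    then show ?thesis unfolding c c' by (auto intro: smooth_on_local)
  next
    case False
    have I: "plaque x s \<inter> plaque y t = plaque x s \<inter> U y" by (rule plaque_Int[OF c(2) c'(2) False])
    let ?N = "{z \<in> C x. E x (s, z) \<in> U y}"
    have N: "snd c ` (fst c \<inter> fst c') = ?N"
    proof -
      have "plaque x s \<inter> U y = (\<lambda>z. E x (s, z)) ` ?N" unfolding plaque_eq_image[OF c(2,3)] by blast
      then show ?thesis unfolding c c' fst_conv snd_conv I using in' by (force simp: image_image)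
    qed
    have o: "open ?N" by (rule smooth_param_open_preimage[OF smooth_param_slice[OF c(2,3)] box_open[OF c'(2)]])
    have "smooth_on ?N ((\<lambda>q. snd (G y q)) \<circ> (\<lambda>z. E x (s, z)))"
      by (rule smooth_param_compose[OF smooth_param_subset[OF smooth_param_slice[OF c(2,3)] o]
            box_open[OF c'(2)] smooth_second_coords[OF c'(2)]]) auto
    then show ?thesis
      unfolding N by (rule smooth_on_transform[OF _ o]) (use plaque_chart(2)[OF c(2,3)] c c' in simp)
  qed
qed

lemma smooth_map_leaf_inclusion: "smooth_map (leaf_topology X atlas L) (leaf_atlas L) X A id"
  unfolding smooth_map_def
proof (intro conjI ballI)
  show "continuous_map (leaf_topology X atlas L) X id" by (rule continuous_map_leaf_inclusion[OF L])
  fix c c' assume "c \<in> leaf_atlas L" and c': "c' \<in> A"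
  then obtain x s where c: "c = (plaque x s, \<lambda>q. snd (G x q))" "x \<in> J" "s \<in> B x"
    unfolding leaf_atlas_def by blast
  note in' = box_in(4,5)[OF c(2,3)]
  let ?N = "{z \<in> C x. E x (s, z) \<in> fst c'}"
  have o: "open ?N" "smooth_on ?N (snd c' \<circ> (\<lambda>z. E x (s, z)))"
    using smooth_param_slice[OF c(2,3)] c' by (auto simp: smooth_param_def)
  have "plaque x s \<inter> fst c' = (\<lambda>z. E x (s, z)) ` ?N" unfolding plaque_eq_image[OF c(2,3)] by blast
  then have N: "snd c ` (fst c \<inter> id -` fst c') = ?N"
    unfolding c fst_conv snd_conv using in' by (force simp: image_image)
  show "smooth_on (snd c ` (fst c \<inter> id -` fst c')) (snd c' \<circ> id \<circ> inv_chart c)"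
    unfolding N by (rule smooth_on_transform[OF o(2,1)]) (use plaque_chart(2)[OF c(2,3)] c in simp)
qed

text \<open>The tangent map is taken in the chosen chart of the leaf, whose inverse is a slice of some box.\<close>

lemma tangent_map_leaf_inclusion:
  assumes "p \<in> L"
  obtains x s z where "x \<in> J" "s \<in> B x" "z \<in> C x" "p = E x (s, z)"
    "tangent_map (leaf_atlas L) A id p = param_derivative A (\<lambda>z. E x (s, z)) z"
proof -
  interpret leaf: manifold "leaf_topology X atlas L" "leaf_atlas L"
    by standard (rule smooth_manifold_leaf)
  define c where "c = chart_at (leaf_atlas L) p"
  have "c \<in> leaf_atlas L" "p \<in> fst c"
    using leaf.chart_around[of p] assms topspace_leaf[OF L] by (auto simp: c_def)
  then obtain x s where c: "c = (plaque x s, \<lambda>q. snd (G x q))" "x \<in> J" "s \<in> B x" and p: "p \<in> plaque x s"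
    unfolding leaf_atlas_def by auto
  let ?z = "snd (G x p)"
  have pU: "p \<in> U x" "G x p = (s, ?z)" using p by (auto simp: plaque_def prod_eq_iff)
  then have z: "?z \<in> C x" "p = E x (s, ?z)" using box_in(2,3)[OF c(2) pU(1)] by auto
  let ?f = "snd (chart_at A p)"
  have "E x (s, ?z) \<in> fst (chart_at A p)" "chart_at A p \<in> A"
    using chart_around[of p] z(2) pU(1) box_subset[OF c(2)] by auto
  then have "(?f \<circ> (\<lambda>z. E x (s, z)) has_derivative
      frechet_derivative (?f \<circ> (\<lambda>z. E x (s, z))) (at ?z)) (at ?z)"
    using smooth_param_slice[OF c(2,3)] z(1)
    by (intro smooth_on_has_derivative[of "{z \<in> C x. E x (s, z) \<in> fst (chart_at A p)}"])
      (auto simp: smooth_param_def)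
  then have "(?f \<circ> id \<circ> inv_chart c has_derivative
      frechet_derivative (?f \<circ> (\<lambda>z. E x (s, z))) (at ?z)) (at ?z)"
    by (rule has_derivative_transform_within_open[OF _ box_sides(2)[OF c(2)] z(1)])
      (use plaque_chart(2)[OF c(2,3)] c in simp)
  from frechet_derivative_at[OF this]
  have "frechet_derivative (?f \<circ> id \<circ> inv_chart c) (at ?z) = param_derivative A (\<lambda>z. E x (s, z)) ?z"
    using z(2) by (simp add: param_derivative_def)
  moreover have "tangent_map (leaf_atlas L) A id p = frechet_derivative (?f \<circ> id \<circ> inv_chart c) (at ?z)"
    unfolding tangent_map_def differential_def c_def[symmetric] by (simp add: c(1))
  ultimately have "tangent_map (leaf_atlas L) A id p = param_derivative A (\<lambda>z. E x (s, z)) ?z" by simp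
  then show ?thesis by (rule that[OF c(2,3) z])
qed

text \<open>The tangent vectors of a leaf are the vectors \<open>(0, v)\<close> of adapted coordinates, on which \<open>\<omega>\<close>
  vanishes.\<close>

lemma lagrangian_leaf: "lagrangian_submanifold X A \<omega> (leaf_topology X atlas L) (leaf_atlas L)"
  unfolding lagrangian_submanifold_def immersed_submanifold_def topspace_leaf[OF L]
proof (intro conjI ballI allI)
  fix p assume p: "p \<in> L"
  obtain x s z where x: "x \<in> J" "s \<in> B x" "z \<in> C x" "p = E x (s, z)"
    and T: "tangent_map (leaf_atlas L) A id p = param_derivative A (\<lambda>z. E x (s, z)) z"
    using tangent_map_leaf_inclusion[OF p] .
  show "inj (tangent_map (leaf_atlas L) A id p)"
    unfolding T by (rule slice_derivative(2)[OF x(1-3)])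
  show "\<omega> p (tangent_map (leaf_atlas L) A id p u) (tangent_map (leaf_atlas L) A id p v) = 0" for u v
    unfolding T slice_derivative(1)[OF x(1-3)] unfolding x(4)
    by (rule adapted_slice_derivative(1)[OF box_adapted[OF x(1)]]) (use x in blast)
next
  obtain x where "x \<in> J" using leafE[OF L] unfolding plaques_atlas by blast
  then show "CARD('d) = 2 * CARD('n)" using box_adapted unfolding adapted_def by blast
qed (fact smooth_manifold_leaf leaf_subset[OF L] smooth_map_leaf_inclusion)+

end

end

section \<open>Existence of the foliation\<close>

theorem theorem1p1:
  fixes X :: "'m topology"
    and A :: "('m, 'd::finite) chart set"
    and \<omega> :: "('m, 'd) form2"
    and \<A> :: "('m \<Rightarrow> complex) set"
  assumes M: "symplectic_manifold X A \<omega>"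
    and dim: "CARD('d) = 2 * CARD('n::finite)"
    and smooth: "\<A> \<subseteq> smooth_functions X A"
    and subspace: "complex_function_subspace \<A>"
    and conj_closed: "\<forall>a\<in>\<A>. (\<lambda>p. cnj (a p)) \<in> \<A>"
    and commutative: "\<forall>a\<in>\<A>. \<forall>b\<in>\<A>. \<forall>p\<in>topspace X. poisson_bracket X A \<omega> a b p = 0"
    and independent: "\<forall>p\<in>topspace X. \<exists>a :: 'n \<Rightarrow> 'm \<Rightarrow> complex.
          (\<forall>i. a i \<in> \<A> \<and> (\<forall>q\<in>topspace X. a i q \<in> \<real>)) \<and>
          real_independent_family (\<lambda>i. differential A (a i) p)"
  shows "\<exists>F :: ('m, 'n) fchart set.
          lagrangian_foliation X A \<omega> F \<and> \<A> \<subseteq> leafwise_constant_functions X A F"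
proof -
  interpret commuting_functions X A \<omega> \<A>
    using M smooth commutative by unfold_locales (simp_all add: symplectic_manifold_def)
  have "\<exists>W \<Omega> (G :: 'm \<Rightarrow> (real ^ 'n) \<times> (real ^ 'n)) E. adapted W \<Omega> G E \<and> p \<in> W"
    if p: "p \<in> topspace X" for p
  proof -
    from independent p obtain a :: "'n \<Rightarrow> 'm \<Rightarrow> complex"
      where "\<And>i. a i \<in> \<A>" "\<And>i q. q \<in> topspace X \<Longrightarrow> a i q \<in> \<real>"
        "real_independent_family (\<lambda>i. differential A (a i) p)" by blast
    then show ?thesis by (rule ex_adapted[OF dim p])
  qed
  from ex_coherent_flow_boxes[OF this]
  obtain J U B C and G :: "'m \<Rightarrow> 'm \<Rightarrow> (real ^ 'n) \<times> (real ^ 'n)" and E where boxes: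
    "countable J" "(\<Union>x\<in>J. U x) = topspace X"
    "\<And>x. x \<in> J \<Longrightarrow> flow_box (U x) (B x) (C x) (G x) (E x)"
    "\<And>x y p q. x \<in> J \<Longrightarrow> y \<in> J \<Longrightarrow> p \<in> U x \<inter> U y \<Longrightarrow> q \<in> U x \<inter> U y \<Longrightarrow>
      fst (G x p) = fst (G x q) \<longleftrightarrow> fst (G y p) = fst (G y q)"
    by (metis (no_types, lifting))
  interpret coherent_flow_boxes X A \<omega> \<A> J U B C G E
    by unfold_locales (fact boxes)+
  have "lagrangian_foliation X A \<omega> atlas"
    unfolding lagrangian_foliation_def using foliated_atlas lagrangian_leaf by blast
  moreover have "\<A> \<subseteq> leafwise_constant_functions X A atlas"
    unfolding leafwise_constant_functions_def using smooth constant_on_leaf by blast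
  ultimately show ?thesis by blast
qed

end
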